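(* Let $(V,q)$ be a commutative (associative) algebra and $M$ a $(V,q)$-module, viewed as a bimodule with coinciding left and right actions ($V$, $M$ finite-dimensional graded, $|q|=0$), and let $(\tilde V,\tilde b,\tilde q)$ be the quadratic algebra obtained as double semidirect product of $V$ by $M$. Consider the map $c\mapsto\Omega_{\tilde C}$ associating to any multilinear mapping $c:V^k\to M$ of degree $2-k$, vanishing on shuffle products, the cyclic form $\Omega_{\tilde C}$ on $\tilde V[1]$. Then this map is a complex morphism between the Harrison cohomology for the $(V,q)$-bimodule $M$ and the Pinczon cohomology of cyclic forms $\mathcal C(\tilde V)$ on $\tilde V$, i.e. $$d_P\,\Omega_{\tilde C}=\{\Omega_{\tilde Q},\Omega_{\tilde C}\}=\Omega_{\widetilde{(d_{Ha}c)[1]}} .$$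
   Context: The ground field has characteristic $0$. $|x|$ is the degree in $V$, and $V[1]$ is $V$ with degree $\deg(x)=|x|-1$. All formulas use Koszul's sign rule: in any relation between homogeneous objects, the first term has sign $+$ and every other term is implicitly multiplied by the sign of the permutation of the odd letters (vectors, maps, forms) relating it to the first term. To a $k$-linear map $q:V^k\to W$ one associates the shifted map (capital letter, also denoted $q[1]$) $Q(x_1,\dots,x_k)=(-1)^{\sum_{j}(k-j)\deg x_j}q(x_1,\dots,x_k)$ on $V[1]$, of degree $|q|+k-1$. To a bilinear form $b$ one associates $B(x,y)=(-1)^{\deg x}b(x,y)$ on $V[1]$. Shuffles. $sh_{p,q}(x_1\otimes\dots\otimes x_p,x_{p+1}\otimes\dots\otimes x_{p+q})=\sum_\sigma x_{\sigma^{-1}(1)}\otimes\dots\otimes x_{\sigma^{-1}(p+q)}$ in $\otimes^{p+q}V[1]$, over $\sigma\in\mathfrak S_{p+q}$ increasing on $\{1,\dots,p\}$ and on $\{p+1,\dots,p+q\}$. $c$ vanishes on shuffle products if its shifted map $C$ vanishes on the image of $sh_{p,k-p}$ for $0<p<k$. Double semidirect product. $W=V\rtimes M$ is $V\times M$ with $q_W((x,a),(y,b))=(xy,\,x\cdot b+a\cdot y)$, where $xy=q(x,y)$. $W^\star=V^\star\times M^\star$ is a $W$-bimodule by $((x,a)\cdot f)(w)=f(w(x,a))$, $(f\cdot(x,a))(w)=f((x,a)w)$; for $f=(g,h)$ this is written $(x,a)\cdot(g,h)=(x\cdot g+a\cdot h,\,x\cdot h)$ and $(g,h)\cdot(x,a)=(g\cdot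 x+h\cdot a,\,h\cdot x)$. $\tilde V=W\times W^\star$ has the (commutative) product $$\tilde q((x,a,g,h),(x',a',g',h'))=(xx',\,xa'+ax',\,x\cdot g'+g\cdot x'+a\cdot h'+h\cdot a',\,x\cdot h'+h\cdot x')$$ and the form $\tilde b((x,a,g,h),(x',a',g',h'))=g(x')+h(a')+g'(x)+h'(a)$. $\tilde Q,\tilde B$ are the shifted versions. The map. For $c:V^k\to M$ with shifted map $C$ (any homogeneous degree), $\tilde C:\tilde V[1]^k\to\tilde V[1]$ is $$\tilde C((x_1,a_1,g_1,h_1),\dots,(x_k,a_k,g_k,h_k))=\Big(0,\,C(x_1,\dots,x_k),\,\sum_jC_j(x_1,\dots,h_j,\dots,x_k),\,0\Big),$$ $C_j(x_1,\dots,h_j,\dots,x_k)=h_j(C(x_{j+1},\dots,x_k,\,\cdot\,,x_1,\dots,x_{j-1}))\in V^\star$. Forms and operators. For $F:\tilde V[1]^k\to\tilde V[1]$, $\Omega_F(v_1,\dots,v_{k+1})=\tilde B(F(v_1,\dots,v_k),v_{k+1})$. $\mathcal C(\tilde V)$ is the space of cyclic forms $\Omega$ on $\tilde V[1]$: $\Omega(v_{k+1},v_1,\dots,v_k)=\Omega(v_1,\dots,v_{k+1})$. The Pinczon bracket associated to $\tilde b$ is $\{\Omega,\Omega'\}=\sum_i\big(\iota_{e_i}\Omega\otimes\iota_{e'_i}\Omega'\big)^{Cycl}$, where $(e_i),(e_i')$ are homogeneous bases of $\tilde V$ with $\tilde b(e_i,e'_j)=\delta_{ij}$, $\iota$ is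 insertion in the first slot and $Cycl$ means sum over all cyclic permutations of the variables. $d_P=\{\Omega_{\tilde Q},\cdot\}$. The Harrison coboundary $d_{Ha}$ is the restriction of the Hochschild coboundary $d_H$ to cochains vanishing on shuffle products, where on shifted maps $(d_Hc)[1](x_1,\dots,x_{k+1})=Q_W(C(x_1,\dots,x_k),x_{k+1})+Q_W(x_1,C(x_2,\dots,x_{k+1}))-\sum_{j=1}^kC(x_1,\dots,Q(x_j,x_{j+1}),\dots,x_{k+1})$ with Koszul signs, $Q_W$ being the shifted map of $q_W$. *)

theory Defs
  imports
    Complex_Main
    "HOL-Library.Function_Algebras"
    "HOL-Library.Product_Plus"
    "HOL-Combinatorics.Permutations"
begin

text \<open>
  A graded vector space is a type with a scalar multiplication and the family \<open>G\<close> of its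
  homogeneous subspaces; \<open>G n\<close> is the part of degree \<open>n\<close>. A \<open>k\<close>-linear map takes its arguments as
  a list of length \<open>k\<close>; its values on lists of other lengths are never used.
  Formulas involving Koszul signs are written for homogeneous arguments and extended
  (multi)linearly by \<open>hsum\<close> and \<open>hsums\<close>, which sum over homogeneous components.
  Throughout, \<open>\<bar>x\<bar>\<close> is the degree and \<open>deg x = \<bar>x\<bar> - 1\<close> the shifted degree.
\<close>

definition sg :: "int \<Rightarrow> 'a::ab_group_add \<Rightarrow> 'a" where
  "sg n x = (if even n then x else - x)"

definition is_hdecomp :: "(int \<Rightarrow> 'a::ab_group_add set) \<Rightarrow> 'a \<Rightarrow> (int \<Rightarrow> 'a) \<Rightarrow> bool" where
  "is_hdecomp G v c \<longleftrightarrow>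
     finite {n. c n \<noteq> 0} \<and> (\<forall>n. c n \<in> G n) \<and> (\<Sum>n | c n \<noteq> 0. c n) = v"

definition hcomp :: "(int \<Rightarrow> 'a::ab_group_add set) \<Rightarrow> 'a \<Rightarrow> int \<Rightarrow> 'a" where
  "hcomp G v = (THE c. is_hdecomp G v c)"

definition hsum ::
  "(int \<Rightarrow> 'a::ab_group_add set) \<Rightarrow> (int \<Rightarrow> 'a \<Rightarrow> 'b::comm_monoid_add) \<Rightarrow> 'a \<Rightarrow> 'b" where
  "hsum G F v = (\<Sum>n | hcomp G v n \<noteq> 0. F n (hcomp G v n))"

primrec hsums ::
  "(int \<Rightarrow> 'a::ab_group_add set) \<Rightarrow> (int list \<Rightarrow> 'a list \<Rightarrow> 'b::comm_monoid_add) \<Rightarrow> 'a list \<Rightarrow> 'b"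
where
  "hsums G F [] = F [] []"
| "hsums G F (v # vs) = hsum G (\<lambda>n x. hsums G (\<lambda>ns xs. F (n # ns) (x # xs)) vs) v"

definition homogeneous :: "(int \<Rightarrow> 'a set) \<Rightarrow> int list \<Rightarrow> 'a list \<Rightarrow> bool" where
  "homogeneous G ns vs \<longleftrightarrow> list_all2 (\<lambda>n v. v \<in> G n) ns vs"

text \<open>Total shifted degree of vectors of degrees \<open>ns\<close>.\<close>

definition sdeg :: "int list \<Rightarrow> int" where
  "sdeg ns = (\<Sum>n\<leftarrow>ns. n - 1)"

definition fd_graded_space ::
  "('k::field \<Rightarrow> 'v::ab_group_add \<Rightarrow> 'v) \<Rightarrow> (int \<Rightarrow> 'v set) \<Rightarrow> bool" where
  "fd_graded_space s G \<longleftrightarrow>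
     (\<exists>B. finite_dimensional_vector_space s B) \<and>
     (\<forall>n. module.subspace s (G n)) \<and> (\<forall>v. \<exists>!c. is_hdecomp G v c)"

definition dual :: "('k::field \<Rightarrow> 'v::ab_group_add \<Rightarrow> 'v) \<Rightarrow> ('v \<Rightarrow> 'k) set" where
  "dual s = {f. Vector_Spaces.linear s (*) f}"

definition dual_gr ::
  "('k::field \<Rightarrow> 'v::ab_group_add \<Rightarrow> 'v) \<Rightarrow> (int \<Rightarrow> 'v set) \<Rightarrow> int \<Rightarrow> ('v \<Rightarrow> 'k) set" where
  "dual_gr s G n = {f \<in> dual s. \<forall>m. m \<noteq> - n \<longrightarrow> (\<forall>x\<in>G m. f x = 0)}"

definition multilinear_on ::
  "'a::ab_group_add set \<Rightarrow> ('k \<Rightarrow> 'a \<Rightarrow> 'a) \<Rightarrow> ('k \<Rightarrow> 'b::ab_group_add \<Rightarrow> 'b) \<Rightarrow>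
   nat \<Rightarrow> ('a list \<Rightarrow> 'b) \<Rightarrow> bool" where
  "multilinear_on S s t n f \<longleftrightarrow>
     (\<forall>us ws. set us \<subseteq> S \<and> set ws \<subseteq> S \<and> length us + length ws + 1 = n \<longrightarrow>
        (\<forall>v\<in>S. \<forall>w\<in>S. f (us @ (v + w) # ws) = f (us @ v # ws) + f (us @ w # ws)) \<and>
        (\<forall>a. \<forall>v\<in>S. f (us @ s a v # ws) = t a (f (us @ v # ws))))"

text \<open>The shifted map \<open>q[1]\<close>, with \<open>k - j\<close> for \<open>j = 1, \<dots>, k\<close> written \<open>k - Suc j\<close> for \<open>j < k\<close>.\<close>

definition shift_map ::
  "(int \<Rightarrow> 'a::ab_group_add set) \<Rightarrow> ('a list \<Rightarrow> 'b::ab_group_add) \<Rightarrow> 'a list \<Rightarrow> 'b" where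
  "shift_map G f =
     hsums G (\<lambda>ns xs. sg (\<Sum>j<length ns. int (length ns - Suc j) * (ns ! j - 1)) (f xs))"

definition shift_form ::
  "(int \<Rightarrow> 'a::ab_group_add set) \<Rightarrow> ('a \<Rightarrow> 'a \<Rightarrow> 'b::ab_group_add) \<Rightarrow> 'a \<Rightarrow> 'a \<Rightarrow> 'b" where
  "shift_form G b x y = hsum G (\<lambda>n x. sg (n - 1) (b x y)) x"


record ('k, 'v, 'm) alg_mod =
  scV :: "'k \<Rightarrow> 'v \<Rightarrow> 'v"
  scM :: "'k \<Rightarrow> 'm \<Rightarrow> 'm"
  grV :: "int \<Rightarrow> 'v set"
  grM :: "int \<Rightarrow> 'm set"
  mul :: "'v \<Rightarrow> 'v \<Rightarrow> 'v"
  act :: "'v \<Rightarrow> 'm \<Rightarrow> 'm"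

definition comm_alg_mod ::
  "('k::field_char_0, 'v::ab_group_add, 'm::ab_group_add) alg_mod \<Rightarrow> bool" where
  "comm_alg_mod D \<longleftrightarrow>
     fd_graded_space (scV D) (grV D) \<and> fd_graded_space (scM D) (grM D) \<and>
     (\<forall>x. Vector_Spaces.linear (scV D) (scV D) (mul D x)) \<and>
     (\<forall>y. Vector_Spaces.linear (scV D) (scV D) (\<lambda>x. mul D x y)) \<and>
     (\<forall>m n. \<forall>x\<in>grV D m. \<forall>y\<in>grV D n. mul D x y \<in> grV D (m + n)) \<and>
     (\<forall>x y z. mul D (mul D x y) z = mul D x (mul D y z)) \<and>
     (\<forall>m n. \<forall>x\<in>grV D m. \<forall>y\<in>grV D n. mul D x y = sg (m * n) (mul D y x)) \<and>
     (\<forall>x. Vector_Spaces.linear (scM D) (scM D) (act D x)) \<and>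
     (\<forall>a. Vector_Spaces.linear (scV D) (scM D) (\<lambda>x. act D x a)) \<and>
     (\<forall>m n. \<forall>x\<in>grV D m. \<forall>a\<in>grM D n. act D x a \<in> grM D (m + n)) \<and>
     (\<forall>x y a. act D (mul D x y) a = act D x (act D y a))"

text \<open>The right action coincides with the left one: \<open>a \<cdot> x = (-1)\<^bsup>\<bar>a\<bar>\<bar>x\<bar>\<^esup> x \<cdot> a\<close>.\<close>

definition ract ::
  "('k, 'v::ab_group_add, 'm::ab_group_add, 'z) alg_mod_scheme \<Rightarrow> 'm \<Rightarrow> 'v \<Rightarrow> 'm" where
  "ract D a x = hsum (grM D) (\<lambda>m a. hsum (grV D) (\<lambda>n x. sg (m * n) (act D x a)) x) a"

definition grW ::
  "('k, 'v, 'm, 'z) alg_mod_scheme \<Rightarrow> int \<Rightarrow> ('v \<times> 'm) set" where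
  "grW D n = grV D n \<times> grM D n"

definition mulW ::
  "('k, 'v::ab_group_add, 'm::ab_group_add, 'z) alg_mod_scheme \<Rightarrow> 'v \<times> 'm \<Rightarrow> 'v \<times> 'm \<Rightarrow> 'v \<times> 'm"
where
  "mulW D u w = (mul D (fst u) (fst w), act D (fst u) (snd w) + ract D (snd u) (fst w))"

definition shQ :: "('k, 'v::ab_group_add, 'm, 'z) alg_mod_scheme \<Rightarrow> 'v \<Rightarrow> 'v \<Rightarrow> 'v" where
  "shQ D x y = shift_map (grV D) (\<lambda>xs. mul D (xs ! 0) (xs ! 1)) [x, y]"

definition shQW ::
  "('k, 'v::ab_group_add, 'm::ab_group_add, 'z) alg_mod_scheme \<Rightarrow> 'v \<times> 'm \<Rightarrow> 'v \<times> 'm \<Rightarrow> 'v \<times> 'm"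
where
  "shQW D u w = shift_map (grW D) (\<lambda>ws. mulW D (ws ! 0) (ws ! 1)) [u, w]"


definition shuffle_perms :: "nat \<Rightarrow> nat \<Rightarrow> (nat \<Rightarrow> nat) set" where
  "shuffle_perms p k =
     {\<sigma>. \<sigma> permutes {..<k} \<and> strict_mono_on {..<p} \<sigma> \<and> strict_mono_on {p..<k} \<sigma>}"

text \<open>
  Koszul sign exponent, on \<open>V[1]\<close>, of \<open>x\<^sub>0 \<dots> x\<^sub>k\<^sub>-\<^sub>1 \<mapsto> x\<^bsub>\<sigma>\<inverse>(0)\<^esub> \<dots> x\<^bsub>\<sigma>\<inverse>(k-1)\<^esub>\<close>:
  the letters \<open>x\<^sub>i\<close> and \<open>x\<^sub>j\<close> are exchanged iff \<open>i < j\<close> and \<open>\<sigma> j < \<sigma> i\<close>.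
\<close>

definition perm_exponent :: "(nat \<Rightarrow> nat) \<Rightarrow> int list \<Rightarrow> int" where
  "perm_exponent \<sigma> ns =
     (\<Sum>(i, j) | i < j \<and> j < length ns \<and> \<sigma> j < \<sigma> i. (ns ! i - 1) * (ns ! j - 1))"

definition vanishes_on_shuffles ::
  "(int \<Rightarrow> 'v::ab_group_add set) \<Rightarrow> nat \<Rightarrow> ('v list \<Rightarrow> 'm::ab_group_add) \<Rightarrow> bool" where
  "vanishes_on_shuffles G k C \<longleftrightarrow>
     (\<forall>p ns xs. 0 < p \<and> p < k \<and> length xs = k \<and> homogeneous G ns xs \<longrightarrow>
        (\<Sum>\<sigma>\<in>shuffle_perms p k.
           sg (perm_exponent \<sigma> ns) (C (map (\<lambda>i. xs ! inv \<sigma> i) [0..<k]))) = 0)"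

definition harrison_cochain ::
  "('k, 'v::ab_group_add, 'm::ab_group_add, 'z) alg_mod_scheme \<Rightarrow>
   nat \<Rightarrow> int \<Rightarrow> ('v list \<Rightarrow> 'm) \<Rightarrow> bool" where
  "harrison_cochain D k d c \<longleftrightarrow>
     multilinear_on UNIV (scV D) (scM D) k c \<and>
     (\<forall>ns xs. length xs = k \<and> homogeneous (grV D) ns xs \<longrightarrow> c xs \<in> grM D (sum_list ns + d)) \<and>
     vanishes_on_shuffles (grV D) k (shift_map (grV D) c)"

text \<open>
  \<open>(d\<^sub>H c)[1]\<close> for a \<open>k\<close>-cochain \<open>c\<close> of degree \<open>d\<close>, evaluated on \<open>k + 1\<close> vectors; \<open>g = deg C\<close>.
  The Koszul signs are those of moving \<open>x\<^sub>1\<close> past \<open>C\<close>, and of moving the odd letter \<open>Q\<close> past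
  \<open>C, x\<^sub>1, \<dots>, x\<^sub>j\<^sub>-\<^sub>1\<close>. The Harrison coboundary is given by the same formula on Harrison cochains.
\<close>

definition coboundary_shifted ::
  "('k, 'v::ab_group_add, 'm::ab_group_add, 'z) alg_mod_scheme \<Rightarrow>
   nat \<Rightarrow> int \<Rightarrow> ('v list \<Rightarrow> 'm) \<Rightarrow> 'v list \<Rightarrow> 'm" where
  "coboundary_shifted D k d c =
     (let C = shift_map (grV D) c; g = d + int k - 1 in
      hsums (grV D) (\<lambda>ns xs.
        snd (shQW D (0, C (take k xs)) (xs ! k, 0))
        + sg (g * (ns ! 0 - 1)) (snd (shQW D (xs ! 0, 0) (0, C (drop 1 xs))))
        - (\<Sum>j<k. sg (g + sdeg (take j ns))
             (C (take j xs @ shQ D (xs ! j) (xs ! Suc j) # drop (j + 2) xs)))))"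


type_synonym ('k, 'v, 'm) tilde = "'v \<times> 'm \<times> ('v \<Rightarrow> 'k) \<times> ('m \<Rightarrow> 'k)"

definition tcar ::
  "('k::field, 'v::ab_group_add, 'm::ab_group_add, 'z) alg_mod_scheme \<Rightarrow> ('k, 'v, 'm) tilde set"
where
  "tcar D = UNIV \<times> UNIV \<times> dual (scV D) \<times> dual (scM D)"

definition tscale ::
  "('k::field, 'v, 'm, 'z) alg_mod_scheme \<Rightarrow> 'k \<Rightarrow> ('k, 'v, 'm) tilde \<Rightarrow> ('k, 'v, 'm) tilde"
where
  "tscale D r = (\<lambda>(x, a, g, h). (scV D r x, scM D r a, \<lambda>y. r * g y, \<lambda>b. r * h b))"

definition tgr ::
  "('k::field, 'v::ab_group_add, 'm::ab_group_add, 'z) alg_mod_scheme \<Rightarrow>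
   int \<Rightarrow> ('k, 'v, 'm) tilde set"
where
  "tgr D n = grV D n \<times> grM D n \<times> dual_gr (scV D) (grV D) n \<times> dual_gr (scM D) (grM D) n"

text \<open>
  The left coadjoint action \<open>(u \<cdot> f)(w) = (-1)\<^bsup>\<bar>u\<bar>(\<bar>f\<bar> + \<bar>w\<bar>)\<^esup> f (w u)\<close>, for \<open>u \<in> U\<close>, \<open>w \<in> T\<close>, \<open>f \<in> F\<close>
  and \<open>p w u\<close> the product. No sign occurs in the right action \<open>(f \<cdot> u)(w) = f (u w)\<close>.
\<close>

definition lcoact ::
  "(int \<Rightarrow> 'u::ab_group_add set) \<Rightarrow> (int \<Rightarrow> 't::ab_group_add set) \<Rightarrow> (int \<Rightarrow> ('s \<Rightarrow> 'k) set) \<Rightarrow>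
   ('t \<Rightarrow> 'u \<Rightarrow> 's) \<Rightarrow> 'u \<Rightarrow> ('s \<Rightarrow> 'k::field) \<Rightarrow> 't \<Rightarrow> 'k" where
  "lcoact GU GT GF p u f w =
     hsum GU (\<lambda>l u. hsum GF (\<lambda>m f. hsum GT (\<lambda>n w. sg (l * (m + n)) (f (p w u))) w) f) u"

definition rcoact :: "('u \<Rightarrow> 't \<Rightarrow> 's) \<Rightarrow> ('s \<Rightarrow> 'k) \<Rightarrow> 'u \<Rightarrow> 't \<Rightarrow> 'k" where
  "rcoact p f u w = f (p u w)"

definition tmul ::
  "('k::field, 'v::ab_group_add, 'm::ab_group_add, 'z) alg_mod_scheme \<Rightarrow>
   ('k, 'v, 'm) tilde \<Rightarrow> ('k, 'v, 'm) tilde \<Rightarrow> ('k, 'v, 'm) tilde"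
where
  "tmul D = (\<lambda>(x, a, g, h) (x', a', g', h').
     let V = grV D; M = grM D; V' = dual_gr (scV D) V; M' = dual_gr (scM D) M in
     (mul D x x',
      act D x a' + ract D a x',
      lcoact V V V' (mul D) x g' + rcoact (mul D) g x'
        + lcoact M V M' (act D) a h' + rcoact (ract D) h a',
      lcoact V M M' (ract D) x h' + rcoact (act D) h x'))"

definition tform ::
  "('k::field, 'v::ab_group_add, 'm::ab_group_add, 'z) alg_mod_scheme \<Rightarrow>
   ('k, 'v, 'm) tilde \<Rightarrow> ('k, 'v, 'm) tilde \<Rightarrow> 'k"
where
  "tform D v v' =
     hsum (tgr D) (\<lambda>m (x, a, g, h). hsum (tgr D) (\<lambda>n (x', a', g', h').
       g x' + h a' + sg (m * n) (g' x + h' a)) v') v"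

definition tQ ::
  "('k::field, 'v::ab_group_add, 'm::ab_group_add, 'z) alg_mod_scheme \<Rightarrow>
   ('k, 'v, 'm) tilde list \<Rightarrow> ('k, 'v, 'm) tilde"
where
  "tQ D = shift_map (tgr D) (\<lambda>vs. tmul D (vs ! 0) (vs ! 1))"

definition tB ::
  "('k::field, 'v::ab_group_add, 'm::ab_group_add, 'z) alg_mod_scheme \<Rightarrow>
   ('k, 'v, 'm) tilde \<Rightarrow> ('k, 'v, 'm) tilde \<Rightarrow> 'k"
where
  "tB D = shift_form (tgr D) (tform D)"


text \<open>
  The functional \<open>C\<^sub>j(x\<^sub>1, \<dots>, h\<^sub>j, \<dots>, x\<^sub>k) = \<plusminus> h\<^sub>j (C (x\<^sub>j\<^sub>+\<^sub>1, \<dots>, x\<^sub>k, y, x\<^sub>1, \<dots>, x\<^sub>j\<^sub>-\<^sub>1))\<close> of \<open>y\<close>.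
  The first term of \<open>\<Omega>\<close> for the extension of \<open>C\<close> is \<open>B (C (x\<^sub>1, \<dots>, x\<^sub>k), h\<^sub>k\<^sub>+\<^sub>1)\<close>, and every other
  term carries the Koszul sign on the shifted space relating it to this one:
    \<open>B (C\<^sub>j (x\<^sub>1, \<dots>, h\<^sub>j, \<dots>, x\<^sub>k), y) = \<epsilon> B (C (x\<^sub>j\<^sub>+\<^sub>1, \<dots>, x\<^sub>k, y, x\<^sub>1, \<dots>, x\<^sub>j\<^sub>-\<^sub>1), h\<^sub>j)\<close>,
  where \<open>\<epsilon>\<close> is the sign of
    \<open>(x\<^sub>1 \<dots> x\<^sub>j\<^sub>-\<^sub>1 h\<^sub>j) (x\<^sub>j\<^sub>+\<^sub>1 \<dots> x\<^sub>k y) \<mapsto> (x\<^sub>j\<^sub>+\<^sub>1 \<dots> x\<^sub>k y) (x\<^sub>1 \<dots> x\<^sub>j\<^sub>-\<^sub>1 h\<^sub>j)\<close>.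
  Since \<open>B (g, y) = (-1)\<^bsup>deg y\<^esup> g y\<close> for \<open>g \<in> V\<^sup>*\<close> and \<open>B (a, h) = - h a\<close> for \<open>a \<in> M\<close>, the total sign
  is \<open>(-1)\<^bsup>deg y + 1\<^esup> \<epsilon>\<close>. This is the only choice making \<open>\<Omega>\<close> cyclic.
\<close>

abbreviation comp_x :: "('k, 'v, 'm) tilde \<Rightarrow> 'v" where "comp_x v \<equiv> fst v"
abbreviation comp_h :: "('k, 'v, 'm) tilde \<Rightarrow> 'm \<Rightarrow> 'k" where "comp_h v \<equiv> snd (snd (snd v))"

definition tilde_j ::
  "('k::field, 'v::ab_group_add, 'm::ab_group_add, 'z) alg_mod_scheme \<Rightarrow> ('v list \<Rightarrow> 'm) \<Rightarrow>
   int list \<Rightarrow> ('k, 'v, 'm) tilde list \<Rightarrow> nat \<Rightarrow> 'v \<Rightarrow> 'k"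
where
  "tilde_j D C ns vs j = hsum (grV D) (\<lambda>n y.
     sg ((n - 1) + 1 + sdeg (take (Suc j) ns) * (sdeg (drop (Suc j) ns) + (n - 1)))
       (comp_h (vs ! j) (C (map comp_x (drop (Suc j) vs) @ y # map comp_x (take j vs)))))"

definition tilde_ext ::
  "('k::field, 'v::ab_group_add, 'm::ab_group_add, 'z) alg_mod_scheme \<Rightarrow> ('v list \<Rightarrow> 'm) \<Rightarrow>
   ('k, 'v, 'm) tilde list \<Rightarrow> ('k, 'v, 'm) tilde"
where
  "tilde_ext D C = hsums (tgr D) (\<lambda>ns vs.
     (0, C (map comp_x vs), \<Sum>j<length vs. tilde_j D C ns vs j, 0))"


definition Omega ::
  "('k::field, 'v::ab_group_add, 'm::ab_group_add, 'z) alg_mod_scheme \<Rightarrow>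
   (('k, 'v, 'm) tilde list \<Rightarrow> ('k, 'v, 'm) tilde) \<Rightarrow> ('k, 'v, 'm) tilde list \<Rightarrow> 'k"
where
  "Omega D F vs = tB D (F (butlast vs)) (last vs)"

definition cyclic_form ::
  "('k::field, 'v::ab_group_add, 'm::ab_group_add, 'z) alg_mod_scheme \<Rightarrow>
   nat \<Rightarrow> (('k, 'v, 'm) tilde list \<Rightarrow> 'k) \<Rightarrow> bool"
where
  "cyclic_form D n \<Omega> \<longleftrightarrow>
     multilinear_on (tcar D) (tscale D) (*) n \<Omega> \<and>
     (\<forall>ns vs. vs \<noteq> [] \<and> length vs = n \<and> homogeneous (tgr D) ns vs \<longrightarrow>
        \<Omega> vs = sg ((last ns - 1) * sdeg (butlast ns)) (\<Omega> (last vs # butlast vs)))"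

definition is_homogeneous_basis ::
  "('k::field, 'v::ab_group_add, 'm::ab_group_add, 'z) alg_mod_scheme \<Rightarrow>
   ('k, 'v, 'm) tilde list \<Rightarrow> bool"
where
  "is_homogeneous_basis D es \<longleftrightarrow>
     distinct es \<and> (\<forall>e\<in>set es. \<exists>n. e \<in> tgr D n) \<and>
     \<not> module.dependent (tscale D) (set es) \<and> module.span (tscale D) (set es) = tcar D"

definition dual_bases ::
  "('k::field, 'v::ab_group_add, 'm::ab_group_add, 'z) alg_mod_scheme \<Rightarrow>
   ('k, 'v, 'm) tilde list \<Rightarrow> ('k, 'v, 'm) tilde list \<Rightarrow> bool"
where
  "dual_bases D es es' \<longleftrightarrow>
     is_homogeneous_basis D es \<and> is_homogeneous_basis D es' \<and> length es = length es' \<and>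
     (\<forall>i<length es. \<forall>j<length es. tform D (es ! i) (es' ! j) = (if i = j then 1 else 0))"

definition hdeg :: "(int \<Rightarrow> 'a set) \<Rightarrow> 'a \<Rightarrow> int" where
  "hdeg G v = (THE n. v \<in> G n)"

text \<open>
  \<open>\<Sum>\<^sub>i (\<iota>\<^bsub>e\<^sub>i\<^esub> \<Omega> \<otimes> \<iota>\<^bsub>e'\<^sub>i\<^esub> \<Omega>') (v\<^sub>1, \<dots>, v\<^sub>n)\<close> for a \<open>p\<close>-linear form \<open>\<Omega>\<close> and homogeneous \<open>v\<^sub>i\<close> of degrees
  \<open>ns\<close>. The Koszul sign is that of \<open>\<Omega> \<Omega>' e e' v w \<mapsto> \<Omega> e v \<Omega>' e' w\<close>, with \<open>v\<close> the first \<open>p - 1\<close> variables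
  and \<open>w\<close> the others. The degree of \<open>\<Omega>'\<close> is read off its arguments: a form of degree \<open>\<omega>\<close>
  vanishes unless \<open>\<omega>\<close> plus the total shifted degree of its arguments is \<open>0\<close>.
\<close>

definition contracted_tensor ::
  "('k::field, 'v::ab_group_add, 'm::ab_group_add, 'z) alg_mod_scheme \<Rightarrow>
   ('k, 'v, 'm) tilde list \<Rightarrow> ('k, 'v, 'm) tilde list \<Rightarrow> nat \<Rightarrow>
   (('k, 'v, 'm) tilde list \<Rightarrow> 'k) \<Rightarrow> (('k, 'v, 'm) tilde list \<Rightarrow> 'k) \<Rightarrow>
   int list \<Rightarrow> ('k, 'v, 'm) tilde list \<Rightarrow> 'k"
where
  "contracted_tensor D es es' p \<Omega> \<Omega>' ns vs =
     (\<Sum>i<length es.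
        let v = take (p - 1) vs; w = drop (p - 1) vs;
            dv = sdeg (take (p - 1) ns); dw = sdeg (drop (p - 1) ns);
            de = hdeg (tgr D) (es ! i) - 1; de' = hdeg (tgr D) (es' ! i) - 1;
            \<omega> = - (de' + dw)
        in sg (\<omega> * de + (\<omega> + de') * dv) (\<Omega> (es ! i # v) * \<Omega>' (es' ! i # w)))"

text \<open>\<open>Cycl\<close> sums over all cyclic permutations, each with its Koszul sign on the shifted space.\<close>

definition pinczon_bracket ::
  "('k::field, 'v::ab_group_add, 'm::ab_group_add, 'z) alg_mod_scheme \<Rightarrow>
   ('k, 'v, 'm) tilde list \<Rightarrow> ('k, 'v, 'm) tilde list \<Rightarrow> nat \<Rightarrow>
   (('k, 'v, 'm) tilde list \<Rightarrow> 'k) \<Rightarrow> (('k, 'v, 'm) tilde list \<Rightarrow> 'k) \<Rightarrow>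
   ('k, 'v, 'm) tilde list \<Rightarrow> 'k"
where
  "pinczon_bracket D es es' p \<Omega> \<Omega>' =
     hsums (tgr D) (\<lambda>ns vs. \<Sum>r<length vs.
       sg (sdeg (take r ns) * sdeg (drop r ns))
         (contracted_tensor D es es' p \<Omega> \<Omega>' (rotate r ns) (rotate r vs)))"

definition d_P ::
  "('k::field, 'v::ab_group_add, 'm::ab_group_add, 'z) alg_mod_scheme \<Rightarrow>
   ('k, 'v, 'm) tilde list \<Rightarrow> ('k, 'v, 'm) tilde list \<Rightarrow>
   (('k, 'v, 'm) tilde list \<Rightarrow> 'k) \<Rightarrow> ('k, 'v, 'm) tilde list \<Rightarrow> 'k"
where
  "d_P D es es' \<Omega> = pinczon_bracket D es es' 3 (Omega D (tQ D)) \<Omega>"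

text \<open>The argument \<open>C\<close> is a map on \<open>V[1]\<close>, i.e. already shifted.\<close>

definition Omega_tilde ::
  "('k::field, 'v::ab_group_add, 'm::ab_group_add, 'z) alg_mod_scheme \<Rightarrow>
   ('v list \<Rightarrow> 'm) \<Rightarrow> ('k, 'v, 'm) tilde list \<Rightarrow> 'k"
where
  "Omega_tilde D C = Omega D (tilde_ext D C)"

end

(*
  Proof idea. On homogeneous vectors, the form of the extension of C is the sum over all signed
  rotations of the single expression - h_n (C (x_1, ..., x_(n-1))); in particular it is cyclic.
  The product on the double semidirect product is invariant for the pairing, so the form of Q is
  cyclic as well, and expanding Q (v_1, v_2) in dual bases shows that d_P substitutes
  Q (v_1, v_2) for the first argument and sums over signed rotations. A signed rotation moves this
  insertion to any other slot, so d_P is the cyclic sum of the insertions of Q into all slots of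
  h_n (C (x_1, ..., x_(n-1))). Insertions into the x-slots are the inner terms of the Hochschild
  coboundary. The M*-component of Q in the last slot has two summands, which are dual to the two
  outer terms.
*)

theory Submission
  imports Defs
begin

section \<open>Signs and linear maps\<close>

text \<open>The obstacle is the signs. Every object is defined by sums over homogeneous components,
  so each identity is reduced by multilinearity to homogeneous vectors, where these sums collapse.
  Even there the Koszul exponents of the two sides are in general not congruent modulo 2. They
  become so when the degrees add up to the value at which the expression can be nonzero; for all
  other degrees both sides are 0. Hence the recurring case distinction on a sum of degrees. The
  degree 2 - k matters here: it gives C the shifted degree 1, like Q, and the forms of Q and of C
  both live on arguments of total shifted degree -3.

  A full turn of a list carries no residual sign, so signed rotations form an action of a cyclic
  group and its orbit sum absorbs rotations. Inserting Q shortens the list by one, so the inner and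
  the outer cyclic sum belong to groups of different orders. They can be compared because the sign
  of the odd letter Q makes up exactly for the degree by which the merged letter differs from the
  pair it replaces.\<close>

lemma sg_0 [simp]: "sg n 0 = 0"
  by (simp add: sg_def)

lemma sg_zero_exponent [simp]: "sg 0 x = x"
  by (simp add: sg_def)

lemma sg_sg [simp]: "sg m (sg n x) = sg (m + n) x"
  by (simp add: sg_def)

lemma sg_add: "sg n (x + y) = sg n x + sg n y"
  by (simp add: sg_def)

lemma sg_minus: "sg n (- x) = - sg n x"
  by (simp add: sg_def)

lemma sg_diff: "sg n (x - y) = sg n x - sg n y"
  by (simp add: sg_def)

lemma sg_sum: "sg n (sum f A) = (\<Sum>i\<in>A. sg n (f i))"
  by (simp add: sg_def sum_negf)

lemma sg_cong: "even m = even n \<Longrightarrow> sg m x = sg n x"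
  by (simp add: sg_def)

lemma fst_sg: "fst (sg n p) = sg n (fst p)"
  and snd_sg: "snd (sg n p) = sg n (snd p)"
  by (simp_all add: sg_def)

lemma sg_apply: "sg n f x = sg n (f x)"
  by (simp add: sg_def)

lemma sg_mult: "sg n x * y = sg n (x * y)" "x * sg n y = sg n (x * y :: 'a::ring)"
  by (simp_all add: sg_def)

text \<open>Linearity is relative to a carrier because the type \<open>tilde\<close> admits
  arbitrary functions in its last two components, while \<open>tcar D\<close> consists of the tuples
  in which these functions are linear.\<close>

definition lin_on ::
  "'a::ab_group_add set \<Rightarrow> ('k \<Rightarrow> 'a \<Rightarrow> 'a) \<Rightarrow> ('k \<Rightarrow> 'b::ab_group_add \<Rightarrow> 'b) \<Rightarrow> ('a \<Rightarrow> 'b) \<Rightarrow> bool" where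
  "lin_on S s t f \<longleftrightarrow>
     (\<forall>v\<in>S. \<forall>w\<in>S. f (v + w) = f v + f w) \<and> (\<forall>a. \<forall>v\<in>S. f (s a v) = t a (f v))"

lemma lin_onI:
  "\<lbrakk>\<And>v w. v \<in> S \<Longrightarrow> w \<in> S \<Longrightarrow> f (v + w) = f v + f w; \<And>a v. v \<in> S \<Longrightarrow> f (s a v) = t a (f v)\<rbrakk>
   \<Longrightarrow> lin_on S s t f"
  by (simp add: lin_on_def)

lemma lin_on_add: "lin_on S s t f \<Longrightarrow> v \<in> S \<Longrightarrow> w \<in> S \<Longrightarrow> f (v + w) = f v + f w"
  by (simp add: lin_on_def)

lemma lin_on_scale: "lin_on S s t f \<Longrightarrow> v \<in> S \<Longrightarrow> f (s a v) = t a (f v)"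
  by (simp add: lin_on_def)

lemma lin_on_0:
  assumes "lin_on S s t f" "0 \<in> S" shows "f 0 = 0"
  using lin_on_add[OF assms(1), of 0 0] assms(2) by simp

lemma lin_on_compose:
  "\<lbrakk>lin_on S s t f; lin_on T t u g; \<And>v. v \<in> S \<Longrightarrow> f v \<in> T\<rbrakk> \<Longrightarrow> lin_on S s u (\<lambda>v. g (f v))"
  by (simp add: lin_on_def)

lemma lin_on_compose_UNIV:
  "\<lbrakk>lin_on S s t f; lin_on UNIV t u g\<rbrakk> \<Longrightarrow> lin_on S s u (\<lambda>v. g (f v))"
  by (simp add: lin_on_def)

lemma lin_on_plus:
  assumes "vector_space t" "lin_on S s t f" "lin_on S s t g"
  shows "lin_on S s t (\<lambda>v. f v + g v)"
proof -
  interpret vector_space t by fact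
  show ?thesis using assms(2,3) by (auto simp: lin_on_def scale_right_distrib)
qed

lemma lin_on_zero:
  assumes "vector_space t"
  shows "lin_on S s t (\<lambda>v. 0)"
proof -
  interpret vector_space t by fact
  show ?thesis by (auto simp: lin_on_def)
qed

lemma lin_on_minus:
  assumes "vector_space t" "lin_on S s t f"
  shows "lin_on S s t (\<lambda>v. - f v)"
proof -
  interpret vector_space t by fact
  show ?thesis using assms(2) by (auto simp: lin_on_def)
qed

lemma lin_on_sg:
  assumes "vector_space t" "lin_on S s t f"
  shows "lin_on S s t (\<lambda>v. sg n (f v))"
  using assms lin_on_minus[OF assms] by (cases "even n") (simp_all add: sg_def)

lemma lin_on_sum:
  assumes "vector_space t" "\<And>i. i \<in> A \<Longrightarrow> lin_on S s t (f i)"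
  shows "lin_on S s t (\<lambda>v. \<Sum>i\<in>A. f i v)"
  using assms(2)
  by (induct A rule: infinite_finite_induct)
    (simp_all add: lin_on_zero[OF assms(1)] lin_on_plus[OF assms(1)])

lemma linear_lin_on: "Vector_Spaces.linear s t f \<Longrightarrow> lin_on S s t f"
  by (simp add: lin_on_def Vector_Spaces.linear_iff)

lemma vector_space_field: "vector_space ((*) :: 'k::field \<Rightarrow> 'k \<Rightarrow> 'k)"
  by unfold_locales (simp_all add: algebra_simps)

lemma vector_space_fun: "vector_space (\<lambda>r (g :: 'a \<Rightarrow> 'k::field) y. r * g y)"
  by unfold_locales (simp_all add: algebra_simps fun_eq_iff)

lemma lin_on_sum_apply:
  assumes "lin_on S s t f" "module s" "module.subspace s S" "\<And>i. i \<in> A \<Longrightarrow> v i \<in> S"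
  shows "f (sum v A) = (\<Sum>i\<in>A. f (v i))"
proof -
  interpret module s by fact
  have "sum v A \<in> S \<and> f (sum v A) = (\<Sum>i\<in>A. f (v i))"
    using assms(4)
    by (induct A rule: infinite_finite_induct)
      (auto simp: lin_on_add[OF assms(1)] lin_on_0[OF assms(1)] subspace_0[OF assms(3)]
         subspace_add[OF assms(3)])
  then show ?thesis ..
qed


lemma lin_on_apply_sg:
  assumes "vector_space s" "vector_space t" "lin_on S s t f" "v \<in> S"
  shows "f (sg i v) = sg i (f v)"
proof -
  interpret s: vector_space s by fact
  interpret t: vector_space t by fact
  show ?thesis
    using lin_on_scale[OF assms(3,4), of "- 1"] by (simp add: sg_def)
qed

section \<open>Extension from homogeneous components\<close>

text \<open>Any finite set containing the support may carry the sum. In this form decompositions of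
  different vectors can be put over a common index set.\<close>

lemma is_hdecomp_iff:
  "is_hdecomp G v c \<longleftrightarrow>
     (\<forall>n. c n \<in> G n) \<and> (\<exists>N. finite N \<and> (\<forall>n. n \<notin> N \<longrightarrow> c n = 0) \<and> sum c N = v)"
proof
  assume "is_hdecomp G v c"
  then show "(\<forall>n. c n \<in> G n) \<and> (\<exists>N. finite N \<and> (\<forall>n. n \<notin> N \<longrightarrow> c n = 0) \<and> sum c N = v)"
    by (auto simp: is_hdecomp_def intro!: exI[of _ "{n. c n \<noteq> 0}"])
next
  assume *: "(\<forall>n. c n \<in> G n) \<and> (\<exists>N. finite N \<and> (\<forall>n. n \<notin> N \<longrightarrow> c n = 0) \<and> sum c N = v)"
  then obtain N where N: "finite N" "\<forall>n. n \<notin> N \<longrightarrow> c n = 0" "sum c N = v" by blast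
  then have sub: "{n. c n \<noteq> 0} \<subseteq> N" by auto
  then have "sum c {n. c n \<noteq> 0} = sum c N"
    using N by (intro sum.mono_neutral_left) auto
  with * N sub show "is_hdecomp G v c"
    by (auto simp: is_hdecomp_def dest: finite_subset)
qed

text \<open>The carrier \<open>S\<close> is a parameter so that one theory serves \<open>V\<close>,
  \<open>M\<close> and \<open>W\<close>, where it is the whole type, as well as the duals and the
  double, where it is not.\<close>

locale graded =
  fixes s :: "'k::field \<Rightarrow> 'a::ab_group_add \<Rightarrow> 'a" and S :: "'a set" and G :: "int \<Rightarrow> 'a set"
  assumes vector_space: "vector_space s" and subspace: "module.subspace s S"
    and subspace_G: "module.subspace s (G n)" and G_le_S: "G n \<subseteq> S"
    and ex1_hdecomp: "v \<in> S \<Longrightarrow> \<exists>!c. is_hdecomp G v c"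
begin

interpretation vector_space s by (rule vector_space)

lemma G_S: "x \<in> G n \<Longrightarrow> x \<in> S"
  using G_le_S by blast

lemmas S_0 [simp] = subspace_0[OF subspace] and S_add = subspace_add[OF subspace]
  and S_scale = subspace_scale[OF subspace] and S_sum = subspace_sum[OF subspace]
  and S_neg = subspace_neg[OF subspace]
lemmas G_0 [simp] = subspace_0[OF subspace_G] and G_add = subspace_add[OF subspace_G]
  and G_scale = subspace_scale[OF subspace_G] and G_neg = subspace_neg[OF subspace_G]
  and G_sum = subspace_sum[OF subspace_G]

lemma G_sg: "x \<in> G n \<Longrightarrow> sg m x \<in> G n"
  by (simp add: sg_def G_neg)

lemma S_sg: "x \<in> S \<Longrightarrow> sg m x \<in> S"
  by (simp add: sg_def S_neg)

lemma hcomp_decomp: "v \<in> S \<Longrightarrow> is_hdecomp G v (hcomp G v)"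
  unfolding hcomp_def by (rule theI'[OF ex1_hdecomp])

lemma hcomp_unique: "v \<in> S \<Longrightarrow> is_hdecomp G v c \<Longrightarrow> hcomp G v = c"
  using hcomp_decomp ex1_hdecomp by blast

lemma hcomp_mem: "v \<in> S \<Longrightarrow> hcomp G v n \<in> G n"
  using hcomp_decomp by (simp add: is_hdecomp_def)

lemma hcomp_finite: "v \<in> S \<Longrightarrow> finite {n. hcomp G v n \<noteq> 0}"
  using hcomp_decomp by (simp add: is_hdecomp_def)

lemma hcomp_sum: "v \<in> S \<Longrightarrow> (\<Sum>n | hcomp G v n \<noteq> 0. hcomp G v n) = v"
  using hcomp_decomp by (simp add: is_hdecomp_def)

lemma hcomp_homogeneous:
  assumes "x \<in> G n" shows "hcomp G x = (\<lambda>m. if m = n then x else 0)"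
  using assms
  by (intro hcomp_unique) (auto simp: G_S is_hdecomp_iff intro!: exI[of _ "{n}"])

text \<open>The zero vector lies in every \<open>G n\<close>, so the definite description in
  \<open>hdeg\<close> is determined only for nonzero vectors.\<close>

lemma hdeg_eq:
  assumes "x \<in> G n" "x \<noteq> 0"
  shows "hdeg G x = n"
  unfolding hdeg_def
proof (rule the_equality)
  fix m assume "x \<in> G m"
  from fun_cong[OF hcomp_homogeneous[OF this], of m] show "m = n"
    using assms(2) by (simp add: hcomp_homogeneous[OF assms(1)] split: if_splits)
qed (rule assms(1))

lemma hcomp_add:
  assumes "v \<in> S" "w \<in> S"
  shows "hcomp G (v + w) = (\<lambda>n. hcomp G v n + hcomp G w n)"
proof (rule hcomp_unique)
  let ?N = "{n. hcomp G v n \<noteq> 0} \<union> {n. hcomp G w n \<noteq> 0}"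
  have fin: "finite ?N" using assms by (simp add: hcomp_finite)
  have "sum (hcomp G v) ?N = v" "sum (hcomp G w) ?N = w"
    \<comment> \<open>Only the third occurrence of the vector, the right-hand side, is replaced by
      the sum of its components; the larger index set adds zeros.\<close>
    by (subst (3) hcomp_sum[symmetric, OF assms(1)] hcomp_sum[symmetric, OF assms(2)],
      rule sum.mono_neutral_right, use fin in auto)+
  with fin show "is_hdecomp G (v + w) (\<lambda>n. hcomp G v n + hcomp G w n)"
    unfolding is_hdecomp_iff
    by (auto simp: sum.distrib assms intro!: G_add hcomp_mem exI[of _ ?N])
qed (simp add: assms S_add)

lemma hcomp_scale:
  assumes "v \<in> S"
  shows "hcomp G (s a v) = (\<lambda>n. s a (hcomp G v n))"
proof (rule hcomp_unique)
  show "is_hdecomp G (s a v) (\<lambda>n. s a (hcomp G v n))"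
    unfolding is_hdecomp_iff
    using hcomp_finite[OF assms] hcomp_sum[OF assms]
    by (auto simp: scale_sum_right[symmetric] assms
        intro!: G_scale hcomp_mem exI[of _ "{n. hcomp G v n \<noteq> 0}"])
qed (simp add: assms S_scale)

lemma hsum_superset:
  assumes "v \<in> S" "finite N" "\<And>n. n \<notin> N \<Longrightarrow> hcomp G v n = 0" "\<And>n. F n 0 = 0"
  shows "hsum G F v = (\<Sum>n\<in>N. F n (hcomp G v n))"
  unfolding hsum_def using assms by (intro sum.mono_neutral_left) auto

text \<open>For \<open>x = 0\<close> the index set of \<open>hsum\<close> is empty and the sum is
  \<open>0\<close>; the condition on \<open>F n 0\<close> covers this case.\<close>

lemma hsum_homogeneous:
  assumes "x \<in> G n" "F n 0 = 0"
  shows "hsum G F x = F n x"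
proof -
  have "{m. hcomp G x m \<noteq> 0} = (if x = 0 then {} else {n})"
    using assms by (auto simp: hcomp_homogeneous split: if_splits)
  then show ?thesis
    using assms by (auto simp: hsum_def hcomp_homogeneous)
qed

lemma hsum_cong:
  assumes "v \<in> S" "\<And>n x. x \<in> G n \<Longrightarrow> F n x = F' n x"
  shows "hsum G F v = hsum G F' v"
  unfolding hsum_def using assms by (intro sum.cong) (auto simp: hcomp_mem)

lemma hsum_mem:
  assumes "v \<in> S" "\<And>n x. x \<in> G n \<Longrightarrow> F n x \<in> Z" "0 \<in> Z" "\<And>x y. x \<in> Z \<Longrightarrow> y \<in> Z \<Longrightarrow> x + y \<in> Z"
  shows "hsum G F v \<in> Z"
proof -
  have "(\<Sum>n\<in>N. F n (hcomp G v n)) \<in> Z" for N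
    using assms(2-4) hcomp_mem[OF assms(1)]
    by (induct N rule: infinite_finite_induct) auto
  then show ?thesis by (simp add: hsum_def)
qed

text \<open>Components of \<open>v\<close> and \<open>w\<close> may cancel in \<open>v + w\<close>,
  so the three sums are compared over the union of the supports of \<open>v\<close> and
  \<open>w\<close>.\<close>

lemma hsum_lin:
  assumes "vector_space t" "\<And>n. lin_on S s t (F n)"
  shows "lin_on S s t (hsum G F)"
proof (rule lin_onI)
  interpret t: vector_space t by fact
  note F0 = lin_on_0[OF assms(2) S_0]
  fix v w assume vw: "v \<in> S" "w \<in> S"
  let ?N = "{n. hcomp G v n \<noteq> 0} \<union> {n. hcomp G w n \<noteq> 0}"
  have fin: "finite ?N" using vw by (simp add: hcomp_finite)
  have "hsum G F (v + w) = (\<Sum>n\<in>?N. F n (hcomp G v n + hcomp G w n))"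
    unfolding fun_cong[OF hcomp_add[OF vw], symmetric]
    by (intro hsum_superset fin F0) (auto simp: S_add vw hcomp_add)
  also have "\<dots> = (\<Sum>n\<in>?N. F n (hcomp G v n) + F n (hcomp G w n))"
    using vw by (intro sum.cong refl lin_on_add[OF assms(2)]) (auto intro!: G_S hcomp_mem)
  also have "\<dots> = hsum G F v + hsum G F w"
    unfolding sum.distrib
    by (intro arg_cong2[of _ _ _ _ "(+)"] hsum_superset[symmetric] vw fin F0) auto
  finally show "hsum G F (v + w) = hsum G F v + hsum G F w" .
next
  interpret t: vector_space t by fact
  note F0 = lin_on_0[OF assms(2) S_0]
  fix a v assume v: "v \<in> S"
  let ?N = "{n. hcomp G v n \<noteq> 0}"
  have "hsum G F (s a v) = (\<Sum>n\<in>?N. F n (s a (hcomp G v n)))"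
    unfolding fun_cong[OF hcomp_scale[OF v], symmetric]
    by (intro hsum_superset F0) (auto simp: S_scale v hcomp_scale hcomp_finite)
  also have "\<dots> = (\<Sum>n\<in>?N. t a (F n (hcomp G v n)))"
    using v by (intro sum.cong refl lin_on_scale[OF assms(2)]) (auto intro!: G_S hcomp_mem)
  also have "\<dots> = t a (hsum G F v)"
    by (simp add: t.scale_sum_right hsum_def)
  finally show "hsum G F (s a v) = t a (hsum G F v)" .
qed

text \<open>The index set depends on \<open>v\<close> alone and stays fixed while the parameter
  \<open>p\<close> varies.\<close>

lemma hsum_lin_param:
  assumes "vector_space t" "v \<in> S" "\<And>n x. x \<in> G n \<Longrightarrow> lin_on Z z t (\<lambda>p. F p n x)"
  shows "lin_on Z z t (\<lambda>p. hsum G (F p) v)"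
  unfolding hsum_def using assms by (intro lin_on_sum) (auto simp: hcomp_mem)

lemma graded_induct [consumes 1, case_names homogeneous add]:
  assumes "v \<in> S" "\<And>n x. x \<in> G n \<Longrightarrow> P x"
    "\<And>x y. x \<in> S \<Longrightarrow> y \<in> S \<Longrightarrow> P x \<Longrightarrow> P y \<Longrightarrow> P (x + y)"
  shows "P v"
proof -
  have P0: "P 0" using assms(2)[OF G_0] .
  have hS: "hcomp G v n \<in> S" and hP: "P (hcomp G v n)" for n
    using hcomp_mem[OF assms(1)] assms(2) G_S by blast+
  have "(\<Sum>n\<in>N. hcomp G v n) \<in> S \<and> P (\<Sum>n\<in>N. hcomp G v n)" for N
    using P0 by (induct N rule: infinite_finite_induct) (auto intro!: S_add assms(3) hS hP)
  from this[of "{n. hcomp G v n \<noteq> 0}"] show ?thesis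
    by (simp add: hcomp_sum[OF assms(1)])
qed

lemma lin_on_eqI:
  assumes "lin_on S s t f" "lin_on S s t g" "\<And>n x. x \<in> G n \<Longrightarrow> f x = g x" "v \<in> S"
  shows "f v = g v"
  using assms(4)
proof (induct rule: graded_induct)
  case (add x y)
  then show ?case
    using lin_on_add[OF assms(1)] lin_on_add[OF assms(2)] by simp
qed (rule assms(3))

end

lemma lin_on_fst: "lin_on S (\<lambda>r p. (s1 r (fst p), s2 r (snd p))) s1 fst"
  and lin_on_snd: "lin_on S (\<lambda>r p. (s1 r (fst p), s2 r (snd p))) s2 snd"
  by (simp_all add: lin_on_def)

lemma is_hdecomp_prod:
  "is_hdecomp (\<lambda>n. G1 n \<times> G2 n) v c \<longleftrightarrow>
     is_hdecomp G1 (fst v) (\<lambda>n. fst (c n)) \<and> is_hdecomp G2 (snd v) (\<lambda>n. snd (c n))"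
  (is "?L \<longleftrightarrow> ?R")
proof
  assume ?L
  then obtain N where "\<forall>n. c n \<in> G1 n \<times> G2 n" "finite N" "\<forall>n. n \<notin> N \<longrightarrow> c n = 0" "sum c N = v"
    unfolding is_hdecomp_iff by blast
  then show ?R
    unfolding is_hdecomp_iff
    by (auto simp: fst_sum snd_sum mem_Times_iff intro!: exI[of _ N])
next
  assume ?R
  then obtain N1 N2 where
    N1: "\<forall>n. fst (c n) \<in> G1 n" "finite N1" "\<forall>n. n \<notin> N1 \<longrightarrow> fst (c n) = 0"
      "(\<Sum>n\<in>N1. fst (c n)) = fst v" and
    N2: "\<forall>n. snd (c n) \<in> G2 n" "finite N2" "\<forall>n. n \<notin> N2 \<longrightarrow> snd (c n) = 0"
      "(\<Sum>n\<in>N2. snd (c n)) = snd v"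
    unfolding is_hdecomp_iff by blast
  have "(\<Sum>n\<in>N1 \<union> N2. fst (c n)) = fst v" "(\<Sum>n\<in>N1 \<union> N2. snd (c n)) = snd v"
    unfolding N1(4)[symmetric] N2(4)[symmetric]
    by (rule sum.mono_neutral_right; use N1 N2 in auto)+
  then have "sum c (N1 \<union> N2) = v"
    by (simp add: prod_eq_iff fst_sum snd_sum)
  then show ?L
    unfolding is_hdecomp_iff using N1 N2
    by (auto simp: mem_Times_iff prod_eq_iff intro!: exI[of _ "N1 \<union> N2"])
qed

lemma graded_prod:
  assumes "graded s1 S1 G1" "graded s2 S2 G2"
  shows "graded (\<lambda>r p. (s1 r (fst p), s2 r (snd p))) (S1 \<times> S2) (\<lambda>n. G1 n \<times> G2 n)"
proof -
  interpret A: graded s1 S1 G1 by fact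
  interpret B: graded s2 S2 G2 by fact
  interpret s1: vector_space s1 by (rule A.vector_space)
  interpret s2: vector_space s2 by (rule B.vector_space)
  interpret P: vector_space "\<lambda>r p. (s1 r (fst p), s2 r (snd p))"
    by unfold_locales
      (simp_all add: s1.scale_right_distrib s1.scale_left_distrib s2.scale_right_distrib
        s2.scale_left_distrib)
  show ?thesis
  proof
    show "P.subspace (S1 \<times> S2)"
      by (auto simp: P.subspace_def A.S_add B.S_add A.S_scale B.S_scale zero_prod_def)
    show "P.subspace (G1 n \<times> G2 n)" for n
      by (auto simp: P.subspace_def A.G_add B.G_add A.G_scale B.G_scale zero_prod_def)
    show "G1 n \<times> G2 n \<subseteq> S1 \<times> S2" for n
      using A.G_le_S B.G_le_S by blast
    fix v :: "'b \<times> 'c" assume "v \<in> S1 \<times> S2"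
    then have v: "fst v \<in> S1" "snd v \<in> S2" by auto
    show "\<exists>!c. is_hdecomp (\<lambda>n. G1 n \<times> G2 n) v c"
    proof (rule ex1I[of _ "\<lambda>n. (hcomp G1 (fst v) n, hcomp G2 (snd v) n)"])
      show "is_hdecomp (\<lambda>n. G1 n \<times> G2 n) v (\<lambda>n. (hcomp G1 (fst v) n, hcomp G2 (snd v) n))"
        using v by (simp add: is_hdecomp_prod A.hcomp_decomp B.hcomp_decomp)
      fix c assume "is_hdecomp (\<lambda>n. G1 n \<times> G2 n) v c"
      then have "hcomp G1 (fst v) = (\<lambda>n. fst (c n))" "hcomp G2 (snd v) = (\<lambda>n. snd (c n))"
        using v by (simp_all add: is_hdecomp_prod A.hcomp_unique B.hcomp_unique)
      then show "c = (\<lambda>n. (hcomp G1 (fst v) n, hcomp G2 (snd v) n))"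
        by (simp add: fun_eq_iff prod_eq_iff)
    qed
  qed
qed

text \<open>Components depend linearly on the vector, so only the degrees present in the finitely
  many spanning vectors can occur at all. This finiteness makes every functional a finite sum of
  homogeneous ones.\<close>

lemma (in graded) finite_degrees:
  assumes "finite B" "module.span s B = UNIV" "S = UNIV"
  shows "finite {n. G n \<noteq> {0}}"
proof -
  interpret vector_space s by (rule vector_space)
  let ?N = "\<Union>b\<in>B. {n. hcomp G b n \<noteq> 0}"
  have "hcomp G v n = 0" if "n \<notin> ?N" for v n
  proof -
    have "v \<in> span B" using assms(2) by simp
    then show ?thesis
    proof (induct rule: span_induct_alt)
      case base
      show ?case using hcomp_homogeneous[OF G_0] by simp
    next
      case (step c b v)
      then show ?case using that assms(3) by (auto simp: hcomp_add hcomp_scale)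
    qed
  qed
  then have "{n. G n \<noteq> {0}} \<subseteq> ?N"
    by (auto simp: hcomp_homogeneous) (metis (lifting) G_0 hcomp_homogeneous insertI1 singletonI equalityI empty_iff insert_iff subsetI)
  moreover have "finite ?N"
    using assms by (auto intro: hcomp_finite)
  ultimately show ?thesis by (rule finite_subset)
qed

lemma dual_iff:
  "vector_space s \<Longrightarrow> f \<in> dual s \<longleftrightarrow> lin_on UNIV s (*) f"
  by (auto simp: dual_def lin_on_def Vector_Spaces.linear_iff vector_space_field)

lemma sum_apply: "(\<Sum>i\<in>A. f i) x = (\<Sum>i\<in>A. f i x)"
  by (induct A rule: infinite_finite_induct) simp_all

text \<open>The component of degree \<open>n\<close> of a functional \<open>f\<close> is
  \<open>f\<close> composed with the projection to degree \<open>- n\<close>.\<close>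

lemma graded_dual:
  assumes "graded s UNIV G" "finite {n. G n \<noteq> {0}}"
  shows "graded (\<lambda>r g y. r * g y) (dual s) (dual_gr s G)"
proof -
  interpret graded s UNIV G by fact
  interpret F: vector_space "\<lambda>r (g :: 'b \<Rightarrow> 'a) y. r * g y" by (rule vector_space_fun)
  have dual: "f \<in> dual s \<longleftrightarrow> lin_on UNIV s (*) f" for f
    by (rule dual_iff[OF vector_space])
  have dual_subspace: "F.subspace (dual s)"
    by (auto simp: F.subspace_def dual lin_on_def algebra_simps)
  show ?thesis
  proof
    show "F.subspace (dual s)" by (rule dual_subspace)
    show "F.subspace (dual_gr s G n)" for n
      using dual_subspace by (simp add: F.subspace_def dual_gr_def)
    show "dual_gr s G n \<subseteq> dual s" for n
      by (auto simp: dual_gr_def)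
    fix f assume f: "f \<in> dual s"
    then have lin: "lin_on UNIV s (*) f" by (simp add: dual)
    show "\<exists>!c. is_hdecomp (dual_gr s G) f c"
    proof (rule ex1I[of _ "\<lambda>n x. f (hcomp G x (- n))"])
      let ?N = "uminus ` {n. G n \<noteq> {0}}"
      have hcomp_0: "hcomp G x n = 0" if "G n = {0}" for x n
        using hcomp_mem[of x n] that by simp
      have "(\<lambda>x. f (hcomp G x (- n))) \<in> dual_gr s G n" for n
        using lin lin_on_0[OF lin]
        by (auto simp: dual_gr_def dual lin_on_def hcomp_add hcomp_scale hcomp_homogeneous)
      moreover have "finite ?N" using assms(2) by simp
      moreover have "(\<lambda>x. f (hcomp G x (- n))) = 0" if "n \<notin> ?N" for n
      proof -
        have "G (- n) = {0}" using that by force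
        then show ?thesis by (simp add: hcomp_0 lin_on_0[OF lin] fun_eq_iff)
      qed
      moreover have "(\<Sum>n\<in>?N. (\<lambda>x. f (hcomp G x (- n)))) = f"
      proof
        fix x
        have "(\<Sum>n\<in>?N. (\<lambda>x. f (hcomp G x (- n)))) x = (\<Sum>n\<in>?N. f (hcomp G x (- n)))"
          by (simp add: sum_apply)
        also have "\<dots> = (\<Sum>n | G n \<noteq> {0}. f (hcomp G x n))"
          by (subst sum.reindex) (auto simp: inj_on_def)
        also have "\<dots> = f (\<Sum>n | G n \<noteq> {0}. hcomp G x n)"
          by (rule lin_on_sum_apply[symmetric, OF lin]) (use vector_space in \<open>auto simp: module_iff_vector_space subspace\<close>)
        also have "(\<Sum>n | G n \<noteq> {0}. hcomp G x n) = (\<Sum>n | hcomp G x n \<noteq> 0. hcomp G x n)"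
          using hcomp_0 assms(2) by (intro sum.mono_neutral_right) auto
        finally show "(\<Sum>n\<in>?N. (\<lambda>x. f (hcomp G x (- n)))) x = f x"
          by (simp add: hcomp_sum)
      qed
      ultimately show "is_hdecomp (dual_gr s G) f (\<lambda>n x. f (hcomp G x (- n)))"
        unfolding is_hdecomp_iff by blast
    next
      fix c assume c: "is_hdecomp (dual_gr s G) f c"
      then obtain N where N: "\<And>n. c n \<in> dual_gr s G n" "finite N" "\<forall>n. n \<notin> N \<longrightarrow> c n = 0"
        "sum c N = f"
        unfolding is_hdecomp_iff by blast
      show "c = (\<lambda>n x. f (hcomp G x (- n)))"
      proof (intro ext)
        fix n x
        have "lin_on UNIV s (*) (c n)" using N(1) by (simp add: dual_gr_def dual)
        moreover have "lin_on UNIV s (*) (\<lambda>x. f (hcomp G x (- n)))"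
          using lin by (auto simp: lin_on_def hcomp_add hcomp_scale)
        moreover have "c n x = f (hcomp G x (- n))" if x: "x \<in> G m" for x m
        proof -
          \<comment> \<open>A functional of degree \<open>i\<close> sees only vectors of degree
            \<open>- i\<close>, so on \<open>x\<close> of degree \<open>m\<close> all of
            \<open>f\<close> comes from \<open>c (- m)\<close>.\<close>
          have z: "c i x = 0" if "i \<noteq> - m" for i
          proof -
            have "m \<noteq> - i" using that by auto
            with N(1)[of i] x show ?thesis by (auto simp: dual_gr_def)
          qed
          have "f x = (\<Sum>i\<in>N. c i x)"
            unfolding N(4)[symmetric] by (simp add: sum_apply)
          also have "\<dots> = (\<Sum>i\<in>N \<union> {- m}. c i x)"
            using N(2,3) by (intro sum.mono_neutral_left) auto
          also have "\<dots> = (\<Sum>i\<in>{- m}. c i x)"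
            using N(2) z by (intro sum.mono_neutral_right) auto
          finally have "f x = c (- m) x" by simp
          then show ?thesis
            using z[of n] lin_on_0[OF lin] by (auto simp: hcomp_homogeneous[OF x])
        qed
        ultimately show "c n x = f (hcomp G x (- n))"
          by (rule lin_on_eqI[OF _ _ _ UNIV_I])
      qed
    qed
  qed
qed


section \<open>Multilinear maps on lists\<close>

lemma multilinear_on_iff:
  "multilinear_on S s t n f \<longleftrightarrow>
     (\<forall>us ws. set us \<subseteq> S \<and> set ws \<subseteq> S \<and> length us + length ws + 1 = n \<longrightarrow>
        lin_on S s t (\<lambda>v. f (us @ v # ws)))"
  unfolding multilinear_on_def lin_on_def by blast

lemma multilinear_onI:
  "(\<And>us ws. \<lbrakk>set us \<subseteq> S; set ws \<subseteq> S; length us + length ws + 1 = n\<rbrakk> \<Longrightarrow>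
      lin_on S s t (\<lambda>v. f (us @ v # ws))) \<Longrightarrow> multilinear_on S s t n f"
  unfolding multilinear_on_iff by blast

lemma multilinear_onD:
  "\<lbrakk>multilinear_on S s t n f; set us \<subseteq> S; set ws \<subseteq> S; length us + length ws + 1 = n\<rbrakk> \<Longrightarrow>
     lin_on S s t (\<lambda>v. f (us @ v # ws))"
  unfolding multilinear_on_iff by blast

lemma multilinear_on_rotate1:
  assumes "multilinear_on S s t n f"
  shows "multilinear_on S s t n (\<lambda>vs. f (rotate1 vs))"
proof (rule multilinear_onI)
  fix us ws assume *: "set us \<subseteq> S" "set ws \<subseteq> S" "length us + length ws + 1 = n"
  show "lin_on S s t (\<lambda>v. f (rotate1 (us @ v # ws)))"
  proof (cases us)
    case Nil
    then show ?thesis using multilinear_onD[OF assms, of ws "[]"] * by simp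
  next
    case (Cons u us')
    then show ?thesis using multilinear_onD[OF assms, of us' "ws @ [u]"] * by simp
  qed
qed

lemma multilinear_on_rotate:
  assumes "multilinear_on S s t n f"
  shows "multilinear_on S s t n (\<lambda>vs. f (rotate r vs))"
proof (induct r)
  case (Suc r)
  show ?case
    using multilinear_on_rotate1[OF Suc] by (simp add: rotate1_rotate_swap)
qed (simp add: assms)

lemma multilinear_on_plus:
  "\<lbrakk>vector_space t; multilinear_on S s t n f; multilinear_on S s t n g\<rbrakk> \<Longrightarrow>
     multilinear_on S s t n (\<lambda>vs. f vs + g vs)"
  by (simp add: multilinear_on_iff lin_on_plus)

lemma multilinear_on_minus:
  "\<lbrakk>vector_space t; multilinear_on S s t n f\<rbrakk> \<Longrightarrow> multilinear_on S s t n (\<lambda>vs. - f vs)"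
  by (simp add: multilinear_on_iff lin_on_minus)

lemma multilinear_on_sg:
  "\<lbrakk>vector_space t; multilinear_on S s t n f\<rbrakk> \<Longrightarrow> multilinear_on S s t n (\<lambda>vs. sg m (f vs))"
  by (simp add: multilinear_on_iff lin_on_sg)

lemma multilinear_on_sum:
  "\<lbrakk>vector_space t; \<And>i. i \<in> A \<Longrightarrow> multilinear_on S s t n (f i)\<rbrakk> \<Longrightarrow>
     multilinear_on S s t n (\<lambda>vs. \<Sum>i\<in>A. f i vs)"
  by (simp add: multilinear_on_iff lin_on_sum)

lemma multilinear_on_compose:
  assumes "multilinear_on S s t n f" "lin_on T t u g"
    "\<And>vs. \<lbrakk>set vs \<subseteq> S; length vs = n\<rbrakk> \<Longrightarrow> f vs \<in> T"
  shows "multilinear_on S s u n (\<lambda>vs. g (f vs))"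
  unfolding multilinear_on_iff
proof (intro allI impI)
  fix us ws assume *: "set us \<subseteq> S \<and> set ws \<subseteq> S \<and> length us + length ws + 1 = n"
  then have "lin_on S s t (\<lambda>v. f (us @ v # ws))"
    using multilinear_onD[OF assms(1)] by blast
  from lin_on_compose[OF this assms(2)] show "lin_on S s u (\<lambda>v. g (f (us @ v # ws)))"
    using * assms(3) by auto
qed

lemma multilinear_on_Cons:
  assumes "multilinear_on S s t (Suc n) f" "x \<in> S"
  shows "multilinear_on S s t n (\<lambda>vs. f (x # vs))"
  using assms multilinear_onD[OF assms(1), of "x # us" for us] by (auto simp: multilinear_on_iff)

lemma multilinear_on_insert:
  assumes "multilinear_on S s t (Suc n) f" "multilinear_on S s s 2 q" "j \<le> n"
    "\<And>u v. u \<in> S \<Longrightarrow> v \<in> S \<Longrightarrow> q [u, v] \<in> S"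
  shows "multilinear_on S s t (n + 2) (\<lambda>vs. f (take j vs @ q [vs ! j, vs ! Suc j] # drop (j + 2) vs))"
proof (rule multilinear_onI)
  fix us ws assume *: "set us \<subseteq> S" "set ws \<subseteq> S" "length us + length ws + 1 = n + 2"
  \<comment> \<open>The varying vector stands behind the pair at positions \<open>j\<close> and
    \<open>Suc j\<close>, is its second member, is its first member, or stands before it.\<close>
  consider "j + 2 \<le> length us" | "length us = j + 1" | "length us = j" | "length us < j"
    by linarith
  then show "lin_on S s t (\<lambda>v. f (take j (us @ v # ws) @
      q [(us @ v # ws) ! j, (us @ v # ws) ! Suc j] # drop (j + 2) (us @ v # ws)))"
  proof cases
    case 1
    have "set (take j us) \<subseteq> S" "set (drop (j + 2) us) \<subseteq> S" "us ! j \<in> S" "us ! Suc j \<in> S"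
      using *(1) 1 by (auto dest: in_set_takeD in_set_dropD)
    then show ?thesis
      using 1 * assms(4) multilinear_onD[OF assms(1),
        of "take j us @ q [us ! j, us ! Suc j] # drop (j + 2) us" ws]
      by (simp add: nth_append)
  next
    case 2
    then obtain us' a where us: "us = us' @ [a]" "length us' = j"
      by (metis length_append_singleton Suc_eq_plus1 append_butlast_last_id length_butlast
          diff_add_inverse2 list.size(3) nat.simps(3))
    have q: "lin_on S s s (\<lambda>v. q [a, v])"
      using multilinear_onD[OF assms(2), of "[a]" "[]"] us * by simp
    have f: "lin_on S s t (\<lambda>v. f (us' @ v # ws))"
      using multilinear_onD[OF assms(1), of us' ws] us * by simp
    have "lin_on S s t (\<lambda>v. f (us' @ q [a, v] # ws))"
      using us * by (auto intro: lin_on_compose[OF q f] assms(4))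
    then show ?thesis using us by (simp add: nth_append)
  next
    case 3
    then obtain b ws' where ws: "ws = b # ws'"
      using * assms(3) by (cases ws) auto
    have q: "lin_on S s s (\<lambda>v. q [v, b])"
      using multilinear_onD[OF assms(2), of "[]" "[b]"] ws * by simp
    have f: "lin_on S s t (\<lambda>v. f (us @ v # ws'))"
      using multilinear_onD[OF assms(1), of us ws'] ws * by simp
    have "lin_on S s t (\<lambda>v. f (us @ q [v, b] # ws'))"
      using ws * by (auto intro: lin_on_compose[OF q f] assms(4))
    then show ?thesis using 3 ws by (simp add: nth_append)
  next
    case 4
    define i where "i = j - length us - 1"
    have j: "j = length us + 1 + i" using 4 by (simp add: i_def)
    have "i + 2 \<le> length ws" using * assms(3) j by linarith
    then have "set (take i ws) \<subseteq> S" "set (drop (i + 2) ws) \<subseteq> S" "ws ! i \<in> S" "ws ! Suc i \<in> S"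
      using *(2) by (auto dest: in_set_takeD in_set_dropD)
    then show ?thesis
      using * \<open>i + 2 \<le> length ws\<close> assms(4) multilinear_onD[OF assms(1),
        of us "take i ws @ q [ws ! i, ws ! Suc i] # drop (i + 2) ws"]
      by (simp add: j nth_append numeral_3_eq_3)
  qed
qed

lemma homogeneous_simps [simp]:
  "homogeneous G [] vs \<longleftrightarrow> vs = []"
  "homogeneous G ns [] \<longleftrightarrow> ns = []"
  "homogeneous G (n # ns) (v # vs) \<longleftrightarrow> v \<in> G n \<and> homogeneous G ns vs"
  by (simp_all add: homogeneous_def)

lemma homogeneous_length: "homogeneous G ns vs \<Longrightarrow> length ns = length vs"
  by (simp add: homogeneous_def list_all2_lengthD)

lemma homogeneous_append:
  "\<lbrakk>homogeneous G ms us; homogeneous G ns vs\<rbrakk> \<Longrightarrow> homogeneous G (ms @ ns) (us @ vs)"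
  by (simp add: homogeneous_def list_all2_appendI)

lemma homogeneous_snoc:
  "homogeneous G (ms @ [n]) (us @ [v]) \<longleftrightarrow> homogeneous G ms us \<and> v \<in> G n"
  by (cases "length ms = length us")
    (auto simp: homogeneous_def list_all2_append dest: list_all2_lengthD)

lemma homogeneous_take: "homogeneous G ns vs \<Longrightarrow> homogeneous G (take r ns) (take r vs)"
  and homogeneous_drop: "homogeneous G ns vs \<Longrightarrow> homogeneous G (drop r ns) (drop r vs)"
  by (simp_all add: homogeneous_def list_all2_takeI list_all2_dropI)

lemma homogeneous_rotate:
  "homogeneous G ns vs \<Longrightarrow> homogeneous G (rotate r ns) (rotate r vs)"
  by (simp add: rotate_drop_take homogeneous_length homogeneous_append homogeneous_take
      homogeneous_drop)

lemma sum_list_rotate: "sum_list (rotate r ns) = (sum_list ns :: int)"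
proof -
  have "sum_list (drop i ns @ take i ns) = sum_list (take i ns @ drop i ns)" for i
    by (simp only: sum_list_append add.commute)
  then show ?thesis by (simp add: rotate_drop_take)
qed

lemma insert_homogeneous:
  assumes "homogeneous G ns xs" "Suc j < length xs" "y \<in> G (ns ! j + ns ! Suc j)"
  shows "homogeneous G (take j ns @ (ns ! j + ns ! Suc j) # drop (j + 2) ns)
    (take j xs @ y # drop (j + 2) xs)"
  using assms by (intro homogeneous_append homogeneous_take) (simp_all add: homogeneous_drop)

lemma sum_list_insert:
  "Suc j < length ns \<Longrightarrow>
    sum_list (take j ns @ (ns ! j + ns ! Suc j) # drop (j + 2) ns) = (sum_list ns :: int)"
proof -
  assume j: "Suc j < length ns"
  have "ns = take j ns @ ns ! j # ns ! Suc j # drop (j + 2) ns"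
    using j by (simp add: Cons_nth_drop_Suc)
  from arg_cong[OF this, of sum_list] show ?thesis by simp
qed

lemma homogeneous_nth: "\<lbrakk>homogeneous G ns xs; i < length xs\<rbrakk> \<Longrightarrow> xs ! i \<in> G (ns ! i)"
  by (auto simp: homogeneous_def list_all2_conv_all_nth)

section \<open>Sums over homogeneous components in several arguments\<close>

context graded
begin

lemma homogeneous_set: "homogeneous G ns vs \<Longrightarrow> set vs \<subseteq> S"
  by (induct vs arbitrary: ns) (auto simp: homogeneous_def list_all2_Cons2 dest: G_S)

lemma hsums_lin_param:
  assumes "vector_space t" "set vs \<subseteq> S"
    "\<And>ns xs. \<lbrakk>homogeneous G ns xs; length xs = length vs\<rbrakk> \<Longrightarrow> lin_on Z z t (\<lambda>p. F p ns xs)"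
  shows "lin_on Z z t (\<lambda>p. hsums G (F p) vs)"
  using assms(2,3)
proof (induct vs arbitrary: F)
  case (Cons v vs)
  then show ?case
    by (auto intro!: hsum_lin_param[OF assms(1)] Cons.hyps)
qed simp

text \<open>The degree list only selects one of the multilinear maps \<open>F ns\<close>. In the sum
  over components of the varying slot linearity is \<open>hsum_lin\<close>; for the slots before and
  after it that vector is a mere parameter.\<close>

lemma hsums_multilinear:
  assumes "vector_space t" "\<And>ns. length ns = n \<Longrightarrow> multilinear_on S s t n (F ns)"
  shows "multilinear_on S s t n (hsums G F)"
proof (rule multilinear_onI)
  fix us ws assume "set us \<subseteq> S" "set ws \<subseteq> S" "length us + length ws + 1 = n"
  then show "lin_on S s t (\<lambda>v. hsums G F (us @ v # ws))"
    using assms(2)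
  proof (induct us arbitrary: n F)
    case Nil
    have "lin_on S s t (\<lambda>x. F (m # ns) (x # xs))"
      if "homogeneous G ns xs" "length xs = length ws" for m ns xs
      using multilinear_onD[OF Nil(4), of "m # ns" "[]" xs] that Nil homogeneous_set[OF that(1)]
      by (simp add: homogeneous_length)
    then show ?case
      using Nil by (auto intro!: hsum_lin[OF assms(1)] hsums_lin_param[OF assms(1)])
  next
    case (Cons u us)
    show ?case
      unfolding append_Cons hsums.simps
    proof (rule hsum_lin_param[OF assms(1)])
      show "u \<in> S" using Cons by simp
      fix m x assume "x \<in> G m"
      show "lin_on S s t (\<lambda>v. hsums G (\<lambda>ns xs. F (m # ns) (x # xs)) (us @ v # ws))"
      proof (rule Cons.hyps[of "n - 1"])
        fix ns :: "int list" assume "length ns = n - 1"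
        then show "multilinear_on S s t (n - 1) (\<lambda>xs. F (m # ns) (x # xs))"
          using Cons.prems \<open>x \<in> G m\<close> by (intro multilinear_on_Cons) (auto intro: G_S)
      qed (use Cons.prems in auto)
    qed
  qed
qed

lemma hsums_cong:
  assumes "set vs \<subseteq> S"
    "\<And>ns xs. \<lbrakk>homogeneous G ns xs; length xs = length vs\<rbrakk> \<Longrightarrow> F ns xs = F' ns xs"
  shows "hsums G F vs = hsums G F' vs"
  using assms
proof (induct vs arbitrary: F F')
  case (Cons v vs)
  show ?case
    unfolding hsums.simps
  proof (rule hsum_cong)
    fix n x assume "x \<in> G n"
    then show "hsums G (\<lambda>ns xs. F (n # ns) (x # xs)) vs = hsums G (\<lambda>ns xs. F' (n # ns) (x # xs)) vs"
      using Cons.prems by (intro Cons.hyps) simp_all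
  qed (use Cons.prems in simp)
qed simp

lemma hsums_mem:
  assumes "set vs \<subseteq> S"
    "\<And>ns xs. \<lbrakk>homogeneous G ns xs; length xs = length vs\<rbrakk> \<Longrightarrow> F ns xs \<in> Z"
    "0 \<in> Z" "\<And>x y. x \<in> Z \<Longrightarrow> y \<in> Z \<Longrightarrow> x + y \<in> Z"
  shows "hsums G F vs \<in> Z"
  using assms(1,2)
proof (induct vs arbitrary: F)
  case (Cons v vs)
  show ?case
    unfolding hsums.simps
  proof (rule hsum_mem)
    fix n x assume "x \<in> G n"
    then show "hsums G (\<lambda>ns xs. F (n # ns) (x # xs)) vs \<in> Z"
      using Cons.prems by (intro Cons.hyps) simp_all
  qed (use Cons.prems in simp, use assms(3,4) in blast)+
qed simp

lemma hsums_homogeneous: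
  assumes "homogeneous G ns vs" "length vs = n" "multilinear_on S s t n (F ns)"
  shows "hsums G F vs = F ns vs"
  using assms
proof (induct vs arbitrary: F ns n)
  case (Cons v vs)
  obtain m ms where ns: "ns = m # ms" "v \<in> G m" "homogeneous G ms vs"
    using Cons.prems(1) by (cases ns) auto
  have F0: "F ns (0 # vs) = 0"
    using lin_on_0[OF multilinear_onD[OF Cons.prems(3), of "[]" vs]] Cons.prems(2)
      homogeneous_set[OF ns(3)] by simp
  have inner: "hsums G (\<lambda>ks xs. F (m # ks) (x # xs)) vs = F ns (x # vs)" if "x \<in> G m" for x
    using Cons.hyps[OF ns(3) refl, of "\<lambda>ks xs. F (m # ks) (x # xs)"] Cons.prems(2,3) ns(1) that
    by (auto intro: multilinear_on_Cons G_S)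
  \<comment> \<open>The components of \<open>v\<close> outside degree \<open>m\<close> vanish, so
    the summand may be set to \<open>0\<close> there and nothing has to be known about
    \<open>F\<close> at other degrees.\<close>
  have "hsums G F (v # vs) = hsum G (\<lambda>k x. if k = m then F ns (x # vs) else 0) v"
    by (simp add: hsum_def hcomp_homogeneous[OF ns(2)])
      (use inner[OF ns(2)] in \<open>auto intro!: sum.cong\<close>)
  also have "\<dots> = F ns (v # vs)"
    by (subst hsum_homogeneous[OF ns(2)]) (auto simp: F0)
  finally show ?case .
qed simp

text \<open>The arguments are made homogeneous from left to right: the prefix \<open>us\<close>
  already is, and linearity in the next slot lengthens it by one. Through this lemma all sign
  computations take place on homogeneous vectors.\<close>

lemma multilinear_on_eqI:
  assumes "multilinear_on S s t n f" "multilinear_on S s t n g"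
    "\<And>ns vs. \<lbrakk>homogeneous G ns vs; length vs = n\<rbrakk> \<Longrightarrow> f vs = g vs"
    "set vs \<subseteq> S" "length vs = n"
  shows "f vs = g vs"
proof -
  have "f (us @ vs) = g (us @ vs)"
    if "homogeneous G ns us" "set vs \<subseteq> S" "length us + length vs = n" for ns us vs
    using that
  proof (induct vs arbitrary: ns us)
    case (Cons v vs)
    have us: "set us \<subseteq> S" by (rule homogeneous_set[OF Cons(2)])
    show ?case
    proof (rule lin_on_eqI)
      show "lin_on S s t (\<lambda>v. f (us @ v # vs))" "lin_on S s t (\<lambda>v. g (us @ v # vs))"
        using multilinear_onD[OF assms(1)] multilinear_onD[OF assms(2)] us Cons.prems by auto
      show "f (us @ x # vs) = g (us @ x # vs)" if "x \<in> G m" for m x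
        using Cons.hyps[of "ns @ [m]" "us @ [x]"] Cons.prems that
        by (simp add: homogeneous_def list_all2_appendI)
    qed (use Cons.prems in simp)
  qed (auto intro: assms(3))
  from this[of "[]" "[]" vs] show ?thesis using assms(4,5) by simp
qed

end

lemma (in graded) shift_map_multilinear:
  assumes "vector_space t" "multilinear_on S s t n f"
  shows "multilinear_on S s t n (shift_map G f)"
  unfolding shift_map_def
  by (intro hsums_multilinear assms(1) multilinear_on_sg assms(2))

lemma (in graded) shift_map_homogeneous:
  assumes "vector_space t" "multilinear_on S s t n f" "homogeneous G ns vs" "length vs = n"
  shows "shift_map G f vs = sg (\<Sum>j<n. int (n - Suc j) * (ns ! j - 1)) (f vs)"
  unfolding shift_map_def
  by (subst hsums_homogeneous[OF assms(3,4)])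
    (use assms in \<open>auto intro: multilinear_on_sg dest: homogeneous_length\<close>)

lemma multilinear_on_2:
  assumes "\<And>v. v \<in> S \<Longrightarrow> lin_on S s t (\<lambda>u. f u v)" "\<And>u. u \<in> S \<Longrightarrow> lin_on S s t (f u)"
  shows "multilinear_on S s t 2 (\<lambda>vs. f (vs ! 0) (vs ! 1))"
proof (rule multilinear_onI)
  fix us ws assume *: "set us \<subseteq> S" "set ws \<subseteq> S" "length us + length ws + 1 = 2"
  show "lin_on S s t (\<lambda>v. f ((us @ v # ws) ! 0) ((us @ v # ws) ! 1))"
  proof (cases us)
    case Nil
    then obtain w where "ws = [w]" using * by (auto simp: length_Suc_conv)
    then show ?thesis using Nil * assms(1) by simp
  next
    case (Cons u us')
    then have "us' = []" "ws = []" using * by auto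
    then show ?thesis using Cons * assms(2) by simp
  qed
qed

lemma (in graded) shift_map_2:
  assumes "vector_space t"
    "\<And>v. v \<in> S \<Longrightarrow> lin_on S s t (\<lambda>u. f u v)" "\<And>u. u \<in> S \<Longrightarrow> lin_on S s t (f u)"
    "u \<in> G m" "v \<in> G n"
  shows "shift_map G (\<lambda>vs. f (vs ! 0) (vs ! 1)) [u, v] = sg (m - 1) (f u v)"
  using shift_map_homogeneous[OF assms(1) multilinear_on_2[OF assms(2,3)], of "[m, n]" "[u, v]"]
    assms(4,5)
  by (simp add: numeral_2_eq_2)

section \<open>Signed rotations\<close>

text \<open>Homogeneous vectors are carried around as pairs of a degree and a vector.\<close>

definition wsum :: "(int \<times> 'a) list \<Rightarrow> int" where
  "wsum ps = (\<Sum>p\<leftarrow>ps. fst p - 1)"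

lemma wsum_simps [simp]:
  "wsum [] = 0" "wsum (p # ps) = fst p - 1 + wsum ps" "wsum (ps @ qs) = wsum ps + wsum qs"
  by (simp_all add: wsum_def)

lemma sdeg_map_fst: "sdeg (map fst ps) = wsum ps"
  by (simp add: sdeg_def wsum_def o_def)

lemma sdeg_simps [simp]:
  "sdeg [] = 0" "sdeg (n # ns) = n - 1 + sdeg ns" "sdeg (ms @ ns) = sdeg ms + sdeg ns"
  by (simp_all add: sdeg_def)

text \<open>The sign is that of moving the first letter past all the others; \<open>take 1\<close>
  and \<open>drop 1\<close> give exponent \<open>0\<close> on the empty list.\<close>

definition srot ::
  "((int \<times> 'a) list \<Rightarrow> 'b::ab_group_add) \<Rightarrow> (int \<times> 'a) list \<Rightarrow> 'b" where
  "srot F ps = sg (wsum (take 1 ps) * wsum (drop 1 ps)) (F (rotate1 ps))"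

definition cyc ::
  "((int \<times> 'a) list \<Rightarrow> 'b::ab_group_add) \<Rightarrow> (int \<times> 'a) list \<Rightarrow> 'b" where
  "cyc F ps =
     (\<Sum>r<length ps. sg (wsum (take r ps) * wsum (drop r ps)) (F (rotate r ps)))"

text \<open>
  As \<open>mu\<close> adds the unshifted degrees, it is an odd letter on the shifted space and picks up the
  sign of moving past the first \<open>j\<close> arguments.
\<close>

definition insert_op ::
  "(int \<times> 'a \<Rightarrow> int \<times> 'a \<Rightarrow> int \<times> 'a) \<Rightarrow> nat \<Rightarrow>
   ((int \<times> 'a) list \<Rightarrow> 'b::ab_group_add) \<Rightarrow> (int \<times> 'a) list \<Rightarrow> 'b" where
  "insert_op mu j F ps =
     sg (wsum (take j ps)) (F (take j ps @ mu (ps ! j) (ps ! Suc j) # drop (j + 2) ps))"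

lemma srot_Cons: "srot F (p # ps) = sg ((fst p - 1) * wsum ps) (F (ps @ [p]))"
  by (simp add: srot_def)

lemma srot_funpow:
  "r \<le> length ps \<Longrightarrow>
     (srot ^^ r) F ps = sg (wsum (take r ps) * wsum (drop r ps)) (F (rotate r ps))"
proof (induct r arbitrary: F)
  case (Suc r)
  define a x b where "a = take r ps" and "x = ps ! r" and "b = drop (Suc r) ps"
  have ps: "ps = a @ x # b" and a: "length a = r"
    using Suc.prems by (simp_all add: a_def x_def b_def id_take_nth_drop)
  have rot: "rotate r ps = x # b @ a" "rotate (Suc r) ps = b @ a @ [x]"
    using rotate_append[of a "x # b"] rotate_append[of "a @ [x]" b]
    by (simp_all add: ps a del: rotate_Suc)
  have "(srot ^^ Suc r) F ps = (srot ^^ r) (srot F) ps"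
    by (simp add: funpow_swap1)
  also have "\<dots> = sg (wsum a * wsum (x # b)) (srot F (rotate r ps))"
    using Suc.hyps[of "srot F"] Suc.prems by (simp add: ps a)
  \<comment> \<open>The letter \<open>x\<close> crosses \<open>a\<close> once with the block and
    once when it is rotated itself; these two contributions cancel modulo 2.\<close>
  also have "\<dots> = sg (wsum (a @ [x]) * wsum b) (F (rotate (Suc r) ps))"
    unfolding rot srot_Cons by (auto intro!: sg_cong)
  finally show ?case by (simp add: ps a del: rotate_Suc)
qed simp

lemma cyc_eq_sum_srot: "cyc F ps = (\<Sum>r<length ps. (srot ^^ r) F ps)"
  unfolding cyc_def by (intro sum.cong refl) (simp add: srot_funpow)

text \<open>After a full turn one of the two exchanged blocks is empty, so no sign is left.\<close>

lemma srot_length: "(srot ^^ length ps) F ps = F ps"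
  by (simp add: srot_funpow)

text \<open>The sum over an orbit is shifted by one step; the term that leaves and the one that
  enters agree by \<open>srot_length\<close>.\<close>

lemma cyc_srot: "cyc (srot F) ps = cyc F ps"
proof -
  have "cyc (srot F) ps = (\<Sum>r<length ps. (srot ^^ Suc r) F ps)"
    by (simp add: cyc_eq_sum_srot funpow_swap1)
  also have "\<dots> + F ps = (\<Sum>r<Suc (length ps). (srot ^^ r) F ps)"
    unfolding sum.lessThan_Suc_shift by (simp add: add.commute)
  also have "\<dots> = cyc F ps + F ps"
    by (simp only: sum.lessThan_Suc srot_length cyc_eq_sum_srot)
  finally show ?thesis by simp
qed

lemma cyc_srot_funpow: "cyc ((srot ^^ r) F) ps = cyc F ps"
  by (induct r) (simp_all add: cyc_srot)

lemma srot_cyc: "srot (cyc F) ps = cyc F ps"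
proof -
  have "srot (cyc F) ps = (\<Sum>r<length ps. (srot ^^ r) (srot F) ps)"
    by (simp add: srot_def[of "cyc F"] cyc_eq_sum_srot sg_sum flip: funpow_swap1)
      (simp add: srot_def)
  then show ?thesis
    by (simp add: cyc_eq_sum_srot[symmetric] cyc_srot)
qed

lemma cyc_cong:
  "(\<And>r. r < length ps \<Longrightarrow> F (rotate r ps) = F' (rotate r ps)) \<Longrightarrow> cyc F ps = cyc F' ps"
  by (simp add: cyc_def)

lemma cyc_plus: "cyc (\<lambda>ps. F ps + F' ps) ps = cyc F ps + cyc F' ps"
  by (simp add: cyc_def sg_add sum.distrib)

lemma cyc_sum: "cyc (\<lambda>ps. \<Sum>i\<in>A. F i ps) ps = (\<Sum>i\<in>A. cyc (F i) ps)"
  unfolding cyc_def sg_sum by (rule sum.swap)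

text \<open>To bring the inserted letter behind the block \<open>b\<close> of length
  \<open>k + 1 - s\<close>, the merged list needs \<open>s\<close> rotations, but the original one
  \<open>Suc s\<close>, because two letters have to cross \<open>b\<close>. The merged letter has
  shifted degree one more than the pair; the resulting extra factor \<open>wsum b\<close> is the
  sign in \<open>insert_op\<close> of moving the operation past \<open>b\<close>.\<close>

lemma insert_srot:
  assumes wt: "\<And>p q. fst (mu p q) = fst p + fst q"
    and "length ps = k + 2" "0 < s" "s \<le> k"
  shows "insert_op mu 0 ((srot ^^ s) F) ps = (srot ^^ Suc s) (insert_op mu (k + 1 - s) F) ps"
proof -
  obtain p0 p1 rest where ps: "ps = p0 # p1 # rest" "length rest = k"
    using assms(2) by (metis add_2_eq_Suc' length_Suc_conv)
  obtain t where s: "s = Suc t" using assms(3) by (cases s) auto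
  define a b where "a = take t rest" and "b = drop t rest"
  have rest: "rest = a @ b" and a: "length a = t" and b: "length b = k + 1 - s"
    using ps(2) s assms(4) by (simp_all add: a_def b_def)
  have "rotate s (mu p0 p1 # rest) = b @ mu p0 p1 # a"
    using rotate_append[of "mu p0 p1 # a" b] by (simp add: rest s a del: rotate_Suc)
  moreover have "rotate (Suc s) ps = b @ p0 # p1 # a"
    using rotate_append[of "p0 # p1 # a" b] by (simp add: ps(1) rest s a del: rotate_Suc)
  moreover have "s \<le> length (mu p0 p1 # rest)" "Suc s \<le> length ps"
    using ps assms(4) by simp_all
  ultimately show ?thesis
    using ps(1) s a b unfolding insert_op_def
    by (auto simp: srot_funpow wt nth_append rest simp del: rotate_Suc funpow.simps intro!: sg_cong)
qed

lemma cyc_insert_cyc: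
  assumes wt: "\<And>p q. fst (mu p q) = fst p + fst q"
    and len: "length ps = k + 2"
  shows "cyc (insert_op mu 0 (cyc F)) ps = (\<Sum>j\<le>k. cyc (insert_op mu j F) ps)"
proof -
  \<comment> \<open>Merging two of the \<open>k + 2\<close> letters leaves \<open>Suc k\<close>,
    hence the range of the inner sum.\<close>
  have "cyc (insert_op mu 0 (cyc F)) ps
      = cyc (\<lambda>qs. \<Sum>s<Suc k. insert_op mu 0 ((srot ^^ s) F) qs) ps"
    using len by (intro cyc_cong) (simp add: insert_op_def cyc_eq_sum_srot sg_sum)
  also have "\<dots> = (\<Sum>s<Suc k. cyc (insert_op mu 0 ((srot ^^ s) F)) ps)"
    by (rule cyc_sum)
  also have "\<dots> = cyc (insert_op mu 0 F) ps + (\<Sum>s<k. cyc (insert_op mu 0 ((srot ^^ Suc s) F)) ps)"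
    by (subst sum.lessThan_Suc_shift) simp
  \<comment> \<open>The unrotated term keeps the insertion in slot \<open>0\<close>; with
    \<open>Suc s\<close> inner rotations the slot becomes \<open>k - s\<close>, and the outer
    rotations are then absorbed by \<open>cyc\<close>.\<close>
  also have "(\<Sum>s<k. cyc (insert_op mu 0 ((srot ^^ Suc s) F)) ps)
      = (\<Sum>s<k. cyc ((srot ^^ Suc (Suc s)) (insert_op mu (k - s) F)) ps)"
  proof (intro sum.cong refl cyc_cong)
    fix s r assume "s \<in> {..<k}"
    then show "insert_op mu 0 ((srot ^^ Suc s) F) (rotate r ps) =
        (srot ^^ Suc (Suc s)) (insert_op mu (k - s) F) (rotate r ps)"
      using insert_srot[of mu "rotate r ps" k "Suc s" F, OF wt] len by simp
  qed
  also have "\<dots> = (\<Sum>s<k. cyc (insert_op mu (k - s) F) ps)"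
    by (simp only: cyc_srot_funpow)
  also have "\<dots> = (\<Sum>j<k. cyc (insert_op mu (Suc j) F) ps)"
    by (rule sum.reindex_bij_witness[of _ "\<lambda>j. k - Suc j" "\<lambda>s. k - Suc s"])
      (auto simp: Suc_diff_Suc)
  also have "cyc (insert_op mu 0 F) ps + \<dots> = (\<Sum>j<Suc k. cyc (insert_op mu j F) ps)"
    by (subst sum.lessThan_Suc_shift) simp
  finally show ?thesis by (simp add: lessThan_Suc_atMost)
qed

section \<open>Coadjoint actions\<close>

lemma dual_lin_on: "f \<in> dual s \<Longrightarrow> lin_on S s (*) f"
  by (simp add: dual_def linear_lin_on)

lemma lin_on_eval: "lin_on F (\<lambda>r g y. r * g y) (*) (\<lambda>f. f y)"
  by (simp add: lin_on_def)

lemma dual_gr_zero: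
  assumes "f \<in> dual_gr s G m" "x \<in> G n" "m + n \<noteq> 0"
  shows "f x = 0"
proof -
  have "n \<noteq> - m" using assms(3) by simp
  then show ?thesis using assms(1,2) by (simp add: dual_gr_def)
qed

text \<open>\<open>U\<close> is the acting space, \<open>T\<close> the domain of the resulting
  functional and \<open>P\<close> the domain of the given one. The acting element is the second
  factor of \<open>p\<close>, as in the left coadjoint action; for right actions \<open>p\<close> is
  a product with its factors exchanged.\<close>

locale graded_pairing =
  U: graded sU UNIV GU + T: graded sT UNIV GT + P: graded sP UNIV GP +
  P': graded "\<lambda>r g y. r * g y" "dual sP" "dual_gr sP GP"
  for sU :: "'k::field \<Rightarrow> 'u::ab_group_add \<Rightarrow> 'u" and GU
    and sT :: "'k \<Rightarrow> 't::ab_group_add \<Rightarrow> 't" and GT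
    and sP :: "'k \<Rightarrow> 'p::ab_group_add \<Rightarrow> 'p" and GP +
  fixes p :: "'t \<Rightarrow> 'u \<Rightarrow> 'p"
  assumes lin1: "lin_on UNIV sT sP (\<lambda>w. p w u)" and lin2: "lin_on UNIV sU sP (p w)"
    and gr: "\<lbrakk>w \<in> GT n; u \<in> GU m\<rbrakk> \<Longrightarrow> p w u \<in> GP (n + m)"
begin

lemma dual_gr_dual: "f \<in> dual_gr sP GP m \<Longrightarrow> f \<in> dual sP"
  by (simp add: dual_gr_def)

lemma lcoact_lin_acting:
  assumes "f \<in> dual sP"
  shows "lin_on UNIV sU (*) (\<lambda>u. lcoact GU GT (dual_gr sP GP) p u f w)"
  unfolding lcoact_def
  by (intro U.hsum_lin P'.hsum_lin_param T.hsum_lin_param vector_space_field lin_on_sg)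
    (auto intro: assms lin_on_compose_UNIV[OF lin2 dual_lin_on] dual_gr_dual)

lemma lcoact_lin_functional:
  "lin_on (dual sP) (\<lambda>r g y. r * g y) (*) (\<lambda>f. lcoact GU GT (dual_gr sP GP) p u f w)"
  unfolding lcoact_def
  by (intro U.hsum_lin_param P'.hsum_lin T.hsum_lin_param vector_space_field lin_on_sg)
    (auto intro: lin_on_eval)

lemma lcoact_lin_arg:
  assumes "f \<in> dual sP"
  shows "lin_on UNIV sT (*) (\<lambda>w. lcoact GU GT (dual_gr sP GP) p u f w)"
  unfolding lcoact_def
  by (intro U.hsum_lin_param P'.hsum_lin_param T.hsum_lin vector_space_field lin_on_sg)
    (auto intro: assms lin_on_compose_UNIV[OF lin1 dual_lin_on] dual_gr_dual)

lemma lcoact_homogeneous: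
  assumes "u \<in> GU l" "f \<in> dual_gr sP GP m" "w \<in> GT n"
  shows "lcoact GU GT (dual_gr sP GP) p u f w = sg (l * (m + n)) (f (p w u))"
proof -
  have *: "f (p 0 u) = 0" "f (p w 0) = 0" if "f \<in> dual sP" for f w u
    using lin_on_0[OF lin1] lin_on_0[OF lin2] lin_on_0[OF dual_lin_on[OF that]] by auto
  have T: "hsum GT (\<lambda>n w. sg (l * (m + n)) (f (p w u))) w = sg (l * (m + n)) (f (p w u))"
    if "f \<in> dual sP" for f u l m
    by (rule T.hsum_homogeneous[OF assms(3)]) (simp add: * that)
  have F: "hsum (dual_gr sP GP) (\<lambda>m f. hsum GT (\<lambda>n w. sg (l * (m + n)) (f (p w u))) w) f
     = sg (l * (m + n)) (f (p w u))" for u l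
    unfolding T[OF dual_gr_dual[OF assms(2)], symmetric]
    by (rule P'.hsum_homogeneous[OF assms(2)]) (simp add: hsum_def)
  show ?thesis
    unfolding lcoact_def
    by (subst U.hsum_homogeneous[OF assms(1)]) (auto simp: F * dual_gr_dual[OF assms(2)])
qed

lemma lcoact_dual: "f \<in> dual sP \<Longrightarrow> lcoact GU GT (dual_gr sP GP) p u f \<in> dual sT"
  unfolding dual_iff[OF T.vector_space] by (rule lcoact_lin_arg)

lemma lcoact_gr:
  assumes "u \<in> GU l" "f \<in> dual_gr sP GP m"
  shows "lcoact GU GT (dual_gr sP GP) p u f \<in> dual_gr sT GT (l + m)"
proof -
  have "lcoact GU GT (dual_gr sP GP) p u f w = 0" if "w \<in> GT n" "n \<noteq> - (l + m)" for w n
  proof -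
    have "f (p w u) = 0"
      using that(2) by (intro dual_gr_zero[OF assms(2) gr[OF that(1) assms(1)]]) simp
    then show ?thesis by (simp add: lcoact_homogeneous[OF assms that(1)])
  qed
  then show ?thesis
    using lcoact_dual[OF dual_gr_dual[OF assms(2)]] unfolding dual_gr_def by blast
qed

lemma rcoact_lin_acting:
  "f \<in> dual sP \<Longrightarrow> lin_on UNIV sU (*) (\<lambda>u. rcoact (\<lambda>u w. p w u) f u w)"
  unfolding rcoact_def by (rule lin_on_compose_UNIV[OF lin2 dual_lin_on])

lemma rcoact_dual: "f \<in> dual sP \<Longrightarrow> rcoact (\<lambda>u w. p w u) f u \<in> dual sT"
  unfolding dual_iff[OF T.vector_space] rcoact_def
  by (rule lin_on_compose_UNIV[OF lin1 dual_lin_on])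

lemma rcoact_gr:
  assumes "u \<in> GU l" "f \<in> dual_gr sP GP m"
  shows "rcoact (\<lambda>u w. p w u) f u \<in> dual_gr sT GT (m + l)"
proof -
  have "rcoact (\<lambda>u w. p w u) f u w = 0" if "w \<in> GT n" "n \<noteq> - (m + l)" for w n
    unfolding rcoact_def
    using that(2) by (intro dual_gr_zero[OF assms(2) gr[OF that(1) assms(1)]]) simp
  then show ?thesis
    using rcoact_dual[OF dual_gr_dual[OF assms(2)]] unfolding dual_gr_def by blast
qed

end


section \<open>The double semidirect product\<close>

lemma fd_graded_space_graded:
  assumes "fd_graded_space s G"
  shows "graded s UNIV G" "graded (\<lambda>r g y. r * g y) (dual s) (dual_gr s G)"
proof -
  obtain B where "finite_dimensional_vector_space s B"
    using assms by (auto simp: fd_graded_space_def)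
  then interpret finite_dimensional_vector_space s B .
  show gr: "graded s UNIV G"
    using assms by unfold_locales (auto simp: fd_graded_space_def)
  show "graded (\<lambda>r g y. r * g y) (dual s) (dual_gr s G)"
    by (rule graded_dual[OF gr graded.finite_degrees[OF gr finite_Basis span_Basis refl]])
qed

locale double_semidirect =
  fixes D :: "('k::field_char_0, 'v::ab_group_add, 'm::ab_group_add) alg_mod"
  assumes comm_alg_mod: "comm_alg_mod D"
begin

sublocale V: graded "scV D" UNIV "grV D"
  + V': graded "\<lambda>r g y. r * g y" "dual (scV D)" "dual_gr (scV D) (grV D)"
  + M: graded "scM D" UNIV "grM D"
  + M': graded "\<lambda>r g y. r * g y" "dual (scM D)" "dual_gr (scM D) (grM D)"
  using comm_alg_mod by (simp_all add: comm_alg_mod_def fd_graded_space_graded)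

lemma tscale_eq:
  "tscale D = (\<lambda>r p. (scV D r (fst p), scM D r (fst (snd p)),
     \<lambda>y. r * fst (snd (snd p)) y, \<lambda>y. r * snd (snd (snd p)) y))"
  by (auto simp: tscale_def fun_eq_iff)

sublocale T: graded "tscale D" "tcar D" "tgr D"
proof -
  have "tgr D = (\<lambda>n. grV D n \<times> grM D n \<times> dual_gr (scV D) (grV D) n \<times> dual_gr (scM D) (grM D) n)"
    by (simp add: tgr_def fun_eq_iff)
  then show "graded (tscale D) (tcar D) (tgr D)"
    using graded_prod[OF V.graded_axioms graded_prod[OF M.graded_axioms
          graded_prod[OF V'.graded_axioms M'.graded_axioms]]]
    by (simp add: tscale_eq tcar_def)
qed

sublocale W: graded "\<lambda>r p. (scV D r (fst p), scM D r (snd p))" UNIV "grW D"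
proof -
  have "grW D = (\<lambda>n. grV D n \<times> grM D n)"
    by (simp add: grW_def fun_eq_iff)
  then show "graded (\<lambda>r p. (scV D r (fst p), scM D r (snd p))) UNIV (grW D)"
    using graded_prod[OF V.graded_axioms M.graded_axioms] by (simp only: UNIV_Times_UNIV)
qed

lemma mul_lin1: "lin_on S (scV D) (scV D) (\<lambda>x. mul D x y)"
  and mul_lin2: "lin_on S (scV D) (scV D) (mul D x)"
  and act_lin1: "lin_on S (scV D) (scM D) (\<lambda>x. act D x a)"
  and act_lin2: "lin_on S' (scM D) (scM D) (act D x)"
  and mul_gr: "\<lbrakk>x \<in> grV D m; y \<in> grV D n\<rbrakk> \<Longrightarrow> mul D x y \<in> grV D (m + n)"
  and act_gr: "\<lbrakk>x \<in> grV D m; a \<in> grM D n\<rbrakk> \<Longrightarrow> act D x a \<in> grM D (m + n)"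
proof -
  note axs = comm_alg_mod[unfolded comm_alg_mod_def, THEN conjunct2, THEN conjunct2]
  note mul = axs[THEN conjunct1, rule_format] axs[THEN conjunct2, THEN conjunct1, rule_format]
    axs[THEN conjunct2, THEN conjunct2, THEN conjunct1, rule_format]
  \<comment> \<open>The list \<open>axs'\<close> starts at the linearity of the action, behind the
    axioms on the product.\<close>
  note axs' = axs[THEN conjunct2, THEN conjunct2, THEN conjunct2, THEN conjunct2, THEN conjunct2]
  note act = axs'[THEN conjunct1, rule_format] axs'[THEN conjunct2, THEN conjunct1, rule_format]
    axs'[THEN conjunct2, THEN conjunct2, THEN conjunct1, rule_format]
  show "lin_on S (scV D) (scV D) (\<lambda>x. mul D x y)" by (rule linear_lin_on, rule mul)
  show "lin_on S (scV D) (scV D) (mul D x)" by (rule linear_lin_on, rule mul)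
  show "lin_on S (scV D) (scM D) (\<lambda>x. act D x a)" by (rule linear_lin_on, rule act)
  show "lin_on S' (scM D) (scM D) (act D x)" by (rule linear_lin_on, rule act)
  show "mul D x y \<in> grV D (m + n)" if "x \<in> grV D m" "y \<in> grV D n" by (rule mul) fact+
  show "act D x a \<in> grM D (m + n)" if "x \<in> grV D m" "a \<in> grM D n" by (rule act) fact+
qed

lemma ract_lin1: "lin_on UNIV (scM D) (scM D) (\<lambda>a. ract D a x)"
  unfolding ract_def
  by (intro M.hsum_lin V.hsum_lin_param lin_on_sg act_lin2 UNIV_I M.vector_space)

lemma ract_lin2: "lin_on UNIV (scV D) (scM D) (ract D a)"
  unfolding ract_def[abs_def]
  by (intro M.hsum_lin_param V.hsum_lin lin_on_sg act_lin1 UNIV_I M.vector_space)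

lemma ract_homogeneous:
  assumes "a \<in> grM D m" "x \<in> grV D n"
  shows "ract D a x = sg (m * n) (act D x a)"
proof -
  have "hsum (grV D) (\<lambda>n x. sg (m * n) (act D x a)) x = sg (m * n) (act D x a)" for a m
    by (rule V.hsum_homogeneous[OF assms(2)]) (simp add: lin_on_0[OF act_lin1 UNIV_I])
  from this[symmetric] show ?thesis
    unfolding ract_def
    by (simp only:) (rule M.hsum_homogeneous[OF assms(1)],
      simp add: lin_on_0[OF act_lin2 UNIV_I] hsum_def)
qed

lemma ract_gr:
  assumes "a \<in> grM D m" "x \<in> grV D n"
  shows "ract D a x \<in> grM D (m + n)"
  using act_gr[OF assms(2,1)] by (simp add: ract_homogeneous[OF assms] M.G_sg add.commute)

text \<open>The first letter of each name is the acting space, the second the space on which the new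
  functional lives. Unprimed instances serve the left coadjoint actions in \<open>tmul\<close>,
  primed ones the right actions.\<close>

sublocale vv: graded_pairing "scV D" "grV D" "scV D" "grV D" "scV D" "grV D" "mul D"
  by unfold_locales (auto intro: mul_lin1 mul_lin2 mul_gr)

sublocale vv': graded_pairing "scV D" "grV D" "scV D" "grV D" "scV D" "grV D" "\<lambda>w u. mul D u w"
proof unfold_locales
  fix w n u m assume "w \<in> grV D n" "u \<in> grV D m"
  then show "mul D u w \<in> grV D (n + m)"
    using mul_gr[of u m w n] by (simp add: add.commute)
qed (auto intro: mul_lin1 mul_lin2)

sublocale mv: graded_pairing "scM D" "grM D" "scV D" "grV D" "scM D" "grM D" "act D"
  by unfold_locales (auto intro: act_lin1 act_lin2 act_gr)

sublocale mv': graded_pairing "scM D" "grM D" "scV D" "grV D" "scM D" "grM D" "\<lambda>w u. ract D u w"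
proof unfold_locales
  fix w n u m assume "w \<in> grV D n" "u \<in> grM D m"
  then show "ract D u w \<in> grM D (n + m)"
    using ract_gr[of u m w n] by (simp add: add.commute)
qed (auto intro: ract_lin1 ract_lin2)

sublocale vm: graded_pairing "scV D" "grV D" "scM D" "grM D" "scM D" "grM D" "ract D"
  by unfold_locales (auto intro: ract_lin1 ract_lin2 ract_gr)

sublocale vm': graded_pairing "scV D" "grV D" "scM D" "grM D" "scM D" "grM D" "\<lambda>w u. act D u w"
proof unfold_locales
  fix w n u m assume "w \<in> grM D n" "u \<in> grV D m"
  then show "act D u w \<in> grM D (n + m)"
    using act_gr[of u m w n] by (simp add: add.commute)
qed (auto intro: act_lin1 act_lin2)

abbreviation "lV \<equiv> lcoact (grV D) (grV D) (dual_gr (scV D) (grV D)) (mul D)"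
abbreviation "lM \<equiv> lcoact (grM D) (grV D) (dual_gr (scM D) (grM D)) (act D)"
abbreviation "lVM \<equiv> lcoact (grV D) (grM D) (dual_gr (scM D) (grM D)) (ract D)"

abbreviation comp_a :: "('k, 'v, 'm) tilde \<Rightarrow> 'm" where "comp_a v \<equiv> fst (snd v)"
abbreviation comp_g :: "('k, 'v, 'm) tilde \<Rightarrow> 'v \<Rightarrow> 'k" where "comp_g v \<equiv> fst (snd (snd v))"

lemma tmul_eq:
  "tmul D u v =
     (mul D (comp_x u) (comp_x v),
      act D (comp_x u) (comp_a v) + ract D (comp_a u) (comp_x v),
      lV (comp_x u) (comp_g v) + rcoact (mul D) (comp_g u) (comp_x v)
        + lM (comp_a u) (comp_h v) + rcoact (ract D) (comp_h u) (comp_a v),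
      lVM (comp_x u) (comp_h v) + rcoact (act D) (comp_h u) (comp_x v))"
  by (simp add: tmul_def split_beta Let_def)

lemma tcar_iff: "u \<in> tcar D \<longleftrightarrow> comp_g u \<in> dual (scV D) \<and> comp_h u \<in> dual (scM D)"
  by (simp add: tcar_def mem_Times_iff)

lemma tgr_iff:
  "u \<in> tgr D n \<longleftrightarrow> comp_x u \<in> grV D n \<and> comp_a u \<in> grM D n \<and>
     comp_g u \<in> dual_gr (scV D) (grV D) n \<and> comp_h u \<in> dual_gr (scM D) (grM D) n"
  by (simp add: tgr_def mem_Times_iff)

lemma lin_comp_x: "lin_on S (tscale D) (scV D) fst"
  and lin_comp_a: "lin_on S (tscale D) (scM D) (\<lambda>u. comp_a u)"
  and lin_comp_g: "lin_on S (tscale D) (\<lambda>r g y. r * g y) (\<lambda>u. comp_g u)"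
  and lin_comp_h: "lin_on S (tscale D) (\<lambda>r g y. r * g y) (\<lambda>u. comp_h u)"
  and lin_comp_g_app: "lin_on S (tscale D) (*) (\<lambda>u. comp_g u y)"
  and lin_comp_h_app: "lin_on S (tscale D) (*) (\<lambda>u. comp_h u b)"
  by (simp_all add: lin_on_def tscale_eq)

lemma lin_on_tuple:
  assumes "lin_on S s (scV D) f1" "lin_on S s (scM D) f2"
    "\<And>y. lin_on S s (*) (\<lambda>v. f3 v y)" "\<And>y. lin_on S s (*) (\<lambda>v. f4 v y)"
  shows "lin_on S s (tscale D) (\<lambda>v. (f1 v, f2 v, f3 v, f4 v))"
  using assms by (auto simp: lin_on_def tscale_def fun_eq_iff)

lemma tmul_lin1:
  assumes "v \<in> tcar D"
  shows "lin_on (tcar D) (tscale D) (tscale D) (\<lambda>u. tmul D u v)"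
proof -
  have "comp_g v \<in> dual (scV D)" "comp_h v \<in> dual (scM D)"
    using assms by (simp_all add: tcar_iff)
  note * = lin_on_compose_UNIV[OF lin_comp_x mul_lin1] lin_on_compose_UNIV[OF lin_comp_x act_lin1]
    lin_on_compose_UNIV[OF lin_comp_a ract_lin1]
    lin_on_compose_UNIV[OF lin_comp_x vv.lcoact_lin_acting[OF this(1)]]
    lin_on_compose_UNIV[OF lin_comp_a mv.lcoact_lin_acting[OF this(2)]]
    lin_on_compose_UNIV[OF lin_comp_x vm.lcoact_lin_acting[OF this(2)]]
  show ?thesis
    unfolding tmul_eq plus_fun_def rcoact_def
    by (intro lin_on_tuple lin_on_plus vector_space_field * M.vector_space)
      (auto simp: rcoact_def intro!: lin_on_plus vector_space_field * lin_comp_g_app lin_comp_h_app)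
qed

lemma tmul_lin2:
  assumes "u \<in> tcar D"
  shows "lin_on (tcar D) (tscale D) (tscale D) (tmul D u)"
proof -
  have "comp_g u \<in> dual (scV D)" "comp_h u \<in> dual (scM D)"
    using assms by (simp_all add: tcar_iff)
  note * = lin_on_compose_UNIV[OF lin_comp_x mul_lin2] lin_on_compose_UNIV[OF lin_comp_a act_lin2]
    lin_on_compose_UNIV[OF lin_comp_x ract_lin2]
    lin_on_compose[OF lin_comp_g vv.lcoact_lin_functional]
    lin_on_compose[OF lin_comp_h mv.lcoact_lin_functional]
    lin_on_compose[OF lin_comp_h vm.lcoact_lin_functional]
    lin_on_compose_UNIV[OF lin_comp_x vv'.rcoact_lin_acting[OF this(1)]]
    lin_on_compose_UNIV[OF lin_comp_a mv'.rcoact_lin_acting[OF this(2)]]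
    lin_on_compose_UNIV[OF lin_comp_x vm'.rcoact_lin_acting[OF this(2)]]
  show ?thesis
    unfolding tmul_eq[abs_def] plus_fun_def
    by (intro lin_on_tuple lin_on_plus vector_space_field * M.vector_space)
      (auto simp: tcar_iff intro!: lin_on_plus vector_space_field *)
qed

lemma tmul_tcar:
  assumes "u \<in> tcar D" "v \<in> tcar D"
  shows "tmul D u v \<in> tcar D"
  using assms vv'.rcoact_dual mv'.rcoact_dual vm'.rcoact_dual
  by (auto simp: tcar_iff tmul_eq intro!: V'.S_add M'.S_add vv.lcoact_dual mv.lcoact_dual vm.lcoact_dual)

lemma tmul_gr:
  assumes "u \<in> tgr D m" "v \<in> tgr D n"
  shows "tmul D u v \<in> tgr D (m + n)"
  using assms vv'.rcoact_gr mv'.rcoact_gr vm'.rcoact_gr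
  by (auto simp: tgr_iff tmul_eq intro!: V'.G_add M'.G_add M.G_add
      vv.lcoact_gr mv.lcoact_gr vm.lcoact_gr mul_gr act_gr ract_gr)

section \<open>The pairing on the double and its invariance\<close>

lemma tform_summand_lin1:
  assumes "comp_g v \<in> dual (scV D)" "comp_h v \<in> dual (scM D)"
  shows "lin_on S (tscale D) (*) (\<lambda>u. comp_g u (comp_x v) + comp_h u (comp_a v)
    + sg e (comp_g v (comp_x u) + comp_h v (comp_a u)))"
  by (intro lin_on_plus lin_on_sg vector_space_field lin_comp_g_app lin_comp_h_app
      lin_on_compose_UNIV[OF lin_comp_x dual_lin_on] lin_on_compose_UNIV[OF lin_comp_a dual_lin_on]
      assms)

lemma tform_summand_lin2:
  assumes "comp_g u \<in> dual (scV D)" "comp_h u \<in> dual (scM D)"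
  shows "lin_on S (tscale D) (*) (\<lambda>v. comp_g u (comp_x v) + comp_h u (comp_a v)
    + sg e (comp_g v (comp_x u) + comp_h v (comp_a u)))"
  by (intro lin_on_plus lin_on_sg vector_space_field lin_comp_g_app lin_comp_h_app
      lin_on_compose_UNIV[OF lin_comp_x dual_lin_on] lin_on_compose_UNIV[OF lin_comp_a dual_lin_on]
      assms)

lemma tform_eq:
  "tform D u v = hsum (tgr D) (\<lambda>m u. hsum (tgr D) (\<lambda>n v. comp_g u (comp_x v) + comp_h u (comp_a v)
    + sg (m * n) (comp_g v (comp_x u) + comp_h v (comp_a u))) v) u"
  by (simp add: tform_def case_prod_unfold)

lemma tgr_dual:
  "u \<in> tgr D m \<Longrightarrow> comp_g u \<in> dual (scV D)" "u \<in> tgr D m \<Longrightarrow> comp_h u \<in> dual (scM D)"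
  by (simp_all add: tgr_iff dual_gr_def)

lemma tform_lin1:
  assumes "v \<in> tcar D" shows "lin_on (tcar D) (tscale D) (*) (\<lambda>u. tform D u v)"
  unfolding tform_eq
  by (intro T.hsum_lin T.hsum_lin_param tform_summand_lin1 vector_space_field assms)
    (auto dest: tgr_dual)

lemma tform_lin2:
  assumes "u \<in> tcar D" shows "lin_on (tcar D) (tscale D) (*) (tform D u)"
  unfolding tform_eq[abs_def]
  by (intro T.hsum_lin T.hsum_lin_param tform_summand_lin2 vector_space_field assms)
    (auto dest: tgr_dual)

lemma tform_homogeneous:
  assumes u: "u \<in> tgr D m" and v: "v \<in> tgr D n"
  shows "tform D u v = comp_g u (comp_x v) + comp_h u (comp_a v)
    + sg (m * n) (comp_g v (comp_x u) + comp_h v (comp_a u))"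
proof -
  have eq: "hsum (tgr D) (\<lambda>n v. comp_g u (comp_x v) + comp_h u (comp_a v)
      + sg (m * n) (comp_g v (comp_x u) + comp_h v (comp_a u))) v =
    comp_g u (comp_x v) + comp_h u (comp_a v)
      + sg (m * n) (comp_g v (comp_x u) + comp_h v (comp_a u))"
    if "u \<in> tcar D" for u m
    using that by (intro T.hsum_homogeneous[OF v] lin_on_0[OF tform_summand_lin2 UNIV_I])
      (simp_all add: tcar_iff)
  have "lin_on UNIV (tscale D) (*) (\<lambda>u. hsum (tgr D) (\<lambda>n v. comp_g u (comp_x v) + comp_h u (comp_a v)
      + sg (m * n) (comp_g v (comp_x u) + comp_h v (comp_a u))) v)"
    by (rule T.hsum_lin_param[OF vector_space_field T.G_S[OF v] tform_summand_lin1])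
      (auto dest: tgr_dual)
  note zero = lin_on_0[OF this UNIV_I]
  show ?thesis
    unfolding tform_eq eq[OF T.G_S[OF u], symmetric]
    by (rule T.hsum_homogeneous[OF u]) (rule zero)
qed

lemma tform_zero:
  assumes "u \<in> tgr D m" "v \<in> tgr D n" "m + n \<noteq> 0"
  shows "tform D u v = 0"
proof -
  have "comp_g u (comp_x v) = 0" "comp_h u (comp_a v) = 0"
    using assms by (auto simp: tgr_iff intro: dual_gr_zero)
  moreover have "comp_g v (comp_x u) = 0" "comp_h v (comp_a u) = 0"
    using assms by (auto simp: tgr_iff add.commute intro: dual_gr_zero[of _ _ _ n _ m])
  ultimately show ?thesis
    by (simp add: tform_homogeneous[OF assms(1,2)])
qed

lemma tform_sym:
  assumes "u \<in> tgr D m" "v \<in> tgr D n"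
  shows "tform D u v = sg (m * n) (tform D v u)"
  by (simp add: tform_homogeneous[OF assms] tform_homogeneous[OF assms(2,1)] sg_add)
    (auto simp: sg_def)

text \<open>The coadjoint actions are transposes of the products, so both sides expand into the same
  nine evaluations of functionals on products. What remains is a comparison of signs, decided by the
  three parities.\<close>

lemma tform_invariant:
  assumes u: "u \<in> tgr D l" and v: "v \<in> tgr D m" and w: "w \<in> tgr D n"
  shows "tform D (tmul D u v) w = tform D u (tmul D v w)"
proof -
  note comps = u[unfolded tgr_iff] v[unfolded tgr_iff] w[unfolded tgr_iff]
  have add: "comp_h z (b + c) = comp_h z b + comp_h z c" if "z \<in> tgr D i" for z b c i
    by (rule lin_on_add[OF dual_lin_on[OF tgr_dual(2)[OF that]] UNIV_I UNIV_I])
  have vv: "lV (comp_x u) (comp_g v) (comp_x w) = sg (l * (m + n)) (comp_g v (mul D (comp_x w) (comp_x u)))"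
    "lV (comp_x v) (comp_g w) (comp_x u) = sg (m * (n + l)) (comp_g w (mul D (comp_x u) (comp_x v)))"
    using comps by (simp_all add: vv.lcoact_homogeneous)
  have mv: "lM (comp_a u) (comp_h v) (comp_x w) = sg (l * (m + n)) (comp_h v (act D (comp_x w) (comp_a u)))"
    "lM (comp_a v) (comp_h w) (comp_x u) = sg (m * (n + l)) (comp_h w (act D (comp_x u) (comp_a v)))"
    using comps by (simp_all add: mv.lcoact_homogeneous)
  have vm: "lVM (comp_x u) (comp_h v) (comp_a w) = sg (l * (m + n)) (comp_h v (ract D (comp_a w) (comp_x u)))"
    "lVM (comp_x v) (comp_h w) (comp_a u) = sg (m * (n + l)) (comp_h w (ract D (comp_a u) (comp_x v)))"
    using comps by (simp_all add: vm.lcoact_homogeneous)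
  show ?thesis
    unfolding tform_homogeneous[OF tmul_gr[OF u v] w] tform_homogeneous[OF u tmul_gr[OF v w]]
    by (simp add: tmul_eq vv mv vm rcoact_def add[OF u] add[OF w] sg_add)
      (cases "even l"; cases "even m"; cases "even n"; simp add: sg_def)
qed

lemma tB_lin1:
  assumes "v \<in> tcar D" shows "lin_on (tcar D) (tscale D) (*) (\<lambda>u. tB D u v)"
  unfolding tB_def shift_form_def
  by (intro T.hsum_lin lin_on_sg vector_space_field tform_lin1 assms)

lemma tB_lin2:
  assumes "u \<in> tcar D" shows "lin_on (tcar D) (tscale D) (*) (tB D u)"
  unfolding tB_def shift_form_def[abs_def]
  by (intro T.hsum_lin_param lin_on_sg vector_space_field tform_lin2 assms) (rule T.G_S)

lemma tB_homogeneous: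
  assumes "u \<in> tgr D m" "v \<in> tcar D"
  shows "tB D u v = sg (m - 1) (tform D u v)"
  unfolding tB_def shift_form_def
  by (rule T.hsum_homogeneous[OF assms(1)])
    (simp add: lin_on_0[OF tform_lin1[OF assms(2)] T.S_0])

text \<open>If \<open>n = - m\<close>, the shift and the symmetry of the pairing together contribute
  the exponent \<open>m - 1 + m * n\<close>, which is odd. In all other degrees both sides
  vanish.\<close>

lemma tB_eq_minus_tform:
  assumes "u \<in> tgr D m" "v \<in> tgr D n"
  shows "tB D u v = - tform D v u"
proof (cases "m + n = 0")
  case True
  then have "n = - m" by simp
  then show ?thesis
    by (simp add: tB_homogeneous[OF assms(1) T.G_S[OF assms(2)]] tform_sym[OF assms])
      (simp add: sg_def)
next
  case False
  then show ?thesis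
    using tform_zero[OF assms(2,1)]
    by (simp add: tB_homogeneous[OF assms(1) T.G_S[OF assms(2)]] tform_zero[OF assms] add.commute)
qed

section \<open>The shifted product on the double and its form\<close>

lemma tQ_multilinear: "multilinear_on (tcar D) (tscale D) (tscale D) 2 (tQ D)"
  unfolding tQ_def
  by (intro T.shift_map_multilinear T.vector_space multilinear_on_2 tmul_lin1 tmul_lin2)

lemma tQ_homogeneous:
  assumes "u \<in> tgr D m" "v \<in> tgr D n"
  shows "tQ D [u, v] = sg (m - 1) (tmul D u v)"
  unfolding tQ_def
  by (rule T.shift_map_2[OF T.vector_space tmul_lin1 tmul_lin2 assms])

lemma tQ_gr: "\<lbrakk>u \<in> tgr D m; v \<in> tgr D n\<rbrakk> \<Longrightarrow> tQ D [u, v] \<in> tgr D (m + n)"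
  by (simp add: tQ_homogeneous T.G_sg tmul_gr)

lemma tQ_tcar:
  assumes "u \<in> tcar D" "v \<in> tcar D"
  shows "tQ D [u, v] \<in> tcar D"
  unfolding tQ_def shift_map_def
proof (rule T.hsums_mem)
  fix ns xs assume "homogeneous (tgr D) ns xs" "length xs = length [u, v]"
  then have "set xs \<subseteq> tcar D" "length xs = 2" by (auto dest: T.homogeneous_set)
  then have "tmul D (xs ! 0) (xs ! 1) \<in> tcar D" by (auto intro!: tmul_tcar)
  then show "sg (\<Sum>j<length ns. int (length ns - Suc j) * (ns ! j - 1)) (tmul D (xs ! 0) (xs ! 1)) \<in> tcar D"
    by (rule T.S_sg)
qed (use assms in \<open>auto intro: T.S_add\<close>)

lemma Omega_multilinear:
  assumes F: "multilinear_on (tcar D) (tscale D) (tscale D) n F"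
    and F_tcar: "\<And>vs. \<lbrakk>set vs \<subseteq> tcar D; length vs = n\<rbrakk> \<Longrightarrow> F vs \<in> tcar D"
  shows "multilinear_on (tcar D) (tscale D) (*) (Suc n) (Omega D F)"
proof (rule multilinear_onI)
  fix us ws assume *: "set us \<subseteq> tcar D" "set ws \<subseteq> tcar D" "length us + length ws + 1 = Suc n"
  show "lin_on (tcar D) (tscale D) (*) (\<lambda>v. Omega D F (us @ v # ws))"
  proof (cases ws rule: rev_cases)
    case Nil
    then show ?thesis using * by (simp add: Omega_def tB_lin2 F_tcar)
  next
    case (snoc ws' w)
    have lin: "lin_on (tcar D) (tscale D) (tscale D) (\<lambda>v. F (us @ v # ws'))"
      using multilinear_onD[OF F, of us ws'] * snoc by simp
    have "lin_on (tcar D) (tscale D) (*) (\<lambda>v. tB D (F (us @ v # ws')) w)"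
      using * snoc by (intro lin_on_compose[OF lin tB_lin1] F_tcar) auto
    then show ?thesis using snoc by (simp add: Omega_def butlast_append)
  qed
qed

lemma Omega_tQ_zero:
  assumes "u \<in> tgr D l" "v \<in> tgr D m" "w \<in> tgr D n" "l + m + n \<noteq> 0"
  shows "Omega D (tQ D) [u, v, w] = 0"
  using tform_zero[OF tQ_gr[OF assms(1,2)] assms(3,4)]
  by (simp add: Omega_def tB_homogeneous[OF tQ_gr[OF assms(1,2)] T.G_S[OF assms(3)]])

text \<open>No sign is visible because on the support \<open>l = - (m + n)\<close>, so the Koszul
  exponent \<open>(l - 1) * (m + n - 2)\<close> is even. Cyclicity itself is invariance followed by
  symmetry of the pairing.\<close>

lemma Omega_tQ_cyclic:
  assumes u: "u \<in> tgr D l" and v: "v \<in> tgr D m" and w: "w \<in> tgr D n"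
  shows "Omega D (tQ D) [u, v, w] = Omega D (tQ D) [v, w, u]"
proof (cases "l + m + n = 0")
  case False
  then show ?thesis
    using Omega_tQ_zero[OF u v w] Omega_tQ_zero[OF v w u] by (simp add: algebra_simps)
next
  case True
  have lin: "tform D (sg i z) y = sg i (tform D z y)" if "z \<in> tcar D" "y \<in> tcar D" for z y i
    by (rule lin_on_apply_sg[OF T.vector_space vector_space_field tform_lin1[OF that(2)] that(1)])
  \<comment> \<open>The exponent \<open>l + m - 1\<close> comes from shifting the form,
    \<open>l - 1\<close> from shifting the product.\<close>
  have Omega: "Omega D (tQ D) [u, v, w] = sg (l + m - 1 + (l - 1)) (tform D (tmul D u v) w)"
    if "u \<in> tgr D l" "v \<in> tgr D m" "w \<in> tgr D n" for u v w l m n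
  proof -
    have "Omega D (tQ D) [u, v, w] = tB D (tQ D [u, v]) w"
      by (simp add: Omega_def)
    also have "\<dots> = sg (l + m - 1) (tform D (tQ D [u, v]) w)"
      by (rule tB_homogeneous[OF tQ_gr[OF that(1,2)] T.G_S[OF that(3)]])
    finally show ?thesis
      by (simp add: tQ_homogeneous[OF that(1,2)] lin T.G_S[OF tmul_gr[OF that(1,2)]] T.G_S[OF that(3)])
  qed
  note Omega[OF u v w]
  also have "tform D (tmul D u v) w = sg (l * (m + n)) (tform D (tmul D v w) u)"
    unfolding tform_invariant[OF u v w] by (rule tform_sym[OF u tmul_gr[OF v w]])
  finally have 1: "Omega D (tQ D) [u, v, w]
    = sg (l + m - 1 + (l - 1) + l * (m + n)) (tform D (tmul D v w) u)" by simp
  note Omega[OF v w u]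
  moreover have "l = - (m + n)" using True by simp
  ultimately show ?thesis
    unfolding 1 by (auto intro!: sg_cong)
qed

end

section \<open>The cyclic form of a cochain\<close>

text \<open>The sign is that of \<open>B (a, h) = - h a\<close> for \<open>a \<in> M\<close> and \<open>h \<in> M\<^sup>*\<close>.\<close>

definition cyclic_part ::
  "('v list \<Rightarrow> 'm) \<Rightarrow> ('k::field, 'v, 'm) tilde list \<Rightarrow> 'k" where
  "cyclic_part C vs = - comp_h (last vs) (C (map comp_x (butlast vs)))"

text \<open>After \<open>Suc j\<close> steps \<open>us ! j\<close> is last, in the slot of the
  functional, and \<open>p\<close> stands where \<open>tilde_j\<close> places its argument. Thus the
  functional with index \<open>j\<close> is a rotation of the leading term.\<close>

lemma cyclic_part_rotate:
  assumes "j < length us"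
  shows "cyclic_part C (rotate (Suc j) (us @ [p])) =
    - comp_h (us ! j) (C (map comp_x (drop (Suc j) us) @ comp_x p # map comp_x (take j us)))"
proof -
  have "rotate (Suc j) (us @ [p]) = (drop (Suc j) us @ [p]) @ take (Suc j) us"
    using rotate_append[of "take (Suc j) us" "drop (Suc j) us @ [p]"] assms
    by (simp add: min_absorb2 del: rotate_Suc append_assoc flip: append_assoc)
  then have "rotate (Suc j) (us @ [p]) = drop (Suc j) us @ p # take j us @ [us ! j]"
    using assms by (simp add: take_Suc_conv_app_nth del: rotate_Suc)
  then show ?thesis
    by (simp add: cyclic_part_def butlast_append del: rotate_Suc)
qed

text \<open>The degree \<open>e\<close> is measured without shift, so neither
  \<open>shift_map\<close> nor the coboundary changes it; the shifted degree is
  \<open>e + k - 1\<close>.\<close>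

definition graded_cochain ::
  "('k, 'v::ab_group_add, 'm::ab_group_add, 'z) alg_mod_scheme \<Rightarrow> nat \<Rightarrow> int \<Rightarrow> ('v list \<Rightarrow> 'm) \<Rightarrow> bool" where
  "graded_cochain D k e C \<longleftrightarrow>
     multilinear_on UNIV (scV D) (scM D) k C \<and>
     (\<forall>ns xs. length xs = k \<and> homogeneous (grV D) ns xs \<longrightarrow> C xs \<in> grM D (sum_list ns + e))"

context double_semidirect
begin

text \<open>Turns the argument of a functional on \<open>V\<close> into one more vector of the
  double, so that it can be rotated together with the others.\<close>

abbreviation emb :: "'v \<Rightarrow> ('k, 'v, 'm) tilde" where "emb y \<equiv> (y, 0, 0, 0)"

lemma emb_gr: "y \<in> grV D n \<Longrightarrow> emb y \<in> tgr D n"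
  by (simp add: tgr_iff)

lemma emb_tcar: "emb y \<in> tcar D"
  by (simp add: tcar_iff)

lemma lin_emb: "lin_on UNIV (scV D) (tscale D) emb"
proof -
  interpret scM: vector_space "scM D" by (rule M.vector_space)
  show ?thesis by (intro lin_on_tuple) (simp_all add: lin_on_def)
qed

lemma homogeneous_comp_x:
  "homogeneous (tgr D) ns vs \<Longrightarrow> homogeneous (grV D) ns (map comp_x vs)"
  by (auto simp: homogeneous_def list_all2_conv_all_nth tgr_iff)

context
  fixes C :: "'v list \<Rightarrow> 'm" and k :: nat and e :: int
  assumes C: "graded_cochain D k e C"
begin

lemma C_multilinear: "multilinear_on UNIV (scV D) (scM D) k C"
  using C by (simp add: graded_cochain_def)

lemma C_gr: "\<lbrakk>length xs = k; homogeneous (grV D) ns xs\<rbrakk> \<Longrightarrow> C xs \<in> grM D (sum_list ns + e)"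
  using C by (simp add: graded_cochain_def)

lemma C_comp_x_multilinear: "multilinear_on S (tscale D) (scM D) k (\<lambda>vs. C (map comp_x vs))"
proof (rule multilinear_onI)
  fix us ws :: "('k, 'v, 'm) tilde list" assume "length us + length ws + 1 = k"
  then show "lin_on S (tscale D) (scM D) (\<lambda>v. C (map comp_x (us @ v # ws)))"
    using lin_on_compose_UNIV[OF lin_comp_x multilinear_onD[OF C_multilinear,
          of "map comp_x us" "map comp_x ws"]]
    by simp
qed

lemma cyclic_part_multilinear:
  "multilinear_on (tcar D) (tscale D) (*) (Suc k) (cyclic_part C)"
proof (rule multilinear_onI)
  fix us ws :: "('k, 'v, 'm) tilde list"
  assume *: "set us \<subseteq> tcar D" "set ws \<subseteq> tcar D" "length us + length ws + 1 = Suc k"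
  show "lin_on (tcar D) (tscale D) (*) (\<lambda>v. cyclic_part C (us @ v # ws))"
  proof (cases ws rule: rev_cases)
    case Nil
    then show ?thesis
      by (simp add: cyclic_part_def lin_on_minus vector_space_field lin_comp_h_app)
  next
    case (snoc ws' w)
    have "comp_h w \<in> dual (scM D)" using snoc * by (simp add: tcar_iff)
    then have "lin_on (tcar D) (tscale D) (*) (\<lambda>v. comp_h w (C (map comp_x (us @ v # ws'))))"
      using * snoc
      by (intro lin_on_compose_UNIV[OF multilinear_onD[OF C_comp_x_multilinear] dual_lin_on]) auto
    then show ?thesis
      using snoc by (simp add: cyclic_part_def butlast_append lin_on_minus vector_space_field)
  qed
qed

lemma cyclic_part_zero:
  assumes "homogeneous (tgr D) ns vs" "length vs = Suc k" "sum_list ns + e \<noteq> 0"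
  shows "cyclic_part C vs = 0"
proof -
  obtain us v where vs: "vs = us @ [v]" using assms(2) by (metis length_Suc_conv_rev)
  obtain ms n where ns: "ns = ms @ [n]"
    using homogeneous_length[OF assms(1)] assms(2) by (metis length_Suc_conv_rev)
  have h: "homogeneous (tgr D) ms us" "v \<in> tgr D n"
    using assms(1) by (simp_all add: vs ns homogeneous_snoc)
  have "C (map comp_x us) \<in> grM D (sum_list ms + e)"
    using assms(2) vs by (intro C_gr homogeneous_comp_x[OF h(1)]) simp
  moreover have "comp_h v \<in> dual_gr (scM D) (grM D) n"
    using h(2) by (simp add: tgr_iff)
  ultimately have "comp_h v (C (map comp_x us)) = 0"
    using assms(3) by (intro dual_gr_zero[where m = n and n = "sum_list ms + e"]) (simp_all add: ns)
  then show ?thesis by (simp add: cyclic_part_def vs)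
qed

lemma tilde_j_eq:
  assumes "j < length vs"
  shows "tilde_j D C ns vs j = hsum (grV D) (\<lambda>n y.
    - sg ((n - 1) + 1 + sdeg (take (Suc j) ns) * (sdeg (drop (Suc j) ns) + (n - 1)))
       (cyclic_part C (rotate (Suc j) (vs @ [emb y]))))"
  unfolding tilde_j_def cyclic_part_rotate[OF assms] by (simp add: sg_minus fun_eq_iff)

lemma tilde_j_dual:
  assumes "set vs \<subseteq> tcar D" "length vs = k" "j < k"
  shows "tilde_j D C ns vs j \<in> dual (scV D)"
proof -
  have j: "j < length vs" using assms by simp
  have "lin_on UNIV (scV D) (*) (\<lambda>y. cyclic_part C (rotate (Suc j) (vs @ [emb y])))"
    by (rule lin_on_compose[OF lin_emb multilinear_onD[OF
            multilinear_on_rotate[OF cyclic_part_multilinear], of vs "[]"]])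
      (use assms emb_tcar in auto)
  then show ?thesis
    unfolding dual_iff[OF V.vector_space] tilde_j_eq[OF j]
    by (intro V.hsum_lin lin_on_minus lin_on_sg vector_space_field)
qed

lemma tilde_j_homogeneous:
  assumes "set vs \<subseteq> tcar D" "length vs = k" "j < k" "y \<in> grV D n"
  shows "tilde_j D C ns vs j y =
    - sg ((n - 1) + 1 + sdeg (take (Suc j) ns) * (sdeg (drop (Suc j) ns) + (n - 1)))
       (cyclic_part C (rotate (Suc j) (vs @ [emb y])))"
proof -
  have j: "j < length vs" using assms by simp
  have "lin_on UNIV (scV D) (*) (\<lambda>y. cyclic_part C (rotate (Suc j) (vs @ [emb y])))"
    by (rule lin_on_compose[OF lin_emb multilinear_onD[OF
            multilinear_on_rotate[OF cyclic_part_multilinear], of vs "[]"]])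
      (use assms emb_tcar in auto)
  note zero = lin_on_0[OF this UNIV_I]
  show ?thesis
    unfolding tilde_j_eq[OF j]
    by (rule V.hsum_homogeneous[OF assms(4)]) (simp only: zero, simp)
qed

lemma tilde_j_gr:
  assumes "homogeneous (tgr D) ns vs" "length vs = k" "j < k"
  shows "tilde_j D C ns vs j \<in> dual_gr (scV D) (grV D) (sum_list ns + e)"
proof -
  have "tilde_j D C ns vs j y = 0" if "y \<in> grV D n" "n \<noteq> - (sum_list ns + e)" for y n
  proof -
    have "homogeneous (tgr D) (rotate (Suc j) (ns @ [n])) (rotate (Suc j) (vs @ [emb y]))"
      using assms(1) that by (intro homogeneous_rotate homogeneous_append) (simp_all add: emb_gr)
    moreover have "length (rotate (Suc j) (vs @ [emb y])) = Suc k" using assms by simp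
    moreover have "sum_list (rotate (Suc j) (ns @ [n])) + e \<noteq> 0"
      unfolding sum_list_rotate using that(2) by simp
    ultimately have "cyclic_part C (rotate (Suc j) (vs @ [emb y])) = 0"
      by (rule cyclic_part_zero)
    then show ?thesis
      using tilde_j_homogeneous[OF T.homogeneous_set[OF assms(1)] assms(2,3) that(1)]
      by (simp del: rotate_Suc)
  qed
  then show ?thesis
    using tilde_j_dual[OF T.homogeneous_set[OF assms(1)] assms(2,3)] by (auto simp: dual_gr_def)
qed

lemma tilde_ext_summand_multilinear:
  "multilinear_on (tcar D) (tscale D) (tscale D) k
     (\<lambda>vs. (0, C (map comp_x vs), \<Sum>j<length vs. tilde_j D C ns vs j, 0))"
proof (rule multilinear_onI)
  fix us ws :: "('k, 'v, 'm) tilde list"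
  assume *: "set us \<subseteq> tcar D" "set ws \<subseteq> tcar D" "length us + length ws + 1 = k"
  then have len: "length (us @ v # ws) = k" for v by simp
  have j: "lin_on (tcar D) (tscale D) (*) (\<lambda>v. tilde_j D C ns (us @ v # ws) j y)"
    if "j < k" for j y
  proof -
    have "lin_on (tcar D) (tscale D) (*) (\<lambda>v. cyclic_part C (rotate (Suc j) (us @ v # ws @ [emb y])))"
      for y
      by (rule multilinear_onD[OF multilinear_on_rotate[OF cyclic_part_multilinear]])
        (use * emb_tcar in auto)
    moreover have jl: "j < length (us @ v # ws)" for v using * that by simp
    ultimately show ?thesis
      unfolding tilde_j_eq[OF jl]
      by (intro V.hsum_lin_param lin_on_minus lin_on_sg vector_space_field UNIV_I)
        (simp del: rotate_Suc)
  qed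
  show "lin_on (tcar D) (tscale D) (tscale D)
    (\<lambda>v. (0, C (map comp_x (us @ v # ws)), \<Sum>j<length (us @ v # ws). tilde_j D C ns (us @ v # ws) j, 0))"
    unfolding len
  proof (rule lin_on_tuple)
    show "lin_on (tcar D) (tscale D) (scM D) (\<lambda>v. C (map comp_x (us @ v # ws)))"
      by (rule multilinear_onD[OF C_comp_x_multilinear *])
    show "lin_on (tcar D) (tscale D) (*) (\<lambda>v. (\<Sum>j<k. tilde_j D C ns (us @ v # ws) j) y)" for y
      unfolding sum_apply by (intro lin_on_sum vector_space_field j) simp
  qed (simp_all add: lin_on_zero V.vector_space vector_space_field)
qed

lemma tilde_ext_multilinear: "multilinear_on (tcar D) (tscale D) (tscale D) k (tilde_ext D C)"
  unfolding tilde_ext_def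
  by (intro T.hsums_multilinear T.vector_space tilde_ext_summand_multilinear)

lemma tilde_ext_homogeneous:
  assumes "homogeneous (tgr D) ns vs" "length vs = k"
  shows "tilde_ext D C vs = (0, C (map comp_x vs), \<Sum>j<k. tilde_j D C ns vs j, 0)"
  unfolding tilde_ext_def
  by (subst T.hsums_homogeneous[OF assms]) (rule tilde_ext_summand_multilinear, simp add: assms(2))

lemma tilde_ext_gr:
  assumes "homogeneous (tgr D) ns vs" "length vs = k"
  shows "tilde_ext D C vs \<in> tgr D (sum_list ns + e)"
  using C_gr[OF _ homogeneous_comp_x[OF assms(1)]] assms(2)
  by (auto simp: tilde_ext_homogeneous[OF assms] tgr_iff intro!: V'.G_sum tilde_j_gr assms)

lemma tilde_ext_tcar:
  assumes "set vs \<subseteq> tcar D" "length vs = k"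
  shows "tilde_ext D C vs \<in> tcar D"
  unfolding tilde_ext_def
proof (rule T.hsums_mem[OF assms(1)])
  fix ns xs assume "homogeneous (tgr D) ns xs" "length xs = length vs"
  then show "(0, C (map comp_x xs), \<Sum>j<length xs. tilde_j D C ns xs j, 0) \<in> tcar D"
    using assms(2)
    by (auto simp: tcar_iff intro!: V'.S_sum tilde_j_dual dest: T.homogeneous_set)
qed (auto intro: T.S_add)

lemma Omega_tilde_multilinear:
  "multilinear_on (tcar D) (tscale D) (*) (Suc k) (Omega_tilde D C)"
  unfolding Omega_tilde_def
  by (rule Omega_multilinear[OF tilde_ext_multilinear tilde_ext_tcar])

lemma Omega_tilde_homogeneous:
  assumes hom: "homogeneous (tgr D) (map fst ps) (map snd ps)" and len: "length ps = Suc k"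
  shows "Omega_tilde D C (map snd ps) = cyc (\<lambda>ps. cyclic_part C (map snd ps)) ps"
proof -
  obtain qs p where "ps = qs @ [p]" "length qs = k"
    using len by (auto simp: length_Suc_conv_rev)
  moreover obtain n v where "p = (n, v)" by (cases p)
  ultimately have ps: "ps = qs @ [(n, v)]" "length qs = k" by simp_all
  define ms us where "ms = map fst qs" and "us = map snd qs"
  have h: "homogeneous (tgr D) ms us" "v \<in> tgr D n" and us: "length us = k" "length ms = k"
    using hom ps by (simp_all add: ms_def us_def homogeneous_snoc)
  let ?u = "tilde_ext D C us" and ?m = "sum_list ms + e"
  let ?sign = "\<lambda>j. sg (wsum (take j ps) * wsum (drop j ps))"
  have u: "?u \<in> tgr D ?m" by (rule tilde_ext_gr[OF h(1) us(1)])
  \<comment> \<open>For \<open>j < k\<close> the rotated \<open>v\<close> is not in the slot of the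
    functional, so only its component in \<open>V\<close> enters.\<close>
  have rot: "cyclic_part C (rotate (Suc j) (us @ [emb (comp_x v)])) =
      cyclic_part C (rotate (Suc j) (map snd ps))" if "j < k" for j
    using that us(1) by (simp add: ps(1) us_def[symmetric] cyclic_part_rotate del: rotate_Suc)
  have "sg (n * ?m) (tilde_j D C ms us j (comp_x v)) =
      - ?sign (Suc j) (cyclic_part C (rotate (Suc j) (map snd ps)))" if "j < k" for j
  \<comment> \<open>On the support \<open>n * ?m\<close> has the parity of \<open>n\<close> and
    cancels the part \<open>(n - 1) + 1\<close> of the exponent in \<open>tilde_j\<close>; what is
    left is the sign of the rotation.\<close>
  proof (cases "?m + n = 0")
    case True
    have t: "take (Suc j) ms = map fst (take (Suc j) ps)"
      and d: "drop (Suc j) ms @ [n] = map fst (drop (Suc j) ps)"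
      using that us ps by (simp_all add: ms_def take_map drop_map)
    have "sdeg (take (Suc j) ms) = wsum (take (Suc j) ps)"
      unfolding t by (rule sdeg_map_fst)
    moreover have "sdeg (drop (Suc j) ms @ [n]) = wsum (drop (Suc j) ps)"
      unfolding d by (rule sdeg_map_fst)
    then have "sdeg (drop (Suc j) ms) + (n - 1) = wsum (drop (Suc j) ps)" by simp
    moreover have "?m = - n" using True by simp
    ultimately show ?thesis
      using that h(2) us(1)
      by (simp add: tilde_j_homogeneous[OF T.homogeneous_set[OF h(1)] us(1) that, of _ n] tgr_iff
          rot sg_minus del: rotate_Suc) (auto intro!: sg_cong)
  next
    case False
    have hr: "homogeneous (tgr D) (rotate (Suc j) (map fst ps)) (rotate (Suc j) (map snd ps))"
      by (rule homogeneous_rotate[OF hom])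
    have "cyclic_part C (rotate (Suc j) (map snd ps)) = 0"
      by (rule cyclic_part_zero[OF hr], unfold sum_list_rotate)
        (use False ps in \<open>auto simp: ms_def\<close>)
    then show ?thesis
      using h(2) by (simp add: tilde_j_homogeneous[OF T.homogeneous_set[OF h(1)] us(1) that, of _ n] tgr_iff
          rot that del: rotate_Suc)
  qed
  note tj = this
  have "Omega_tilde D C (map snd ps) = tB D ?u v"
    by (simp add: Omega_tilde_def Omega_def ps(1) us_def butlast_append)
  also have "\<dots> = - tform D v ?u" by (rule tB_eq_minus_tform[OF u h(2)])
  also have "\<dots> = cyclic_part C (map snd ps) - (\<Sum>j<k. sg (n * ?m) (tilde_j D C ms us j (comp_x v)))"
    unfolding tform_homogeneous[OF h(2) u]
    unfolding tilde_ext_homogeneous[OF h(1) us(1)]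
    using lin_on_0[OF dual_lin_on[OF tgr_dual(1)[OF h(2)]] UNIV_I]
    by (simp add: cyclic_part_def ps(1) us_def[symmetric] butlast_append sum_apply sg_sum)
  also have "\<dots> = cyclic_part C (map snd ps) +
      (\<Sum>j<k. ?sign (Suc j) (cyclic_part C (rotate (Suc j) (map snd ps))))"
    using tj by (simp add: sum_negf del: rotate_Suc)
  also have "\<dots> = cyc (\<lambda>ps. cyclic_part C (map snd ps)) ps"
    unfolding cyc_def len sum.lessThan_Suc_shift by (simp add: rotate_map del: rotate_Suc)
  finally show ?thesis .
qed

text \<open>This is \<open>srot_cyc\<close> at the list that starts with the last vector, whose
  rotation is the given list. The sign is its own inverse and can change sides.\<close>

lemma Omega_tilde_cyclic: "cyclic_form D (Suc k) (Omega_tilde D C)"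
  unfolding cyclic_form_def
proof (intro conjI allI impI Omega_tilde_multilinear)
  fix ns vs assume *: "vs \<noteq> [] \<and> length vs = Suc k \<and> homogeneous (tgr D) ns vs"
  define ps where "ps = zip ns vs"
  have ps: "map fst ps = ns" "map snd ps = vs" "length ps = Suc k"
    using * homogeneous_length[of "tgr D" ns vs] by (simp_all add: ps_def)
  obtain qs p where qs: "ps = qs @ [p]" using ps(3) by (metis length_Suc_conv_rev)
  have hom: "homogeneous (tgr D) (map fst (p # qs)) (map snd (p # qs))"
    using * ps(1,2)[symmetric] by (simp add: qs homogeneous_snoc)
  have "Omega_tilde D C (last vs # butlast vs) = cyc (\<lambda>ps. cyclic_part C (map snd ps)) (p # qs)"
    using Omega_tilde_homogeneous[OF hom] ps qs by (auto simp: butlast_append)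
  also have "\<dots> = sg ((fst p - 1) * wsum qs) (cyc (\<lambda>ps. cyclic_part C (map snd ps)) (qs @ [p]))"
    by (subst srot_cyc[symmetric]) (simp add: srot_Cons)
  also have "\<dots> = sg ((last ns - 1) * sdeg (butlast ns)) (Omega_tilde D C vs)"
    using Omega_tilde_homogeneous[of ps] * ps qs sdeg_map_fst[of qs] by (auto simp: butlast_append)
  finally show "Omega_tilde D C vs
    = sg ((last ns - 1) * sdeg (butlast ns)) (Omega_tilde D C (last vs # butlast vs))"
    by (simp add: sg_def)
qed

end

end

section \<open>The Hochschild coboundary\<close>

context double_semidirect
begin

abbreviation "scW \<equiv> \<lambda>r (p :: 'v \<times> 'm). (scV D r (fst p), scM D r (snd p))"

lemma mulW_lin1: "lin_on UNIV scW scW (\<lambda>u. mulW D u w)"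
proof -
  note * = lin_on_compose_UNIV[OF lin_on_fst mul_lin1] lin_on_compose_UNIV[OF lin_on_fst act_lin1]
    lin_on_compose_UNIV[OF lin_on_snd ract_lin1]
  have "lin_on UNIV scW (scM D) (\<lambda>u. act D (fst u) (snd w) + ract D (snd u) (fst w))"
    by (intro lin_on_plus M.vector_space *)
  moreover have "lin_on UNIV scW (scV D) (\<lambda>u. mul D (fst u) (fst w))" by (rule *)
  ultimately show ?thesis by (auto simp: lin_on_def mulW_def)
qed

lemma mulW_lin2: "lin_on UNIV scW scW (mulW D u)"
proof -
  note * = lin_on_compose_UNIV[OF lin_on_fst mul_lin2] lin_on_compose_UNIV[OF lin_on_snd act_lin2]
    lin_on_compose_UNIV[OF lin_on_fst ract_lin2]
  have "lin_on UNIV scW (scM D) (\<lambda>w. act D (fst u) (snd w) + ract D (snd u) (fst w))"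
    by (intro lin_on_plus M.vector_space *)
  moreover have "lin_on UNIV scW (scV D) (\<lambda>w. mul D (fst u) (fst w))" by (rule *)
  ultimately show ?thesis by (auto simp: lin_on_def mulW_def)
qed

lemma shQW_lin1: "lin_on UNIV scW scW (\<lambda>u. shQW D u w)"
  and shQW_lin2: "lin_on UNIV scW scW (shQW D u)"
proof -
  have "multilinear_on UNIV scW scW 2 (shift_map (grW D) (\<lambda>ws. mulW D (ws ! 0) (ws ! 1)))"
    by (intro W.shift_map_multilinear W.vector_space multilinear_on_2 mulW_lin1 mulW_lin2)
  from multilinear_onD[OF this, of "[]" "[w]"] multilinear_onD[OF this, of "[u]" "[]"]
  show "lin_on UNIV scW scW (\<lambda>u. shQW D u w)" "lin_on UNIV scW scW (shQW D u)"
    by (simp_all add: shQW_def[abs_def])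
qed

lemma shQ_multilinear: "multilinear_on UNIV (scV D) (scV D) 2 (\<lambda>xs. shQ D (xs ! 0) (xs ! 1))"
proof (rule multilinear_on_2)
  have *: "multilinear_on UNIV (scV D) (scV D) 2 (shift_map (grV D) (\<lambda>xs. mul D (xs ! 0) (xs ! 1)))"
    by (intro V.shift_map_multilinear V.vector_space multilinear_on_2 mul_lin1 mul_lin2)
  show "lin_on UNIV (scV D) (scV D) (\<lambda>u. shQ D u v)" "lin_on UNIV (scV D) (scV D) (shQ D u)" for u v
    using multilinear_onD[OF *, of "[]" "[v]"] multilinear_onD[OF *, of "[u]" "[]"]
    by (simp_all add: shQ_def[abs_def])
qed

lemma shQ_homogeneous:
  assumes "x \<in> grV D m" "y \<in> grV D n"
  shows "shQ D x y = sg (m - 1) (mul D x y)"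
  unfolding shQ_def by (rule V.shift_map_2[OF V.vector_space mul_lin1 mul_lin2 assms])

abbreviation qright :: "'m \<Rightarrow> 'v \<Rightarrow> 'm" where "qright a x \<equiv> snd (shQW D (0, a) (x, 0))"
abbreviation qleft :: "'v \<Rightarrow> 'm \<Rightarrow> 'm" where "qleft x a \<equiv> snd (shQW D (x, 0) (0, a))"

lemma lin_inl: "lin_on UNIV (scV D) scW (\<lambda>x. (x, 0))"
  and lin_inr: "lin_on UNIV (scM D) scW (\<lambda>a. (0, a))"
proof -
  interpret scV: vector_space "scV D" by (rule V.vector_space)
  interpret scM: vector_space "scM D" by (rule M.vector_space)
  show "lin_on UNIV (scV D) scW (\<lambda>x. (x, 0))" "lin_on UNIV (scM D) scW (\<lambda>a. (0, a))"
    by (simp_all add: lin_on_def)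
qed

lemma qright_lin1: "lin_on UNIV (scM D) (scM D) (\<lambda>a. qright a x)"
  and qright_lin2: "lin_on UNIV (scV D) (scM D) (qright a)"
  and qleft_lin1: "lin_on UNIV (scV D) (scM D) (\<lambda>x. qleft x a)"
  and qleft_lin2: "lin_on UNIV (scM D) (scM D) (qleft x)"
  by (rule lin_on_compose_UNIV[OF lin_on_compose_UNIV[OF lin_inr shQW_lin1] lin_on_snd]
      lin_on_compose_UNIV[OF lin_on_compose_UNIV[OF lin_inl shQW_lin2] lin_on_snd]
      lin_on_compose_UNIV[OF lin_on_compose_UNIV[OF lin_inl shQW_lin1] lin_on_snd]
      lin_on_compose_UNIV[OF lin_on_compose_UNIV[OF lin_inr shQW_lin2] lin_on_snd])+

lemma shQW_homogeneous:
  "\<lbrakk>u \<in> grW D m; w \<in> grW D n\<rbrakk> \<Longrightarrow> shQW D u w = sg (m - 1) (mulW D u w)"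
  unfolding shQW_def by (rule W.shift_map_2[OF W.vector_space mulW_lin1 mulW_lin2])

lemma qright_homogeneous:
  assumes "a \<in> grM D m" "x \<in> grV D n"
  shows "qright a x = sg (m - 1) (ract D a x)"
  using assms lin_on_0[OF act_lin2 UNIV_I]
  by (subst shQW_homogeneous[of _ m _ n]) (simp_all add: grW_def mulW_def snd_sg)

lemma qleft_homogeneous:
  assumes "x \<in> grV D m" "a \<in> grM D n"
  shows "qleft x a = sg (m - 1) (act D x a)"
  using assms lin_on_0[OF ract_lin1 UNIV_I]
  by (subst shQW_homogeneous[of _ m _ n]) (simp_all add: grW_def mulW_def snd_sg)

lemma graded_cochain_shift:
  assumes "graded_cochain D k e c"
  shows "graded_cochain D k e (shift_map (grV D) c)"
proof -
  have c: "multilinear_on UNIV (scV D) (scM D) k c"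
    using assms by (simp add: graded_cochain_def)
  show ?thesis
    using assms unfolding graded_cochain_def
    by (auto simp: V.shift_map_multilinear[OF M.vector_space c]
        V.shift_map_homogeneous[OF M.vector_space c] intro!: M.G_sg)
qed

context
  fixes C :: "'v list \<Rightarrow> 'm" and k :: nat and e :: int
  assumes C: "graded_cochain D k e C"
begin

lemma qright_multilinear:
  "multilinear_on UNIV (scV D) (scM D) (Suc k) (\<lambda>xs. qright (C (take k xs)) (xs ! k))"
proof (rule multilinear_onI)
  fix us ws :: "'v list" assume len: "length us + length ws + 1 = Suc k"
  show "lin_on UNIV (scV D) (scM D) (\<lambda>v. qright (C (take k (us @ v # ws))) ((us @ v # ws) ! k))"
  proof (cases ws rule: rev_cases)
    case Nil
    then have "k = length us" using len by simp
    then show ?thesis using Nil by (simp add: qright_lin2)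
  next
    case (snoc ws' w)
    then have k: "k = length (us @ v # ws')" for v using len by simp
    have "lin_on UNIV (scV D) (scM D) (\<lambda>v. C (us @ v # ws'))"
      using len snoc by (intro multilinear_onD[OF C_multilinear[OF C]]) auto
    note lin = lin_on_compose_UNIV[OF this qright_lin1]
    have "take k (us @ v # ws) = us @ v # ws'" "(us @ v # ws) ! k = w" for v
      unfolding snoc using k[of v] by (simp_all add: nth_append)
    then show ?thesis using lin by simp
  qed
qed

lemma qleft_multilinear:
  "multilinear_on UNIV (scV D) (scM D) (Suc k) (\<lambda>xs. qleft (xs ! 0) (C (drop 1 xs)))"
proof (rule multilinear_onI)
  fix us ws :: "'v list" assume len: "length us + length ws + 1 = Suc k"
  show "lin_on UNIV (scV D) (scM D) (\<lambda>v. qleft ((us @ v # ws) ! 0) (C (drop 1 (us @ v # ws))))"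
  proof (cases us)
    case Nil
    then show ?thesis by (simp add: qleft_lin1)
  next
    case (Cons u us')
    have "lin_on UNIV (scV D) (scM D) (\<lambda>v. C (us' @ v # ws))"
      using len Cons by (intro multilinear_onD[OF C_multilinear[OF C]]) auto
    then show ?thesis
      using Cons lin_on_compose_UNIV[OF _ qleft_lin2] by simp
  qed
qed

lemma insert_shQ_multilinear:
  assumes "j < k"
  shows "multilinear_on UNIV (scV D) (scM D) (Suc k)
    (\<lambda>xs. C (take j xs @ shQ D (xs ! j) (xs ! Suc j) # drop (j + 2) xs))"
proof -
  obtain n where k: "k = Suc n" using assms by (cases k) auto
  have "multilinear_on UNIV (scV D) (scM D) (Suc n) C"
    using C_multilinear[OF C] k by simp
  from multilinear_on_insert[OF this shQ_multilinear, of j] assms k show ?thesis by simp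
qed

end

text \<open>For a fixed degree list the summand is multilinear, so \<open>hsums\<close> collapses to
  it on homogeneous vectors, and the degree is read off the collapsed formula.\<close>

lemma coboundary:
  assumes c: "graded_cochain D k e c"
  defines "C \<equiv> shift_map (grV D) c"
  shows coboundary_cochain: "graded_cochain D (Suc k) e (coboundary_shifted D k e c)"
    and coboundary_homogeneous: "\<lbrakk>homogeneous (grV D) ns xs; length xs = Suc k\<rbrakk> \<Longrightarrow>
      coboundary_shifted D k e c xs =
        qright (C (take k xs)) (xs ! k)
        + sg ((e + int k - 1) * (ns ! 0 - 1)) (qleft (xs ! 0) (C (drop 1 xs)))
        - (\<Sum>j<k. sg (e + int k - 1 + sdeg (take j ns))
             (C (take j xs @ shQ D (xs ! j) (xs ! Suc j) # drop (j + 2) xs)))"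
proof -
  let ?F = "\<lambda>ns xs. qright (C (take k xs)) (xs ! k)
        + sg ((e + int k - 1) * (ns ! 0 - 1)) (qleft (xs ! 0) (C (drop 1 xs)))
        - (\<Sum>j<k. sg (e + int k - 1 + sdeg (take j ns))
             (C (take j xs @ shQ D (xs ! j) (xs ! Suc j) # drop (j + 2) xs)))"
  have C: "graded_cochain D k e C"
    unfolding C_def by (rule graded_cochain_shift[OF c])
  have F: "multilinear_on UNIV (scV D) (scM D) (Suc k) (?F ns)" for ns
    unfolding diff_conv_add_uminus
    by (intro multilinear_on_plus multilinear_on_minus multilinear_on_sum multilinear_on_sg
        M.vector_space qright_multilinear[OF C] qleft_multilinear[OF C]
        insert_shQ_multilinear[OF C]) simp
  have eq: "coboundary_shifted D k e c = hsums (grV D) ?F"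
    by (simp add: coboundary_shifted_def C_def Let_def)
  show hom: "coboundary_shifted D k e c xs = ?F ns xs"
    if "homogeneous (grV D) ns xs" "length xs = Suc k" for ns xs
    unfolding eq by (rule V.hsums_homogeneous[OF that F])
  have "coboundary_shifted D k e c xs \<in> grM D (sum_list ns + e)"
    if h: "homogeneous (grV D) ns xs" and len: "length xs = Suc k" for ns xs
  proof -
    have ns: "length ns = Suc k" using homogeneous_length[OF h] len by simp
    have "C (take k xs) \<in> grM D (sum_list (take k ns) + e)" "xs ! k \<in> grV D (ns ! k)"
      using len by (auto intro!: C_gr[OF C] homogeneous_take homogeneous_nth[OF h] h)
    moreover have "sum_list (take k ns) + ns ! k = sum_list ns"
      using arg_cong[OF take_Suc_conv_app_nth[of k ns], of sum_list] ns by simp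
    ultimately have 1: "qright (C (take k xs)) (xs ! k) \<in> grM D (sum_list ns + e)"
      using ract_gr[of "C (take k xs)" "sum_list (take k ns) + e" "xs ! k" "ns ! k"]
      by (simp add: qright_homogeneous algebra_simps M.G_sg)
    have "C (drop 1 xs) \<in> grM D (sum_list (drop 1 ns) + e)" "xs ! 0 \<in> grV D (ns ! 0)"
      using len by (auto intro!: C_gr[OF C] homogeneous_drop homogeneous_nth[OF h] h simp del: drop_Suc_Cons)
    moreover have "ns ! 0 + sum_list (drop 1 ns) = sum_list ns"
      using ns by (cases ns) auto
    ultimately have 2: "qleft (xs ! 0) (C (drop 1 xs)) \<in> grM D (sum_list ns + e)"
      using act_gr[of "xs ! 0" "ns ! 0" "C (drop 1 xs)" "sum_list (drop 1 ns) + e"]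
      by (simp add: qleft_homogeneous algebra_simps M.G_sg)
    have 3: "C (take j xs @ shQ D (xs ! j) (xs ! Suc j) # drop (j + 2) xs) \<in> grM D (sum_list ns + e)"
      if "j < k" for j
    proof -
      have "xs ! j \<in> grV D (ns ! j)" "xs ! Suc j \<in> grV D (ns ! Suc j)"
        using that len by (auto intro!: homogeneous_nth[OF h])
      then have "shQ D (xs ! j) (xs ! Suc j) \<in> grV D (ns ! j + ns ! Suc j)"
        by (simp add: shQ_homogeneous V.G_sg mul_gr)
      from C_gr[OF C _ insert_homogeneous[OF h _ this]] sum_list_insert[of j ns]
      show ?thesis using that len ns by simp
    qed
    show ?thesis
      unfolding hom[OF h len] diff_conv_add_uminus
      by (intro M.G_add M.G_neg M.G_sum M.G_sg 1 2 3) simp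
  qed
  moreover have "multilinear_on UNIV (scV D) (scM D) (Suc k) (coboundary_shifted D k e c)"
    unfolding eq by (intro V.hsums_multilinear M.vector_space F)
  ultimately show "graded_cochain D (Suc k) e (coboundary_shifted D k e c)"
    by (simp add: graded_cochain_def)
qed

end

section \<open>Contraction with dual bases\<close>

context double_semidirect
begin

context
  fixes es es' :: "('k, 'v, 'm) tilde list"
  assumes dual_bases: "dual_bases D es es'"
begin

lemma dual_basis_length: "length es' = length es"
  using dual_bases by (simp add: dual_bases_def)

lemma tform_dual_basis:
  "\<lbrakk>i < length es; j < length es\<rbrakk> \<Longrightarrow> tform D (es ! i) (es' ! j) = (if i = j then 1 else 0)"
  using dual_bases by (simp add: dual_bases_def)

text \<open>The pairing of the two vectors is \<open>1\<close>, which forces opposite degrees and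
  makes both nonzero; hence \<open>hdeg\<close> returns these degrees.\<close>

lemma dual_basis_degrees:
  assumes "i < length es"
  obtains a where "es ! i \<in> tgr D a" "es' ! i \<in> tgr D (- a)"
    "hdeg (tgr D) (es ! i) = a" "hdeg (tgr D) (es' ! i) = - a"
proof -
  obtain a b where ab: "es ! i \<in> tgr D a" "es' ! i \<in> tgr D b"
    using dual_bases assms dual_basis_length
    unfolding dual_bases_def is_homogeneous_basis_def by (metis nth_mem)
  have ne: "tform D (es ! i) (es' ! i) \<noteq> 0" using tform_dual_basis[OF assms assms] by simp
  then have "b = - a" using tform_zero[OF ab] by linarith
  moreover have "es ! i \<noteq> 0" "es' ! i \<noteq> 0"
    using ne lin_on_0[OF tform_lin1[OF T.G_S[OF ab(2)]] T.S_0]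
      lin_on_0[OF tform_lin2[OF T.G_S[OF ab(1)]] T.S_0] by auto
  ultimately show thesis using that[of a] ab T.hdeg_eq by simp
qed

text \<open>The identity is linear in \<open>u\<close> and holds on \<open>es'\<close> by duality,
  and \<open>es'\<close> spans the carrier.\<close>

lemma dual_basis_expansion:
  assumes "u \<in> tcar D"
  shows "(\<Sum>i<length es. tscale D (tform D (es ! i) u) (es' ! i)) = u"
proof -
  interpret vector_space "tscale D" by (rule T.vector_space)
  have es: "es ! i \<in> tcar D" "es' ! i \<in> tcar D" if "i < length es" for i
    by (rule dual_basis_degrees[OF that]; blast intro: T.G_S)+
  have span: "span (set es') = tcar D"
    using dual_bases by (simp add: dual_bases_def is_homogeneous_basis_def)
  have "u \<in> span (set es')" using assms span by simp
  then have "u \<in> tcar D \<and> (\<Sum>i<length es. tscale D (tform D (es ! i) u) (es' ! i)) = u"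
  proof (induct rule: span_induct_alt)
    case base
    show ?case using lin_on_0[OF tform_lin2[OF es(1)] T.S_0] by simp
  next
    case (step c x v)
    obtain j where j: "j < length es" "x = es' ! j"
      using step(1) dual_basis_length by (metis in_set_conv_nth)
    have "tform D (es ! i) (tscale D c x + v) = (if i = j then c else 0) + tform D (es ! i) v"
      if "i < length es" for i
      using es(2)[OF j(1)] step(2) j
      by (simp add: lin_on_add[OF tform_lin2[OF es(1)[OF that]]] T.S_scale
          lin_on_scale[OF tform_lin2[OF es(1)[OF that]]] tform_dual_basis[OF that j(1)])
    then have "(\<Sum>i<length es. tscale D (tform D (es ! i) (tscale D c x + v)) (es' ! i))
      = (\<Sum>i<length es. (if i = j then tscale D c (es' ! i) else 0)
          + tscale D (tform D (es ! i) v) (es' ! i))"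
      by (intro sum.cong refl) (simp add: scale_left_distrib)
    also have "\<dots> = tscale D c x + v"
      using j step(2) by (simp add: sum.distrib sum.delta)
    finally show ?case
      using step(2) es(2)[OF j(1)] j(2) by (simp add: T.S_add T.S_scale)
  qed
  then show ?thesis ..
qed

text \<open>
  Since the form of \<open>Q\<close> is cyclic, \<open>\<Omega> (e, v\<^sub>1, v\<^sub>2)\<close> is, up to sign, the pairing of \<open>e\<close> with
  \<open>Q (v\<^sub>1, v\<^sub>2)\<close>, so the sum over \<open>e\<close> expands this vector in the dual basis. Of the degree \<open>3\<close> of the
  second form only the parity enters the signs.
\<close>

lemma contracted_tensor_tQ:
  assumes f: "multilinear_on (tcar D) (tscale D) (*) (Suc k) f"
    and f_zero: "\<And>ns vs. \<lbrakk>homogeneous (tgr D) ns vs; length vs = Suc k; sdeg ns \<noteq> - 3\<rbrakk> \<Longrightarrow> f vs = 0"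
    and hom: "homogeneous (tgr D) ns vs" and len: "length vs = k + 2"
  shows "contracted_tensor D es es' 3 (Omega D (tQ D)) f ns vs
    = f (tQ D [vs ! 0, vs ! Suc 0] # drop 2 vs)"
proof -
  obtain v1 v2 w where vs: "vs = v1 # v2 # w" "length w = k"
    using len by (auto simp: length_Suc_conv)
  obtain m1 m2 ms where ns: "ns = m1 # m2 # ms"
    using hom by (auto simp: vs homogeneous_def list_all2_Cons2)
  have h: "v1 \<in> tgr D m1" "v2 \<in> tgr D m2" "homogeneous (tgr D) ms w"
    using hom by (simp_all add: vs ns)
  let ?u = "tQ D [v1, v2]"
  have u: "?u \<in> tgr D (m1 + m2)" by (rule tQ_gr[OF h(1,2)])
  have lin: "lin_on (tcar D) (tscale D) (*) (\<lambda>x. f (x # w))"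
    using multilinear_onD[OF f, of "[]" w] vs T.homogeneous_set[OF h(3)] by simp
  have summand: "sg (- (b - 1 + sdeg ms) * (a - 1) + (- (b - 1 + sdeg ms) + (b - 1)) * sdeg [m1, m2])
        (Omega D (tQ D) (es ! i # [v1, v2]) * f (es' ! i # w))
      = tform D (es ! i) ?u * f (es' ! i # w)"
    if e: "es ! i \<in> tgr D a" "es' ! i \<in> tgr D b" "b = - a" for i a b
  proof -
    have "Omega D (tQ D) [es ! i, v1, v2] = tB D ?u (es ! i)"
      unfolding Omega_tQ_cyclic[OF e(1) h(1,2)] by (simp add: Omega_def)
    also have "\<dots> = - tform D (es ! i) ?u" by (rule tB_eq_minus_tform[OF u e(1)])
    finally have Omega: "Omega D (tQ D) [es ! i, v1, v2] = - tform D (es ! i) ?u" .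
    consider "a + (m1 + m2) \<noteq> 0" | "b - 1 + sdeg ms \<noteq> - 3"
      | "a + (m1 + m2) = 0" "b - 1 + sdeg ms = - 3" by blast
    then show ?thesis
    proof cases
      case 1
      then show ?thesis unfolding Omega using tform_zero[OF e(1) u] by simp
    next
      case 2
      then have "f (es' ! i # w) = 0"
        using h(3) e(2) vs by (intro f_zero[of "b # ms"]) simp_all
      then show ?thesis by simp
    next
      \<comment> \<open>Here neither factor vanishes for reasons of degree. The exponent becomes
        \<open>3 * (a - 1) + (2 - a) * (- a - 2)\<close>, which is odd, and cancels the minus sign
        of \<open>Omega\<close>.\<close>
      case 3
      then have "m1 = - a - m2" by simp
      then show ?thesis
        unfolding Omega 3(2) by (simp add: e(3)) (simp add: sg_def)
    qed
  qed
  have "contracted_tensor D es es' 3 (Omega D (tQ D)) f ns vs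
      = (\<Sum>i<length es. tform D (es ! i) ?u * f (es' ! i # w))"
    unfolding contracted_tensor_def
  proof (intro sum.cong refl)
    fix i assume "i \<in> {..<length es}"
    then obtain a where a: "es ! i \<in> tgr D a" "es' ! i \<in> tgr D (- a)"
      "hdeg (tgr D) (es ! i) = a" "hdeg (tgr D) (es' ! i) = - a"
      by (auto elim: dual_basis_degrees)
    show "(let v = take (3 - 1) vs; w = drop (3 - 1) vs; dv = sdeg (take (3 - 1) ns);
          dw = sdeg (drop (3 - 1) ns); de = hdeg (tgr D) (es ! i) - 1;
          de' = hdeg (tgr D) (es' ! i) - 1; \<omega> = - (de' + dw)
        in sg (\<omega> * de + (\<omega> + de') * dv) (Omega D (tQ D) (es ! i # v) * f (es' ! i # w)))
      = tform D (es ! i) ?u * f (es' ! i # w)"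
      using summand[OF a(1,2) refl] unfolding Let_def a(3,4) by (simp add: vs ns)
  qed
  also have "\<dots> = f ((\<Sum>i<length es. tscale D (tform D (es ! i) ?u) (es' ! i)) # w)"
  proof -
    have es': "es' ! i \<in> tcar D" if "i \<in> {..<length es}" for i
      using that by (auto elim: dual_basis_degrees intro: T.G_S)
    have "f ((\<Sum>i<length es. tscale D (tform D (es ! i) ?u) (es' ! i)) # w)
      = (\<Sum>i<length es. f (tscale D (tform D (es ! i) ?u) (es' ! i) # w))"
      using T.vector_space T.subspace
      by (intro lin_on_sum_apply[OF lin] T.S_scale es') (simp_all add: module_iff_vector_space)
    also have "\<dots> = (\<Sum>i<length es. tform D (es ! i) ?u * f (es' ! i # w))"
      by (intro sum.cong refl lin_on_scale[OF lin] es')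
    finally show ?thesis by simp
  qed
  also have "\<dots> = f (?u # w)"
    using dual_basis_expansion[OF T.G_S[OF u]] by simp
  finally show ?thesis by (simp add: vs)
qed

end

section \<open>The differential\<close>

text \<open>By \<open>tQ_gr\<close> the recorded degree is the right one; its additivity is the
  condition on \<open>mu\<close> in \<open>insert_srot\<close>.\<close>

definition tmu :: "int \<times> ('k, 'v, 'm) tilde \<Rightarrow> int \<times> ('k, 'v, 'm) tilde \<Rightarrow> int \<times> ('k, 'v, 'm) tilde"
  where "tmu p q = (fst p + fst q, tQ D [snd p, snd q])"

lemma tQ_comp_x:
  assumes "u \<in> tgr D m" "v \<in> tgr D n"
  shows "comp_x (tQ D [u, v]) = shQ D (comp_x u) (comp_x v)"
proof -
  have "comp_x u \<in> grV D m" "comp_x v \<in> grV D n" using assms by (simp_all add: tgr_iff)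
  then show ?thesis by (simp add: tQ_homogeneous[OF assms] shQ_homogeneous fst_sg tmul_eq)
qed

lemma tQ_comp_h:
  assumes "u \<in> tgr D m" "v \<in> tgr D n" "b \<in> grM D l"
  shows "comp_h (tQ D [u, v]) b =
    sg (m - 1 + m * (n + l)) (comp_h v (ract D b (comp_x u)))
    + sg (m - 1) (comp_h u (act D (comp_x v) b))"
  using assms
  by (simp add: tQ_homogeneous snd_sg sg_apply tmul_eq sg_add rcoact_def tgr_iff
      vm.lcoact_homogeneous[of _ m _ n _ l])

context
  fixes c :: "'v list \<Rightarrow> 'm" and k :: nat
  assumes c: "graded_cochain D k (2 - int k) c"
begin

abbreviation "C \<equiv> shift_map (grV D) c"
abbreviation "dC \<equiv> coboundary_shifted D k (2 - int k) c"
abbreviation \<Phi> :: "(int \<times> ('k, 'v, 'm) tilde) list \<Rightarrow> 'k" where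
  "\<Phi> ps \<equiv> cyclic_part C (map snd ps)"

lemmas C = graded_cochain_shift[OF c]

text \<open>
  The summands of \<open>h\<^sub>n (C (x\<^sub>1, \<dots>))\<close> with \<open>h\<^sub>n\<close> the component of \<open>Q (u, v)\<close> in \<open>M\<^sup>*\<close>: \<open>h\<close> comes from \<open>v\<close> in
  \<open>right_part\<close> and from \<open>u\<close> in \<open>left_part\<close>. In the latter \<open>h\<close> has to be rotated to the end before the
  result can be compared with the coboundary.
\<close>

definition right_part :: "(int \<times> ('k, 'v, 'm) tilde) list \<Rightarrow> 'k" where
  "right_part ps = (let (m, u) = ps ! k; (n, v) = ps ! Suc k; as = take k ps;
     l = sum_list (map fst as) + (2 - int k) in
     - sg (wsum as + (m - 1 + m * (n + l))) (comp_h v (ract D (C (map (comp_x \<circ> snd) as)) (comp_x u))))"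

definition left_part :: "(int \<times> ('k, 'v, 'm) tilde) list \<Rightarrow> 'k" where
  "left_part ps = (let (m, u) = ps ! k; (n, v) = ps ! Suc k; as = take k ps in
     - sg (wsum as + (m - 1)) (comp_h u (act D (comp_x v) (C (map (comp_x \<circ> snd) as)))))"

lemma homogeneous_comp_x_snd:
  assumes "homogeneous (tgr D) (map fst ps) (map snd ps)"
  shows "homogeneous (grV D) (map fst ps) (map (comp_x \<circ> snd) ps)"
  using homogeneous_comp_x[OF assms] by simp

lemma wsum_eq: "wsum ps = sum_list (map fst ps) - int (length ps)"
  by (induct ps) simp_all

lemma length_Suc_Suc_snoc:
  assumes "length ps = k + 2" obtains as p q where "ps = as @ [p, q]" "length as = k"
proof -
  have "ps = take k ps @ [ps ! k, ps ! Suc k]"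
    using assms by (metis Cons_nth_drop_Suc add_2_eq_Suc' append_take_drop_id drop_all lessI
        less_Suc_eq order_refl)
  then show thesis using that[of "take k ps"] assms by simp
qed

lemma insert_last:
  assumes hom: "homogeneous (tgr D) (map fst ps) (map snd ps)" and len: "length ps = k + 2"
  shows "insert_op tmu k \<Phi> ps = right_part ps + left_part ps"
proof -
  obtain as p q where ps: "ps = as @ [p, q]" "length as = k"
    by (rule length_Suc_Suc_snoc[OF len])
  obtain m u n v where pq: "p = (m, u)" "q = (n, v)" by (cases p, cases q)
  have h: "homogeneous (tgr D) (map fst as) (map snd as)" "u \<in> tgr D m" "v \<in> tgr D n"
    using hom homogeneous_snoc[of _ "map fst as @ [m]" n "map snd as @ [u]" v]
    by (simp_all add: ps pq homogeneous_snoc)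
  have "C (map (comp_x \<circ> snd) as) \<in> grM D (sum_list (map fst as) + (2 - int k))"
    using ps by (intro C_gr[OF C] homogeneous_comp_x_snd h(1)) simp
  from tQ_comp_h[OF h(2,3) this] show ?thesis
    by (simp add: insert_op_def right_part_def left_part_def ps pq nth_append tmu_def
        cyclic_part_def butlast_append sg_add sg_minus sg_diff o_def flip: sg_sg)
qed

lemma coboundary_cyclic_part:
  assumes hom: "homogeneous (tgr D) (map fst ps) (map snd ps)" and len: "length ps = k + 2"
  shows "cyclic_part dC (map snd ps) =
    (\<Sum>j<k. insert_op tmu j \<Phi> ps) + right_part ps + srot left_part ps"
proof -
  obtain qs q where ps: "ps = qs @ [q]" "length qs = Suc k"
    using len by (auto simp: length_Suc_conv_rev)
  obtain n w where q: "q = (n, w)" by (cases q)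
  define ns xs where "ns = map fst qs" and "xs = map (comp_x \<circ> snd) qs"
  have h: "homogeneous (tgr D) ns (map snd qs)" and w: "w \<in> tgr D n"
    using hom by (simp_all add: ps q ns_def homogeneous_snoc)
  have hx: "homogeneous (grV D) ns xs"
    unfolding ns_def xs_def by (rule homogeneous_comp_x_snd[OF h[unfolded ns_def]])
  have len_ns: "length ns = Suc k" "length xs = Suc k" by (simp_all add: ns_def xs_def ps)
  have lin: "lin_on UNIV (scM D) (*) (comp_h w)"
    by (rule dual_lin_on[OF tgr_dual(2)[OF w]])
  have h_sg: "comp_h w (sg i a) = sg i (comp_h w a)" for i a
    by (rule lin_on_apply_sg[OF M.vector_space vector_space_field lin UNIV_I])
  have h_minus: "comp_h w (- a) = - comp_h w a" for a
    using h_sg[of 1 a] by (simp add: sg_def)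
  have h_sum: "comp_h w (sum g A) = (\<Sum>j\<in>A. comp_h w (g j))" for g and A :: "nat set"
    using M.vector_space M.subspace
    by (intro lin_on_sum_apply[OF lin]) (simp_all add: module_iff_vector_space)
  have h_zero: "comp_h w a = 0" if "a \<in> grM D l" "n + l \<noteq> 0" for a l
    using w that by (auto simp: tgr_iff intro: dual_gr_zero)

  have right: "- comp_h w (qright (C (take k xs)) (xs ! k)) = right_part ps"
  proof -
    obtain as p where qs: "qs = as @ [p]" "length as = k"
      using ps(2) by (auto simp: length_Suc_conv_rev)
    obtain m u where p: "p = (m, u)" by (cases p)
    have as: "homogeneous (tgr D) (map fst as) (map snd as)" and u: "u \<in> tgr D m"
      using h by (simp_all add: ns_def qs p homogeneous_snoc)
    define a l where "a = C (map (comp_x \<circ> snd) as)" and "l = sum_list (map fst as) + (2 - int k)"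
    have a: "a \<in> grM D l"
      unfolding a_def l_def using qs by (intro C_gr[OF C] homogeneous_comp_x_snd as) simp
    have x: "comp_x u \<in> grV D m" using u by (simp add: tgr_iff)
    have "right_part ps = - sg (wsum as + (m - 1 + m * (n + l))) (comp_h w (ract D a (comp_x u)))"
      by (simp add: right_part_def ps q qs p nth_append a_def l_def)
    moreover have "comp_h w (qright (C (take k xs)) (xs ! k)) = sg (l - 1) (comp_h w (ract D a (comp_x u)))"
      using qright_homogeneous[OF a x] by (simp add: xs_def qs p nth_append a_def h_sg)
    moreover have "sg (wsum as + (m - 1 + m * (n + l))) (comp_h w (ract D a (comp_x u)))
        = sg (l - 1) (comp_h w (ract D a (comp_x u)))"
    \<comment> \<open>On the support \<open>m * (n + l)\<close> is \<open>- m * m\<close> and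
      cancels \<open>m\<close> modulo 2. Since \<open>c\<close> has degree \<open>2 - k\<close>,
      \<open>l = wsum as + 2\<close>, and \<open>l - 1\<close> is what remains.\<close>
    proof (cases "n + (l + m) = 0")
      case True
      then have "m = - (n + l)" by simp
      moreover have "l = wsum as + 2" using qs by (simp add: l_def wsum_eq)
      ultimately show ?thesis by (auto intro!: sg_cong)
    next
      case False
      then show ?thesis using h_zero[OF ract_gr[OF a x]] by simp
    qed
    ultimately show ?thesis by simp
  qed

  \<comment> \<open>One rotation moves the first vector behind the functional, which is the order in
    which \<open>left_part\<close> reads them. As \<open>deg C\<close> is 1, the sign on the left is
    just \<open>ns ! 0 - 1\<close>; it cancels the shift sign of
    \<open>qleft_homogeneous\<close>.\<close>
  have left: "- comp_h w (sg (ns ! 0 - 1) (qleft (xs ! 0) (C (drop 1 xs)))) = srot left_part ps"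
  proof -
    obtain p bs where qs: "qs = p # bs" "length bs = k"
      using ps(2) by (auto simp: length_Suc_conv)
    obtain m u where p: "p = (m, u)" by (cases p)
    have bs: "homogeneous (tgr D) (map fst bs) (map snd bs)" and u: "u \<in> tgr D m"
      using h by (simp_all add: ns_def qs p)
    define a l where "a = C (map (comp_x \<circ> snd) bs)" and "l = sum_list (map fst bs) + (2 - int k)"
    have a: "a \<in> grM D l"
      unfolding a_def l_def using qs by (intro C_gr[OF C] homogeneous_comp_x_snd bs) simp
    have x: "comp_x u \<in> grV D m" using u by (simp add: tgr_iff)
    have "srot left_part ps = - sg ((m - 1) * (wsum bs + (n - 1)) + (wsum bs + (n - 1)))
        (comp_h w (act D (comp_x u) a))"
      by (simp add: ps q qs(1) p srot_Cons left_part_def nth_append qs(2) a_def sg_minus)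
    moreover have "comp_h w (sg (ns ! 0 - 1) (qleft (xs ! 0) (C (drop 1 xs))))
        = comp_h w (act D (comp_x u) a)"
      using qleft_homogeneous[OF x a] by (simp add: ns_def xs_def qs p a_def h_sg) (simp add: sg_def)
    moreover have "sg ((m - 1) * (wsum bs + (n - 1)) + (wsum bs + (n - 1)))
        (comp_h w (act D (comp_x u) a)) = comp_h w (act D (comp_x u) a)"
    \<comment> \<open>The exponent is \<open>m * (wsum bs + n - 1)\<close>. On the support this
      equals \<open>- m * (m + 3)\<close>, which is even.\<close>
    proof (cases "n + (m + l) = 0")
      case True
      then have "m = - (n + l)" by simp
      moreover have "l = wsum bs + 2" using qs by (simp add: l_def wsum_eq)
      ultimately show ?thesis by (auto simp: sg_def)
    next
      case False
      then show ?thesis using h_zero[OF act_gr[OF x a]] by simp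
    qed
    ultimately show ?thesis by simp
  qed

  \<comment> \<open>The \<open>1\<close> is the shifted degree of \<open>C\<close>, passed by the
    odd letter \<open>Q\<close>. As a sign it is the minus sign of
    \<open>cyclic_part\<close>.\<close>
  have inner: "comp_h w (sg (1 + sdeg (take j ns))
      (C (take j xs @ shQ D (xs ! j) (xs ! Suc j) # drop (j + 2) xs))) = insert_op tmu j \<Phi> ps"
    if j: "j < k" for j
  proof -
    have "snd (qs ! j) \<in> tgr D (fst (qs ! j))" "snd (qs ! Suc j) \<in> tgr D (fst (qs ! Suc j))"
      using homogeneous_nth[OF h, of j] homogeneous_nth[OF h, of "Suc j"] j ps(2) by (simp_all add: ns_def)
    from tQ_comp_x[OF this]
    have "map (comp_x \<circ> snd) (take j qs @ tmu (qs ! j) (qs ! Suc j) # drop (j + 2) qs)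
        = take j xs @ shQ D (xs ! j) (xs ! Suc j) # drop (j + 2) xs"
      using j ps(2) by (simp add: xs_def tmu_def take_map drop_map)
    moreover have "take j ps @ tmu (ps ! j) (ps ! Suc j) # drop (j + 2) ps
        = (take j qs @ tmu (qs ! j) (qs ! Suc j) # drop (j + 2) qs) @ [q]"
      using j ps by (simp add: nth_append)
    ultimately have "\<Phi> (take j ps @ tmu (ps ! j) (ps ! Suc j) # drop (j + 2) ps)
        = - comp_h w (C (take j xs @ shQ D (xs ! j) (xs ! Suc j) # drop (j + 2) xs))"
      by (simp add: cyclic_part_def q butlast_append o_def)
    moreover have "wsum (take j ps) = sdeg (take j ns)"
      using j ps by (simp add: ns_def take_map sdeg_map_fst)
    ultimately show ?thesis
      by (simp add: insert_op_def h_sg) (simp add: sg_def)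
  qed

  have dC: "dC xs = qright (C (take k xs)) (xs ! k) + sg (ns ! 0 - 1) (qleft (xs ! 0) (C (drop 1 xs)))
      + - (\<Sum>j<k. sg (1 + sdeg (take j ns))
          (C (take j xs @ shQ D (xs ! j) (xs ! Suc j) # drop (j + 2) xs)))"
    using coboundary_homogeneous[OF c hx len_ns(2)] by simp
  have "cyclic_part dC (map snd ps) = - comp_h w (dC xs)"
    by (simp add: cyclic_part_def ps q xs_def butlast_append)
  also have "\<dots> = - comp_h w (qright (C (take k xs)) (xs ! k))
      - comp_h w (sg (ns ! 0 - 1) (qleft (xs ! 0) (C (drop 1 xs))))
      + (\<Sum>j<k. comp_h w (sg (1 + sdeg (take j ns))
           (C (take j xs @ shQ D (xs ! j) (xs ! Suc j) # drop (j + 2) xs))))"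
    unfolding dC by (simp only: lin_on_add[OF lin UNIV_I UNIV_I] h_minus h_sum) simp
  also have "\<dots> = right_part ps + srot left_part ps + (\<Sum>j<k. insert_op tmu j \<Phi> ps)"
    using right left inner by simp
  finally show ?thesis by simp
qed

text \<open>A nonzero value needs \<open>k + 1\<close> arguments whose degrees add up to
  \<open>k - 2\<close>, so their total shifted degree is
  \<open>k - 2 - (k + 1) = - 3\<close>.\<close>

lemma Omega_tilde_zero:
  assumes hom: "homogeneous (tgr D) ns vs" and len: "length vs = Suc k" and "sdeg ns \<noteq> - 3"
  shows "Omega_tilde D C vs = 0"
proof -
  define ps where "ps = zip ns vs"
  have ps: "map fst ps = ns" "map snd ps = vs" "length ps = Suc k"
    using len homogeneous_length[OF hom] by (simp_all add: ps_def)
  have "sum_list ns + (2 - int k) \<noteq> 0"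
    using assms(3) sdeg_map_fst[of ps] wsum_eq[of ps] ps by simp
  then have "\<Phi> (rotate r ps) = 0" for r
    using cyclic_part_zero[OF C homogeneous_rotate[OF hom, of r]] len ps
    by (simp add: sum_list_rotate flip: rotate_map)
  then show ?thesis
    using Omega_tilde_homogeneous[OF C, of ps] hom ps by (simp add: cyc_def)
qed

lemma d_P_Omega_tilde:
  assumes "dual_bases D es es'" and vs: "length vs = k + 2" "set vs \<subseteq> tcar D"
  shows "d_P D es es' (Omega_tilde D C) vs = Omega_tilde D dC vs"
proof -
  \<comment> \<open>The unsimplified \<open>take 0\<close> and \<open>0 + 2\<close> match
    \<open>multilinear_on_insert\<close> at slot \<open>0\<close>.\<close>
  let ?G = "\<lambda>vs. Omega_tilde D C (take 0 vs @ tQ D [vs ! 0, vs ! Suc 0] # drop (0 + 2) vs)"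
  let ?F = "\<lambda>ns vs. \<Sum>r<k + 2. sg (sdeg (take r ns) * sdeg (drop r ns)) (?G (rotate r vs))"
  have "multilinear_on (tcar D) (tscale D) (*) (k + 2) ?G"
    by (rule multilinear_on_insert[OF Omega_tilde_multilinear[OF C] tQ_multilinear])
      (simp_all add: tQ_tcar)
  then have F: "multilinear_on (tcar D) (tscale D) (*) (k + 2) (?F ns)" for ns
    by (intro multilinear_on_sum multilinear_on_sg multilinear_on_rotate vector_space_field)
  have "d_P D es es' (Omega_tilde D C) vs = hsums (tgr D) ?F vs"
    unfolding d_P_def pinczon_bracket_def
  proof (rule T.hsums_cong[OF vs(2)])
    fix ns xs assume *: "homogeneous (tgr D) ns xs" "length xs = length vs"
    have "contracted_tensor D es es' 3 (Omega D (tQ D)) (Omega_tilde D C) (rotate r ns) (rotate r xs)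
      = Omega_tilde D C (tQ D [rotate r xs ! 0, rotate r xs ! Suc 0] # drop 2 (rotate r xs))" for r
      by (rule contracted_tensor_tQ[OF assms(1) Omega_tilde_multilinear[OF C] Omega_tilde_zero
            homogeneous_rotate[OF *(1)]])
        (use * vs(1) in simp_all)
    then show "(\<Sum>r<length xs. sg (sdeg (take r ns) * sdeg (drop r ns))
        (contracted_tensor D es es' 3 (Omega D (tQ D)) (Omega_tilde D C) (rotate r ns) (rotate r xs)))
      = ?F ns xs"
      unfolding *(2) vs(1) by (intro sum.cong refl) (simp add: numeral_2_eq_2)
  qed
  also have "\<dots> = Omega_tilde D dC vs"
  proof (rule T.multilinear_on_eqI[where f = "hsums (tgr D) ?F" and g = "Omega_tilde D dC",
        OF _ _ _ vs(2,1)])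
    show "multilinear_on (tcar D) (tscale D) (*) (k + 2) (hsums (tgr D) ?F)"
      by (intro T.hsums_multilinear vector_space_field F)
    show "multilinear_on (tcar D) (tscale D) (*) (k + 2) (Omega_tilde D dC)"
      using Omega_tilde_multilinear[OF coboundary_cochain[OF c]] by simp
    fix ns vs assume hom: "homogeneous (tgr D) ns vs" and len: "length vs = k + 2"
    define ps where "ps = zip ns vs"
    have ps: "map fst ps = ns" "map snd ps = vs" "length ps = k + 2"
      using len homogeneous_length[OF hom] by (simp_all add: ps_def)
    have rot: "homogeneous (tgr D) (map fst (rotate r ps)) (map snd (rotate r ps))" for r
      using homogeneous_rotate[OF hom, of r] ps by (simp flip: rotate_map)
    \<comment> \<open>The list with its first two letters merged is again homogeneous, so the form
      of the extension expands into a cyclic sum over it.\<close>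
    have G: "?G (map snd qs) = insert_op tmu 0 (cyc \<Phi>) qs"
      if h: "homogeneous (tgr D) (map fst qs) (map snd qs)" and "length qs = k + 2" for qs
    proof -
      obtain p q rest where qs: "qs = p # q # rest"
        using \<open>length qs = k + 2\<close> by (auto simp: length_Suc_conv)
      have "homogeneous (tgr D) (map fst (tmu p q # rest)) (map snd (tmu p q # rest))"
        using h by (simp add: qs tmu_def tQ_gr)
      from Omega_tilde_homogeneous[OF C this] show ?thesis
        using \<open>length qs = k + 2\<close> by (simp add: insert_op_def qs tmu_def)
    qed
    have "hsums (tgr D) ?F vs = ?F ns vs"
      by (rule T.hsums_homogeneous[OF hom len F])
    also have "\<dots> = cyc (insert_op tmu 0 (cyc \<Phi>)) ps"
        unfolding cyc_def[of "insert_op tmu 0 (cyc \<Phi>)"] ps(3)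
    proof (intro sum.cong refl)
      fix r
      have "?G (rotate r vs) = insert_op tmu 0 (cyc \<Phi>) (rotate r ps)"
        using G[OF rot, of r] ps by (simp flip: rotate_map)
      then show "sg (sdeg (take r ns) * sdeg (drop r ns)) (?G (rotate r vs))
        = sg (wsum (take r ps) * wsum (drop r ps)) (insert_op tmu 0 (cyc \<Phi>) (rotate r ps))"
        by (simp add: ps(1)[symmetric] take_map drop_map sdeg_map_fst)
    qed
    also have "\<dots> = (\<Sum>j\<le>k. cyc (insert_op tmu j \<Phi>) ps)"
      by (rule cyc_insert_cyc[OF _ ps(3)]) (simp add: tmu_def)
    also have "\<dots> = (\<Sum>j<k. cyc (insert_op tmu j \<Phi>) ps) + cyc (insert_op tmu k \<Phi>) ps"
      by (simp flip: lessThan_Suc_atMost)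
    also have "cyc (insert_op tmu k \<Phi>) ps = cyc (\<lambda>ps. right_part ps + left_part ps) ps"
      by (intro cyc_cong insert_last rot) (simp add: ps)
    \<comment> \<open>Under \<open>cyc\<close> a rotation costs nothing; it brings the left part
      into the shape of the outer term of the coboundary.\<close>
    also have "\<dots> = cyc right_part ps + cyc (srot left_part) ps"
      by (simp add: cyc_plus cyc_srot)
    also have "(\<Sum>j<k. cyc (insert_op tmu j \<Phi>) ps) + \<dots>
      = cyc (\<lambda>ps. (\<Sum>j<k. insert_op tmu j \<Phi> ps) + right_part ps + srot left_part ps) ps"
      by (simp add: cyc_plus cyc_sum add.assoc)
    also have "\<dots> = cyc (\<lambda>ps. cyclic_part dC (map snd ps)) ps"
      by (intro cyc_cong coboundary_cyclic_part[symmetric] rot) (simp add: ps)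
    also have "\<dots> = Omega_tilde D dC (map snd ps)"
      using ps hom by (intro Omega_tilde_homogeneous[OF coboundary_cochain[OF c], symmetric]) simp_all
    finally show "hsums (tgr D) ?F vs = Omega_tilde D dC vs" by (simp add: ps)
  qed
  finally show ?thesis .
qed

end

section \<open>Linearity in the cochain\<close>

lemma harrison_cochain_graded: "harrison_cochain D k d c \<Longrightarrow> graded_cochain D k d c"
  by (simp add: harrison_cochain_def graded_cochain_def)

lemma graded_cochain_lincomb:
  assumes "graded_cochain D k d c" "graded_cochain D k d c'"
  shows "graded_cochain D k d (\<lambda>xs. scM D r (c xs) + c' xs)"
proof -
  interpret scM: vector_space "scM D" by (rule M.vector_space)
  have "lin_on UNIV (scM D) (scM D) (scM D r)"
    by (simp add: lin_on_def scM.scale_right_distrib mult.commute)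
  from multilinear_on_plus[OF M.vector_space
      multilinear_on_compose[OF C_multilinear[OF assms(1)] this UNIV_I] C_multilinear[OF assms(2)]]
  show ?thesis
    unfolding graded_cochain_def
    by (auto intro!: M.G_add M.G_scale C_gr[OF assms(1)] C_gr[OF assms(2)])
qed

text \<open>On homogeneous vectors each form is a cyclic sum of \<open>cyclic_part\<close>, which is
  linear in the cochain because \<open>shift_map\<close> only multiplies its values by a sign. This
  route avoids the nested sums in \<open>tilde_ext\<close>.\<close>

lemma Omega_tilde_lincomb:
  assumes c: "graded_cochain D k d c" and c': "graded_cochain D k d c'"
    and vs: "length vs = k + 1" "set vs \<subseteq> tcar D"
  shows "Omega_tilde D (shift_map (grV D) (\<lambda>xs. scM D r (c xs) + c' xs)) vs =
    r * Omega_tilde D (shift_map (grV D) c) vs + Omega_tilde D (shift_map (grV D) c') vs"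
proof -
  let ?c = "\<lambda>xs. scM D r (c xs) + c' xs"
  have c'': "graded_cochain D k d ?c" by (rule graded_cochain_lincomb[OF c c'])
  have lin: "lin_on UNIV (*) (*) ((*) r)" by (simp add: lin_on_def algebra_simps)
  have ml: "multilinear_on (tcar D) (tscale D) (*) (Suc k) (Omega_tilde D (shift_map (grV D) c))"
    if "graded_cochain D k d c" for c
    by (rule Omega_tilde_multilinear[OF graded_cochain_shift[OF that]])
  show ?thesis
  proof (rule T.multilinear_on_eqI[OF ml[OF c''] _ _ vs(2)])
    show "multilinear_on (tcar D) (tscale D) (*) (Suc k) (\<lambda>vs.
      r * Omega_tilde D (shift_map (grV D) c) vs + Omega_tilde D (shift_map (grV D) c') vs)"
      by (intro multilinear_on_plus vector_space_field multilinear_on_compose[OF ml[OF c] lin] ml[OF c']) simp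
    fix ns vs assume hom: "homogeneous (tgr D) ns vs" and len: "length vs = Suc k"
    define ps where "ps = zip ns vs"
    have ps: "map fst ps = ns" "map snd ps = vs" "length ps = Suc k"
      using len homogeneous_length[OF hom] by (simp_all add: ps_def)
    have Omega: "Omega_tilde D (shift_map (grV D) c) vs
        = cyc (\<lambda>ps. cyclic_part (shift_map (grV D) c) (map snd ps)) ps"
      if "graded_cochain D k d c" for c
      using Omega_tilde_homogeneous[OF graded_cochain_shift[OF that], of ps] ps hom by simp
    have part: "cyclic_part (shift_map (grV D) ?c) us =
        r * cyclic_part (shift_map (grV D) c) us + cyclic_part (shift_map (grV D) c') us"
      if h: "homogeneous (tgr D) ms us" "length us = Suc k" for ms us
    proof -
      obtain us' v where us: "us = us' @ [v]" using h(2) by (auto simp: length_Suc_conv_rev)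
      obtain ms' n where ms: "ms = ms' @ [n]"
        using homogeneous_length[OF h(1)] h(2) by (auto simp: length_Suc_conv_rev)
      have h': "homogeneous (grV D) ms' (map comp_x us')" "v \<in> tgr D n"
        using h(1) by (simp_all add: us ms homogeneous_snoc homogeneous_comp_x)
      note sh = V.shift_map_homogeneous[OF M.vector_space C_multilinear h'(1)]
      have lin_h: "lin_on UNIV (scM D) (*) (comp_h v)"
        by (rule dual_lin_on[OF tgr_dual(2)[OF h'(2)]])
      have "length (map comp_x us') = k" using h(2) us by simp
      then show ?thesis
        by (simp add: cyclic_part_def us butlast_append sh[OF c] sh[OF c'] sh[OF c'']
            lin_on_apply_sg[OF M.vector_space vector_space_field lin_h UNIV_I]
            lin_on_add[OF lin_h] lin_on_scale[OF lin_h] sg_add)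
          (simp add: sg_def)
    qed
    have "cyc (\<lambda>ps. cyclic_part (shift_map (grV D) ?c) (map snd ps)) ps
      = cyc (\<lambda>ps. r * cyclic_part (shift_map (grV D) c) (map snd ps)
          + cyclic_part (shift_map (grV D) c') (map snd ps)) ps"
      using homogeneous_rotate[OF hom] ps len
      by (intro cyc_cong part[of "map fst (rotate _ ps)"]) (simp_all flip: rotate_map)
    also have "\<dots> = r * cyc (\<lambda>ps. cyclic_part (shift_map (grV D) c) (map snd ps)) ps
        + cyc (\<lambda>ps. cyclic_part (shift_map (grV D) c') (map snd ps)) ps"
      by (simp add: cyc_plus) (simp add: cyc_def sum_distrib_left sg_mult)
    finally show "Omega_tilde D (shift_map (grV D) ?c) vs =
      r * Omega_tilde D (shift_map (grV D) c) vs + Omega_tilde D (shift_map (grV D) c') vs"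
      by (simp add: Omega[OF c] Omega[OF c'] Omega[OF c''])
  qed (simp add: vs)
qed

end

text \<open>The last conjunct supplies the linearity that a morphism of complexes has besides
  commuting with the differentials. Identities of forms are claimed on \<open>tcar D\<close>, the
  true carrier of the double.\<close>

theorem proposition5p6:
  fixes D :: "('k::field_char_0, 'v::ab_group_add, 'm::ab_group_add) alg_mod"
    and es es' :: "('k, 'v, 'm) tilde list"
    and k :: nat
  assumes "comm_alg_mod D"
    and "dual_bases D es es'"
  shows
    "(\<forall>c. harrison_cochain D k (2 - int k) c \<longrightarrow>
        cyclic_form D (k + 1) (Omega_tilde D (shift_map (grV D) c)) \<and>
        (\<forall>vs. length vs = k + 2 \<and> set vs \<subseteq> tcar D \<longrightarrow>
           d_P D es es' (Omega_tilde D (shift_map (grV D) c)) vs =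
           Omega_tilde D (coboundary_shifted D k (2 - int k) c) vs)) \<and>
     (\<forall>c c' r vs. harrison_cochain D k (2 - int k) c \<and> harrison_cochain D k (2 - int k) c' \<and>
        length vs = k + 1 \<and> set vs \<subseteq> tcar D \<longrightarrow>
        Omega_tilde D (shift_map (grV D) (\<lambda>xs. scM D r (c xs) + c' xs)) vs =
        r * Omega_tilde D (shift_map (grV D) c) vs + Omega_tilde D (shift_map (grV D) c') vs)"
proof -
  interpret double_semidirect D by unfold_locales (rule assms(1))
  show ?thesis
  proof (intro conjI allI impI)
    fix c assume "harrison_cochain D k (2 - int k) c"
    note c = harrison_cochain_graded[OF this]
    show "cyclic_form D (k + 1) (Omega_tilde D (shift_map (grV D) c))"
      using Omega_tilde_cyclic[OF graded_cochain_shift[OF c]] by simp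
    fix vs :: "('k, 'v, 'm) tilde list" assume "length vs = k + 2 \<and> set vs \<subseteq> tcar D"
    then show "d_P D es es' (Omega_tilde D (shift_map (grV D) c)) vs =
        Omega_tilde D (coboundary_shifted D k (2 - int k) c) vs"
      by (intro d_P_Omega_tilde[OF c assms(2)]) simp_all
  next
    fix c c' r and vs :: "('k, 'v, 'm) tilde list"
    assume "harrison_cochain D k (2 - int k) c \<and> harrison_cochain D k (2 - int k) c' \<and>
      length vs = k + 1 \<and> set vs \<subseteq> tcar D"
    then show "Omega_tilde D (shift_map (grV D) (\<lambda>xs. scM D r (c xs) + c' xs)) vs =
        r * Omega_tilde D (shift_map (grV D) c) vs + Omega_tilde D (shift_map (grV D) c') vs"
      by (intro Omega_tilde_lincomb[where d = "2 - int k"]) (simp_all add: harrison_cochain_graded)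
  qed
qed

end
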